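(* Let $\nu$ be a semi-neutral probability measure on $\mathcal O(\mathbb C^2,0)$ with compact support, and suppose the origin lies in the random Fatou set. Then for $\mu$-almost every $\omega$: every limit $g=\lim_{k\to\infty}f^{n_k}_\omega$ (locally uniform limit on $U_\omega$) has $dg(0)$ of rank one; and there exists $\rho>0$ such that for every $z\in\mathbb B_\rho$ the stable set $\mathbb W^s_\omega(z)$ is, near $z$, a one-dimensional complex submanifold.
   Context: $\mathcal O(\mathbb C^m,0)$: germs at $0$ of holomorphic self-maps of $\mathbb C^m$ fixing $0$, with the inductive limit topology (fix strictly decreasing $\varepsilon_n\to0$; $X_n$ = bounded holomorphic maps on $\mathbb B_{\varepsilon_n}$ with sup-metric $d_n$; $U$ open iff $U\cap X_n$ is $d_n$-open for all $n$). $\Omega=\mathrm{supp}(\nu)^{\mathbb N}$, $\mu=\nu^{\otimes\mathbb N}$, for $\omega=(f_1,f_2,\dots)$, $f^n_\omega=f_n\circ\cdots\circ f_1$. Origin in random Fatou set: for $\mu$-a.e. $\omega$ the family $\{f^n_\omega\}$ is defined and normal on some neighbourhood of $0$. Semi-neutral: for the i.i.d. matrix products of $df(0)$, $f\sim\nu$, the Lyapunov indices (given by Oseledets: a.s. $((M^n_\omega)^*M^n_\omega)^{1/2n}$ converges to a Hermitian matrix with eigenvalues $e^{\kappa_1}>\dots>e^{\kappa_s}$, multiplicities $\alpha_i$) satisfy $\kappa_1=0$ and $\alpha_1\neq m$. Fix $R>0$ such that all $f\in\mathrm{supp}(\nu)$ are holomorphic and bounded on $\mathbb B_R$ (exists by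 compactness); $D_\omega=\{z\in\mathbb B_R: f^n_\omega(z)\text{ defined and in }\mathbb B_R\ \forall n\ge0\}$, $F_\omega=\mathrm{int}(D_\omega)$, $U_\omega$ = connected component of $F_\omega$ containing $0$. Stable set: $\mathbb W^s_\omega(z)=\{w\in U_\omega: \|f^n_\omega(z)-f^n_\omega(w)\|\to0\}$. *)

theory Defs
  imports "HOL-Analysis.Analysis" "HOL-Probability.Probability"
begin

type_synonym c2 = "complex^2"

definition holo_on :: "c2 set \<Rightarrow> (c2 \<Rightarrow> c2) \<Rightarrow> bool" where
  "holo_on S f \<longleftrightarrow> (\<forall>z\<in>S. \<exists>L. (f has_derivative L) (at z) \<and>
       (\<forall>(c::complex) v. L (c *s v) = c *s L v))"

definition germ_class :: "(c2 \<Rightarrow> c2) \<Rightarrow> (c2 \<Rightarrow> c2) set" where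
  "germ_class f = {h. \<exists>s>0. holo_on (ball 0 s) h \<and> (\<forall>z\<in>ball 0 s. h z = f z)}"

typedef germ = "{G. \<exists>r>0. \<exists>f. holo_on (ball 0 r) f \<and> f 0 = 0 \<and> G = germ_class f}"
proof -
  have "holo_on (ball 0 1) (\<lambda>_. 0)"
    unfolding holo_on_def by (auto intro!: exI[of _ "\<lambda>_. 0"] has_derivative_const)
  then show ?thesis by (intro exI[of _ "germ_class (\<lambda>_. 0)"]) (auto intro!: exI[of _ "1::real"])
qed

definition represents :: "(c2 \<Rightarrow> c2) \<Rightarrow> c2 set \<Rightarrow> germ \<Rightarrow> bool" where
  "represents h W g \<longleftrightarrow> open W \<and> 0 \<in> W \<and> holo_on W h \<and> Rep_germ g = germ_class h"

definition bdd_rep :: "(c2 \<Rightarrow> c2) \<Rightarrow> real \<Rightarrow> germ \<Rightarrow> bool" where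
  "bdd_rep h r g \<longleftrightarrow> represents h (ball 0 r) g \<and> bounded (h ` ball 0 r)"

definition eps :: "nat \<Rightarrow> real" where "eps n = 1 / real (Suc n)"

definition Xn :: "nat \<Rightarrow> germ set" where
  "Xn n = {g. \<exists>h. bdd_rep h (eps n) g}"

definition repn :: "nat \<Rightarrow> germ \<Rightarrow> c2 \<Rightarrow> c2" where
  "repn n g = (SOME h. bdd_rep h (eps n) g)"

definition dn :: "nat \<Rightarrow> germ \<Rightarrow> germ \<Rightarrow> real" where
  "dn n g g' = (SUP z\<in>ball 0 (eps n). dist (repn n g z) (repn n g' z))"

definition germ_open :: "germ set \<Rightarrow> bool" where
  "germ_open U \<longleftrightarrow> (\<forall>n. \<forall>g\<in>U \<inter> Xn n. \<exists>\<delta>>0. \<forall>g'\<in>Xn n. dn n g g' < \<delta> \<longrightarrow> g' \<in> U)"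

definition germ_top :: "germ topology" where
  "germ_top = topology_generated_by {U. germ_open U}"

definition supp :: "germ measure \<Rightarrow> germ set" where
  "supp \<nu> = {g. \<forall>U. openin germ_top U \<and> g \<in> U \<longrightarrow> emeasure \<nu> U > 0}"

definition dgerm :: "germ \<Rightarrow> complex^2^2" where
  "dgerm g = (let L = (SOME L. \<exists>h W. represents h W g \<and> (h has_derivative L) (at 0))
              in (\<chi> i j. (L (axis j 1)) $ i))"

definition adj :: "complex^2^2 \<Rightarrow> complex^2^2" where
  "adj M = (\<chi> i j. cnj (M $ j $ i))"

definition cinner :: "c2 \<Rightarrow> c2 \<Rightarrow> complex" where
  "cinner v w = (\<Sum>i\<in>UNIV. cnj (v $ i) * w $ i)"

definition psd :: "complex^2^2 \<Rightarrow> bool" where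
  "psd B \<longleftrightarrow> adj B = B \<and> (\<forall>v. 0 \<le> Re (cinner v (B *v v)))"

primrec cmatpow :: "complex^2^2 \<Rightarrow> nat \<Rightarrow> complex^2^2" where
  "cmatpow B 0 = mat 1"
| "cmatpow B (Suc n) = B ** cmatpow B n"

definition psd_root :: "nat \<Rightarrow> complex^2^2 \<Rightarrow> complex^2^2" where
  "psd_root k A = (THE B. psd B \<and> cmatpow B k = A)"

text \<open>M^n_omega = df_n(0) ... df_1(0), with f_{k+1} = omega k\<close>
primrec prodM :: "(nat \<Rightarrow> germ) \<Rightarrow> nat \<Rightarrow> complex^2^2" where
  "prodM \<omega> 0 = mat 1"
| "prodM \<omega> (Suc n) = dgerm (\<omega> n) ** prodM \<omega> n"

definition semi_neutral :: "germ measure \<Rightarrow> bool" where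
  "semi_neutral \<nu> \<longleftrightarrow> (AE \<omega> in PiM UNIV (\<lambda>_::nat. \<nu>). (\<forall>n. \<omega> n \<in> supp \<nu>) \<longrightarrow>
     (\<exists>\<Lambda>. (\<lambda>n. psd_root (2*n) (adj (prodM \<omega> n) ** prodM \<omega> n)) \<longlonglongrightarrow> \<Lambda>
        \<and> (\<exists>v. v \<noteq> 0 \<and> \<Lambda> *v v = v)
        \<and> (\<forall>c v. v \<noteq> 0 \<and> \<Lambda> *v v = c *s v \<longrightarrow> Re c \<le> 1)
        \<and> {v. \<Lambda> *v v = v} \<noteq> UNIV))"

primrec compo :: "(nat \<Rightarrow> c2 \<Rightarrow> c2) \<Rightarrow> nat \<Rightarrow> c2 \<Rightarrow> c2" where
  "compo h 0 = id"
| "compo h (Suc n) = h n \<circ> compo h n"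

definition normal_fam :: "c2 set \<Rightarrow> (c2 \<Rightarrow> c2) set \<Rightarrow> bool" where
  "normal_fam V F \<longleftrightarrow> (\<forall>s::nat \<Rightarrow> c2 \<Rightarrow> c2. (\<forall>n. s n \<in> F) \<longrightarrow> (\<exists>(r::nat\<Rightarrow>nat) (g::c2\<Rightarrow>c2). strict_mono r \<and>
      (\<forall>K. compact K \<and> K \<subseteq> V \<longrightarrow> uniform_limit K (s \<circ> r) g sequentially)))"

definition random_fatou :: "germ measure \<Rightarrow> bool" where
  "random_fatou \<nu> \<longleftrightarrow> (AE \<omega> in PiM UNIV (\<lambda>_::nat. \<nu>). (\<forall>n. \<omega> n \<in> supp \<nu>) \<longrightarrow>
     (\<exists>r>0. \<exists>h W. (\<forall>n. represents (h n) (W n) (\<omega> n)) \<and>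
        (\<forall>z\<in>ball 0 r. \<forall>n. compo h n z \<in> W n) \<and>
        normal_fam (ball 0 r) (range (compo h))))"

definition R_ok :: "germ measure \<Rightarrow> real \<Rightarrow> bool" where
  "R_ok \<nu> R \<longleftrightarrow> R > 0 \<and> (\<forall>g\<in>supp \<nu>. \<exists>h. bdd_rep h R g)"

definition repR :: "real \<Rightarrow> germ \<Rightarrow> c2 \<Rightarrow> c2" where
  "repR R g = (SOME h. bdd_rep h R g)"

primrec iterR :: "real \<Rightarrow> (nat \<Rightarrow> germ) \<Rightarrow> nat \<Rightarrow> c2 \<Rightarrow> c2" where
  "iterR R \<omega> 0 z = z"
| "iterR R \<omega> (Suc n) z = repR R (\<omega> n) (iterR R \<omega> n z)"

definition Dom :: "real \<Rightarrow> (nat \<Rightarrow> germ) \<Rightarrow> c2 set" where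
  "Dom R \<omega> = {z \<in> ball 0 R. \<forall>n. iterR R \<omega> n z \<in> ball 0 R}"

definition Uom :: "real \<Rightarrow> (nat \<Rightarrow> germ) \<Rightarrow> c2 set" where
  "Uom R \<omega> = connected_component_set (interior (Dom R \<omega>)) 0"

definition Ws :: "real \<Rightarrow> (nat \<Rightarrow> germ) \<Rightarrow> c2 \<Rightarrow> c2 set" where
  "Ws R \<omega> z = {w \<in> Uom R \<omega>. (\<lambda>n. norm (iterR R \<omega> n z - iterR R \<omega> n w)) \<longlonglongrightarrow> 0}"

definition c_indep :: "c2 set \<Rightarrow> bool" where
  "c_indep B \<longleftrightarrow> (\<forall>c. (\<Sum>v\<in>B. c v *s v) = 0 \<longrightarrow> (\<forall>v\<in>B. c v = 0))"

definition crank :: "(c2 \<Rightarrow> c2) \<Rightarrow> nat" where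
  "crank L = Max {card B | B. finite B \<and> B \<subseteq> range L \<and> c_indep B}"

definition biholo :: "c2 set \<Rightarrow> (c2 \<Rightarrow> c2) \<Rightarrow> bool" where
  "biholo N \<Phi> \<longleftrightarrow> open N \<and> holo_on N \<Phi> \<and> inj_on \<Phi> N \<and> open (\<Phi> ` N)
     \<and> holo_on (\<Phi> ` N) (inv_into N \<Phi>)"

definition one_dim_submfd_near :: "c2 set \<Rightarrow> c2 \<Rightarrow> bool" where
  "one_dim_submfd_near S z \<longleftrightarrow> z \<in> S \<and>
     (\<exists>N \<Phi>. z \<in> N \<and> biholo N \<Phi> \<and> \<Phi> ` (S \<inter> N) = \<Phi> ` N \<inter> {w. w $ 1 = 0})"

end

theory Submission
  imports Defs "HOL-Complex_Analysis.Complex_Analysis"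
begin

text \<open>
  Write M_n for the derivative of f^n at 0 along omega. The Lyapunov hypothesis gives det M_n \<rightarrow> 0,
  while norm M_n does not decay exponentially. If M_n were small at some time with positive
  probability, then, since the tails of the product are bounded, the set of omega for which the norm of
  M_m is at most 1/2 for all large m would have positive probability; by stationarity a
  positive density of times would belong to it for some omega, each contributing a factor 1/2, and the
  norm would decay exponentially. So the norm of M_n stays away from 0, and every limit g has a
  derivative of rank one at 0.

  For almost every omega there are infinitely many times n_k at which the shifted sequence is equicontinuous
  on one fixed ball. Let g be a limit of f^(n_k). If g had rank two somewhere near 0, the maps from time n_k
  to a much later time n_l would accumulate at a map h with h o g = g, hence at the identity, although their
  determinants at 0 can be made smaller than 1/2. So g has constant rank one near 0 and its fibres
  are discs; by equicontinuity along n_k they are the stable sets.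
\<close>

(* The formal power series notation makes iterated matrix indexing ambiguous. *)
no_notation fps_nth (infixl \<open>$\<close> 75)

subsection \<open>Positive semidefinite roots of 2 by 2 matrices\<close>

text \<open>Recurrence is extracted from stationarity and independence. Among the first n times the
  expected number of visits to an event of probability p is n p, so with probability at least p / 2
  there are at least n p / 2 visits; passing to the limsup, this holds for infinitely many n on an
  event of probability at least p / 2. A single \<open>\<omega>\<close> there that also satisfies
  the almost sure hypotheses gives the contradiction. The radius on which the shifted sequence is
  equicontinuous is random and may shrink along some times. Exhausting by the radii R / (j + 2)
  shows that almost surely one of them recurs infinitely often, which is all that the comparison of
  two late times requires. The complement of \<open>supp \<nu>\<close> is a union of null open sets,
  possibly uncountable, so its measure is not taken for granted: independence shows that the event
  that all \<open>\<omega> n\<close> lie in \<open>supp \<nu>\<close> is null, and the claim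
  vacuous, or the support has full measure.\<close>

lemma mat2_eq_iff:
  "(A::'a^2^2) = B \<longleftrightarrow> A$1$1 = B$1$1 \<and> A$1$2 = B$1$2 \<and> A$2$1 = B$2$1 \<and> A$2$2 = B$2$2"
  by (auto simp: vec_eq_iff forall_2)

lemma mat2_mult_entry: "((A::'a::semiring_1^2^2) ** B) $ i $ j = A$i$1 * B$1$j + A$i$2 * B$2$j"
  by (simp add: matrix_matrix_mult_def sum_2)

lemma mat2_vec_entry: "((A::complex^2^2) *v v) $ i = A$i$1 * v$1 + A$i$2 * v$2"
  by (simp add: matrix_vector_mult_def sum_2)

lemma mat1_entries [simp]:
  "(mat 1 :: complex^2^2) $ 1 $ 1 = 1" "(mat 1 :: complex^2^2) $ 1 $ 2 = 0"
  "(mat 1 :: complex^2^2) $ 2 $ 1 = 0" "(mat 1 :: complex^2^2) $ 2 $ 2 = 1"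
  by (simp_all add: mat_def)

lemma trace_2: "trace (A::'a::semiring_1^2^2) = A$1$1 + A$2$2"
  by (simp add: trace_def sum_2)

lemma cmod_square_eq: "(complex_of_real (cmod z))\<^sup>2 = z * cnj z"
  by (metis complex_norm_square of_real_power)

lemma adj_entry: "adj M $ i $ j = cnj (M $ j $ i)"
  by (simp add: adj_def)

lemma adj_self_iff:
  "adj B = B \<longleftrightarrow> (\<exists>x y. B$1$1 = complex_of_real x \<and> B$2$2 = complex_of_real y) \<and> B$2$1 = cnj (B$1$2)"
proof
  assume "adj B = B"
  then have e: "cnj (B$1$1) = B$1$1" "cnj (B$2$2) = B$2$2" "cnj (B$1$2) = B$2$1"
    by (simp_all add: adj_def mat2_eq_iff)
  have "B$1$1 = complex_of_real (Re (B$1$1))" "B$2$2 = complex_of_real (Re (B$2$2))"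
    using e(1,2) by (simp_all add: complex_eq_iff)
  then show "(\<exists>x y. B$1$1 = complex_of_real x \<and> B$2$2 = complex_of_real y) \<and> B$2$1 = cnj (B$1$2)"
    using e(3) by force
next
  assume "(\<exists>x y. B$1$1 = complex_of_real x \<and> B$2$2 = complex_of_real y) \<and> B$2$1 = cnj (B$1$2)"
  then show "adj B = B" by (auto simp: adj_def mat2_eq_iff)
qed

text \<open>The diagonal entries x, y have nonnegative sum and, since x y is at least |w|^2,
  nonnegative product, so both are nonnegative; the cross term is then absorbed by the two squares.
  In this form positivity passes to a limit through its trace and determinant.\<close>

lemma psd_of_trace_det:
  assumes "adj B = B" "trace B = complex_of_real s" "det B = complex_of_real p" "0 \<le> s" "0 \<le> p"
  shows "psd B"
proof -
  obtain x y where xy: "B$1$1 = complex_of_real x" "B$2$2 = complex_of_real y" "B$2$1 = cnj (B$1$2)"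
    using assms(1) adj_self_iff by blast
  define w where "w = B$1$2"
  have s: "x + y = s" using assms(2) by (simp add: trace_2 xy flip: of_real_add)
  have p: "x * y - (cmod w)\<^sup>2 = p"
  proof -
    have "complex_of_real (x * y - (cmod w)\<^sup>2) = complex_of_real p"
      using assms(3) by (simp add: det_2 xy w_def cmod_square_eq)
    then show ?thesis by (simp only: of_real_eq_iff)
  qed
  have xy0: "x * y \<ge> (cmod w)\<^sup>2" using p assms by simp
  have "0 \<le> x * y" using xy0 zero_le_power2[of "cmod w"] by linarith
  then have x0: "x \<ge> 0" and y0: "y \<ge> 0"
    using s assms(4) by (auto simp: zero_le_mult_iff)
  have "0 \<le> Re (cinner v (B *v v))" for v
  proof -
    let ?a = "cmod (v$1)" and ?b = "cmod (v$2)"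
    have "cinner v (B *v v) = complex_of_real (x * ?a\<^sup>2 + y * ?b\<^sup>2) + (cnj (v$1) * w * v$2 + cnj (cnj (v$1) * w * v$2))"
      by (simp add: cinner_def sum_2 mat2_vec_entry xy w_def cmod_square_eq algebra_simps)
    then have e: "Re (cinner v (B *v v)) = x * ?a\<^sup>2 + y * ?b\<^sup>2 + 2 * Re (cnj (v$1) * w * v$2)"
      by (simp add: algebra_simps)
    have "\<bar>Re (cnj (v$1) * w * v$2)\<bar> \<le> ?a * cmod w * ?b"
      by (metis abs_Re_le_cmod norm_mult complex_mod_cnj)
    also have "\<dots> \<le> ?a * (sqrt x * sqrt y) * ?b"
      by (intro mult_right_mono mult_left_mono)
        (use xy0 in \<open>auto simp: real_sqrt_mult[symmetric] real_le_rsqrt\<close>)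
    finally have 1: "\<bar>Re (cnj (v$1) * w * v$2)\<bar> \<le> (sqrt x * ?a) * (sqrt y * ?b)" by (simp add: mult_ac)
    have 2: "2 * ((sqrt x * ?a) * (sqrt y * ?b)) \<le> (sqrt x * ?a)\<^sup>2 + (sqrt y * ?b)\<^sup>2"
      using sum_squares_bound[of "sqrt x * ?a" "sqrt y * ?b"] by (simp add: mult_ac)
    have 3: "(sqrt x * ?a)\<^sup>2 + (sqrt y * ?b)\<^sup>2 = x * ?a\<^sup>2 + y * ?b\<^sup>2"
      using x0 y0 by (simp add: power_mult_distrib)
    show ?thesis unfolding e using 1 2 3 by linarith
  qed
  then show ?thesis using assms(1) by (simp add: psd_def)
qed

lemma psd_entries:
  assumes "psd B"
  obtains x y where "B$1$1 = complex_of_real x" "B$2$2 = complex_of_real y" "B$2$1 = cnj (B$1$2)"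
    "0 \<le> x" "0 \<le> y" "(cmod (B$1$2))\<^sup>2 \<le> x * y"
proof -
  obtain x y where xy: "B$1$1 = complex_of_real x" "B$2$2 = complex_of_real y" "B$2$1 = cnj (B$1$2)"
    using assms adj_self_iff psd_def by blast
  define w where "w = B$1$2"
  have pos: "0 \<le> Re (cinner v (B *v v))" for v using assms psd_def by blast
  have form: "Re (cinner v (B *v v)) = x * (cmod (v$1))\<^sup>2 + y * (cmod (v$2))\<^sup>2 + 2 * Re (cnj (v$1) * w * v$2)" for v
  proof -
    have "cinner v (B *v v) = complex_of_real (x * (cmod (v$1))\<^sup>2 + y * (cmod (v$2))\<^sup>2) + (cnj (v$1) * w * v$2 + cnj (cnj (v$1) * w * v$2))"
      by (simp add: cinner_def sum_2 mat2_vec_entry xy w_def cmod_square_eq algebra_simps)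
    then show ?thesis by (simp add: algebra_simps)
  qed
  have x0: "0 \<le> x" using pos[of "vector [1,0]"] unfolding form by simp
  have y0: "0 \<le> y" using pos[of "vector [0,1]"] unfolding form by simp
  \<comment> \<open>The vector (-t w, 1) aligns the phase of the cross term, leaving a polynomial in
    t. Its minimiser is t = 1/x; for x = 0 it is y - 2 t |w|^2, which a large t makes negative
    unless w = 0.\<close>
  have q: "0 \<le> x * t\<^sup>2 * (cmod w)\<^sup>2 + y - 2 * t * (cmod w)\<^sup>2" for t :: real
  proof -
    have "Re (cnj (- of_real t * w) * w * 1) = - t * (cmod w)\<^sup>2"
      by (simp add: cmod_def power2_eq_square algebra_simps)
    then show ?thesis
      using pos[of "vector [- of_real t * w, 1]"] unfolding form
      by (simp add: norm_mult power_mult_distrib algebra_simps)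
  qed
  have "(cmod w)\<^sup>2 \<le> x * y"
  proof (cases "x = 0")
    case True
    show ?thesis
    proof (rule ccontr)
      assume "\<not> ?thesis"
      then have w: "cmod w \<noteq> 0" using True by auto
      define t where "t = (y + 1) / (cmod w)\<^sup>2"
      have "t * (cmod w)\<^sup>2 = y + 1" using w by (simp add: t_def)
      moreover have "0 \<le> y - 2 * (t * (cmod w)\<^sup>2)"
        using q[of t] True by (simp add: mult.assoc)
      ultimately show False using y0 by linarith
    qed
  next
    case False
    then have "x > 0" using x0 by simp
    then show ?thesis using q[of "1/x"]
      by (simp add: power2_eq_square field_simps)
  qed
  then show ?thesis using that xy x0 y0 w_def by blast
qed

text \<open>Eigenvalues are recorded only by their sum and product. Here r is the square root of the
  discriminant trace^2 - 4 det, and r is at most the trace because the determinant is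
  nonnegative.\<close>

lemma psd_eigenvalues:
  assumes "psd B"
  obtains c d where "0 \<le> d" "d \<le> c" "trace B = complex_of_real (c + d)" "det B = complex_of_real (c * d)"
proof -
  obtain x y where xy: "B$1$1 = complex_of_real x" "B$2$2 = complex_of_real y" "B$2$1 = cnj (B$1$2)"
    "0 \<le> x" "0 \<le> y" "(cmod (B$1$2))\<^sup>2 \<le> x * y" using psd_entries[OF assms] by blast
  define w where "w = cmod (B$1$2)"
  define r where "r = sqrt ((x - y)\<^sup>2 + 4 * w\<^sup>2)"
  have r2: "r\<^sup>2 = (x - y)\<^sup>2 + 4 * w\<^sup>2" unfolding r_def by simp
  have r0: "r \<ge> 0" unfolding r_def by simp
  have "r\<^sup>2 \<le> (x + y)\<^sup>2" unfolding r2 using xy(6) w_def by (simp add: power2_eq_square algebra_simps)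
  then have rle: "r \<le> x + y" using xy by (simp add: abs_le_square_iff[symmetric] r0)
  have "((x + y + r)/2) * ((x + y - r)/2) = ((x+y)\<^sup>2 - r\<^sup>2)/4"
    by (simp add: power2_eq_square algebra_simps)
  also have "\<dots> = x * y - w\<^sup>2" unfolding r2 by (simp add: power2_eq_square field_simps)
  finally have prd: "((x + y + r)/2) * ((x + y - r)/2) = x * y - w\<^sup>2" .
  have "det B = complex_of_real (x * y - w\<^sup>2)"
    by (simp add: det_2 xy w_def cmod_square_eq)
  then have "det B = complex_of_real ((x + y + r)/2 * ((x + y - r)/2))" unfolding prd .
  moreover have "trace B = complex_of_real ((x + y + r)/2 + (x + y - r)/2)"
    by (simp add: trace_2 xy field_simps)
  ultimately show ?thesis
    using that[of "(x + y - r)/2" "(x + y + r)/2"] rle r0 by simp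
qed

lemma psd_trace_zero:
  assumes "psd B" "trace B = 0" shows "B = 0"
proof -
  obtain x y where xy: "B$1$1 = complex_of_real x" "B$2$2 = complex_of_real y" "B$2$1 = cnj (B$1$2)"
    "0 \<le> x" "0 \<le> y" "(cmod (B$1$2))\<^sup>2 \<le> x * y" using psd_entries[OF assms(1)] by blast
  have "x + y = 0" using assms(2) by (simp add: trace_2 xy flip: of_real_add)
  then have "x = 0" "y = 0" using xy by linarith+
  then show ?thesis using xy by (simp add: mat2_eq_iff)
qed

text \<open>Coefficients (p, q) with B^k = p B + q I, obtained from B^2 = t B - e I.\<close>

fun ch_coeffs :: "real \<Rightarrow> real \<Rightarrow> nat \<Rightarrow> real \<times> real" where
  "ch_coeffs t e 0 = (0, 1)"
| "ch_coeffs t e (Suc k) = (t * fst (ch_coeffs t e k) + snd (ch_coeffs t e k), - e * fst (ch_coeffs t e k))"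

text \<open>A root of the characteristic polynomial obeys the same quadratic relation as the matrix,
  hence the same recursion for its powers.\<close>

lemma ch_coeffs_scalar:
  assumes "c * c = t * c - e"
  shows "c ^ k = fst (ch_coeffs t e k) * c + snd (ch_coeffs t e k)"
proof (induction k)
  case (Suc k)
  have "c ^ Suc k = fst (ch_coeffs t e k) * (c * c) + snd (ch_coeffs t e k) * c"
    by (simp add: Suc algebra_simps)
  then show ?case unfolding assms by (simp add: algebra_simps)
qed simp


text \<open>Cayley-Hamilton in dimension two. Writing B^k linearly in B is what later allows B to be
  recovered from B^k.\<close>

lemma cmatpow_entry:
  assumes t: "trace B = complex_of_real t" and e: "det B = complex_of_real e"
  shows "cmatpow B k $ i $ j = complex_of_real (fst (ch_coeffs t e k)) * B$i$j
    + complex_of_real (snd (ch_coeffs t e k)) * mat 1 $ i $ j"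
proof -
  define a b c d where abcd: "a = B$1$1" "b = B$1$2" "c = B$2$1" "d = B$2$2"
  have td: "a + d = complex_of_real t" "a * d - b * c = complex_of_real e"
    using t e by (simp_all add: trace_2 det_2 abcd)
  have "cmatpow B k = (\<chi> i j. complex_of_real (fst (ch_coeffs t e k)) * B$i$j
    + complex_of_real (snd (ch_coeffs t e k)) * mat 1 $ i $ j)"
  proof (induction k)
    case 0
    then show ?case by (simp add: mat2_eq_iff)
  next
    case (Suc k)
    show ?case
      unfolding cmatpow.simps Suc
      by (simp add: mat2_eq_iff mat2_mult_entry abcd[symmetric] td[symmetric] algebra_simps)
  qed
  then show ?thesis by simp
qed

lemma det_cmatpow: "det (cmatpow B k) = det B ^ k"
  by (induction k) (simp_all add: det_mul)

lemma trace_cmatpow: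
  assumes t: "trace B = complex_of_real (c + d)" and e: "det B = complex_of_real (c * d)"
  shows "trace (cmatpow B k) = complex_of_real (c ^ k + d ^ k)"
proof -
  let ?p = "fst (ch_coeffs (c + d) (c * d) k)" and ?q = "snd (ch_coeffs (c + d) (c * d) k)"
  have "c ^ k = ?p * c + ?q" "d ^ k = ?p * d + ?q"
    by (rule ch_coeffs_scalar, simp add: algebra_simps)+
  then have "c ^ k + d ^ k = ?p * (c + d) + 2 * ?q" by (simp add: algebra_simps)
  moreover have "trace (cmatpow B k) = complex_of_real ?p * trace B + 2 * complex_of_real ?q"
    by (simp add: trace_2 cmatpow_entry[OF t e] algebra_simps)
  ultimately show ?thesis unfolding t by simp
qed

text \<open>This coefficient is the sum of c^i d^(k-1-i), that is (c^k - d^k) / (c - d) for distinct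
  eigenvalues. The recursion p_(k+1) = d p_k + c^k covers a double eigenvalue as well.\<close>

lemma ch_coeffs_pos:
  assumes "0 \<le> d" "d \<le> c" "0 < c" "1 \<le> k"
  shows "0 < fst (ch_coeffs (c + d) (c * d) k)"
proof -
  have "fst (ch_coeffs (c + d) (c * d) k) \<ge> 0 \<and>
    fst (ch_coeffs (c + d) (c * d) (Suc k)) = d * fst (ch_coeffs (c + d) (c * d) k) + c ^ k" for k
  proof (induction k)
    case (Suc k)
    have "c ^ Suc k = fst (ch_coeffs (c + d) (c * d) (Suc k)) * c + snd (ch_coeffs (c + d) (c * d) (Suc k))"
      by (rule ch_coeffs_scalar) (simp add: algebra_simps)
    then have "fst (ch_coeffs (c + d) (c * d) (Suc (Suc k)))
        = d * fst (ch_coeffs (c + d) (c * d) (Suc k)) + c ^ Suc k"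
      by (subst ch_coeffs.simps(2)) (simp add: algebra_simps del: ch_coeffs.simps)
    moreover have "fst (ch_coeffs (c + d) (c * d) (Suc k)) \<ge> 0"
      using Suc assms by (simp del: ch_coeffs.simps)
    ultimately show ?case by blast
  qed simp
  note h = this
  from assms(4) obtain m where k: "k = Suc m" by (cases k) auto
  have "0 < c ^ m" using assms by simp
  then show ?thesis using h[of m] assms(1) unfolding k by (simp add: add_nonneg_pos del: ch_coeffs.simps)
qed

lemma sum_prod_ordered_unique:
  fixes a b c d :: real
  assumes "a + b = c + d" "a * b = c * d" "b \<le> a" "d \<le> c"
  shows "a = c \<and> b = d"
proof -
  have "(a - c) * (a - d) = a * a - a * (c + d) + c * d" by (simp add: algebra_simps)
  also have "\<dots> = 0" unfolding assms(1,2)[symmetric] by (simp add: algebra_simps)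
  finally have "a = c \<or> a = d" by simp
  then show ?thesis using assms by auto
qed

text \<open>Trace and determinant of B^k determine the ordered pair (c^k, d^k), hence (c, d) and the
  coefficients in B^k = p B + q I. As p > 0 for c > 0, this can be solved for B; for c = 0 the trace
  vanishes and so does B.\<close>

lemma psd_root_unique:
  assumes "psd B" "psd B'" "cmatpow B k = cmatpow B' k" "1 \<le> k"
  shows "B = B'"
proof -
  obtain c d where B: "0 \<le> d" "d \<le> c" "trace B = complex_of_real (c + d)" "det B = complex_of_real (c * d)"
    using psd_eigenvalues assms(1) by blast
  obtain c' d' where B': "0 \<le> d'" "d' \<le> c'" "trace B' = complex_of_real (c' + d')" "det B' = complex_of_real (c' * d')"
    using psd_eigenvalues assms(2) by blast
  have "complex_of_real (c ^ k + d ^ k) = complex_of_real (c' ^ k + d' ^ k)"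
    using trace_cmatpow B(3,4) B'(3,4) assms(3) by metis
  then have 1: "c ^ k + d ^ k = c' ^ k + d' ^ k" by (simp only: of_real_eq_iff)
  have "complex_of_real ((c * d) ^ k) = complex_of_real ((c' * d') ^ k)"
    using det_cmatpow[of B k] det_cmatpow[of B' k] B(4) B'(4) assms(3) by simp
  then have 2: "c ^ k * d ^ k = c' ^ k * d' ^ k"
    by (simp only: of_real_eq_iff power_mult_distrib)
  have "c ^ k = c' ^ k \<and> d ^ k = d' ^ k"
    by (rule sum_prod_ordered_unique[OF 1 2]) (use B B' in \<open>auto intro: power_mono\<close>)
  then have cd: "c = c'" "d = d'"
    using B B' assms(4) by (auto dest!: power_eq_imp_eq_base)
  show ?thesis
  proof (cases "c = 0")
    case True
    then have "trace B = 0" "trace B' = 0" using B B' cd by auto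
    then show ?thesis using assms psd_trace_zero by metis
  next
    case False
    let ?p = "fst (ch_coeffs (c + d) (c * d) k)"
    have "?p > 0" using False B assms(4) by (intro ch_coeffs_pos) auto
    moreover have "complex_of_real ?p * B$i$j = complex_of_real ?p * B'$i$j" for i j
      using cmatpow_entry[OF B(3,4), of k i j] cmatpow_entry[OF B'(3,4), of k i j] assms(3) cd by auto
    ultimately show ?thesis by (simp add: mat2_eq_iff)
  qed
qed

text \<open>The same identity read backwards: with c, d the k-th roots of the eigenvalues of A, the
  only candidate is (A - q I) / p. Its trace c + d and determinant c d make it positive.\<close>

lemma psd_root_exists:
  assumes "psd A" "1 \<le> k"
  shows "\<exists>B. psd B \<and> cmatpow B k = A"
proof -
  obtain a b where A: "0 \<le> b" "b \<le> a" "trace A = complex_of_real (a + b)" "det A = complex_of_real (a * b)"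
    using psd_eigenvalues assms(1) by blast
  show ?thesis
  proof (cases "a = 0")
    case True
    then have "A = 0" using A psd_trace_zero assms(1) by auto
    moreover have "cmatpow 0 k = 0" using assms(2) by (cases k) (auto simp: mat2_eq_iff mat2_mult_entry)
    ultimately show ?thesis using assms(1) by auto
  next
    case False
    define c d where "c = root k a" and "d = root k b"
    have cd: "c ^ k = a" "d ^ k = b" "0 \<le> d" "d \<le> c" "0 < c"
      using A False assms(2) by (auto simp: c_def d_def)
    let ?p = "fst (ch_coeffs (c + d) (c * d) k)" and ?q = "snd (ch_coeffs (c + d) (c * d) k)"
    define p q where "p = ?p" and "q = ?q"
    have p: "p > 0" unfolding p_def using cd assms(2) by (intro ch_coeffs_pos) auto
    have ck: "a = p * c + q" unfolding cd(1)[symmetric] p_def q_def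
      by (rule ch_coeffs_scalar) (simp add: algebra_simps)
    have dk: "b = p * d + q" unfolding cd(2)[symmetric] p_def q_def
      by (rule ch_coeffs_scalar) (simp add: algebra_simps)
    define B where "B = (\<chi> i j. (A$i$j - complex_of_real q * mat 1$i$j) / complex_of_real p)"
    have AB: "A$i$j = complex_of_real p * B$i$j + complex_of_real q * mat 1$i$j" for i j
      using p by (simp add: B_def)
    have t: "trace B = complex_of_real (c + d)"
    proof -
      have "complex_of_real p * trace B = trace A - 2 * complex_of_real q"
        by (simp add: trace_2 AB algebra_simps)
      also have "\<dots> = complex_of_real p * complex_of_real (c + d)"
        unfolding A(3) ck dk by (simp add: algebra_simps)
      finally show ?thesis using p by simp
    qed
    have e: "det B = complex_of_real (c * d)"
    proof -
      have "complex_of_real (p * p) * det B = det A - complex_of_real q * trace A + complex_of_real (q * q)"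
        by (simp add: trace_2 det_2 AB algebra_simps)
      also have "\<dots> = complex_of_real (p * p) * complex_of_real (c * d)"
        unfolding A(3,4) ck dk by (simp add: algebra_simps)
      finally show ?thesis using p by simp
    qed
    have "adj B = B"
    proof -
      have "adj A = A" using assms(1) psd_def by blast
      then obtain x y where "A$1$1 = complex_of_real x" "A$2$2 = complex_of_real y" "A$2$1 = cnj (A$1$2)"
        using adj_self_iff by blast
      then show ?thesis by (simp add: adj_def B_def mat2_eq_iff)
    qed
    then have "psd B" using t e cd by (intro psd_of_trace_det[of B "c + d" "c * d"]) auto
    moreover have "cmatpow B k = A"
      by (simp add: mat2_eq_iff cmatpow_entry[OF t e] AB p_def q_def)
    ultimately show ?thesis by blast
  qed
qed

lemma psd_root_works:
  assumes "psd A" "1 \<le> k"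
  shows "psd (psd_root k A) \<and> cmatpow (psd_root k A) k = A"
proof -
  have "\<exists>!B. psd B \<and> cmatpow B k = A"
    using psd_root_exists[OF assms] psd_root_unique assms(2) by metis
  then show ?thesis unfolding psd_root_def by (rule theI')
qed

lemma psd_adj_mult: "psd (adj M ** M)"
proof (rule psd_of_trace_det)
  let ?s = "(cmod (M$1$1))\<^sup>2 + (cmod (M$2$1))\<^sup>2 + (cmod (M$1$2))\<^sup>2 + (cmod (M$2$2))\<^sup>2"
  show "adj (adj M ** M) = adj M ** M"
    by (simp add: mat2_eq_iff mat2_mult_entry adj_def mult.commute)
  show "trace (adj M ** M) = complex_of_real ?s"
    by (simp add: trace_2 mat2_mult_entry adj_def cmod_square_eq mult_ac)
  show "det (adj M ** M) = complex_of_real ((cmod (det M))\<^sup>2)"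
    by (simp add: det_mul cmod_square_eq, simp add: det_2 adj_def algebra_simps)
qed auto


section \<open>Eigenvalues, the entrywise norm and the Oseledets limit\<close>

lemma kernel_2:
  fixes N :: "complex^2^2"
  shows "(\<exists>v. v \<noteq> 0 \<and> N *v v = 0) \<longleftrightarrow> det N = 0"
proof
  assume "\<exists>v. v \<noteq> 0 \<and> N *v v = 0"
  then obtain v where v: "v \<noteq> 0" "N *v v = 0" by blast
  have 1: "N$1$1 * v$1 + N$1$2 * v$2 = 0" "N$2$1 * v$1 + N$2$2 * v$2 = 0"
    using v(2) mat2_vec_entry[of N v] by (metis zero_index)+
  have "det N * v$1 = N$2$2 * (N$1$1 * v$1 + N$1$2 * v$2) - N$1$2 * (N$2$1 * v$1 + N$2$2 * v$2)"
    by (simp add: det_2 algebra_simps)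
  moreover have "det N * v$2 = N$1$1 * (N$2$1 * v$1 + N$2$2 * v$2) - N$2$1 * (N$1$1 * v$1 + N$1$2 * v$2)"
    by (simp add: det_2 algebra_simps)
  ultimately have "det N * v$1 = 0" "det N * v$2 = 0" unfolding 1 by simp_all
  then show "det N = 0" using v(1) by (auto simp: vec_eq_iff forall_2)
next
  assume d: "det N = 0"
  \<comment> \<open>Each vector is annihilated by one row of N, and by the other row because the
    determinant vanishes. Both are zero only if N = 0.\<close>
  define w1 w2 :: "complex^2" where "w1 = vector [N$1$2, - (N$1$1)]" and "w2 = vector [N$2$2, - (N$2$1)]"
  have "N *v w1 = 0" "N *v w2 = 0"
    using d by (auto simp: vec_eq_iff forall_2 mat2_vec_entry w1_def w2_def det_2 algebra_simps)
  moreover have "N *v (vector [1, 0]) = 0" if "w1 = 0" "w2 = 0"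
    using that by (auto simp: vec_eq_iff forall_2 mat2_vec_entry w1_def w2_def)
  moreover have "(vector [1, 0] :: complex^2) \<noteq> 0" by (simp add: vec_eq_iff forall_2)
  ultimately show "\<exists>v. v \<noteq> 0 \<and> N *v v = 0" by metis
qed

lemma eigenvalue_2:
  fixes A :: "complex^2^2"
  shows "(\<exists>v. v \<noteq> 0 \<and> A *v v = z *s v) \<longleftrightarrow> z * z - trace A * z + det A = 0"
proof -
  define N where "N = (\<chi> i j. A$i$j - z * mat 1 $ i $ j)"
  have "N *v v = 0 \<longleftrightarrow> A *v v = z *s v" for v
    by (simp add: vec_eq_iff forall_2 mat2_vec_entry N_def algebra_simps)
  moreover have "det N = z * z - trace A * z + det A"
    by (simp add: det_2 trace_2 N_def algebra_simps)
  ultimately show ?thesis using kernel_2[of N] by simp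
qed

text \<open>The entrywise l1 norm: submultiplicative, an upper bound for the operator norm, and
  measurable as soon as the entries are.\<close>

definition msize :: "complex^2^2 \<Rightarrow> real" where
  "msize M = cmod (M$1$1) + cmod (M$1$2) + cmod (M$2$1) + cmod (M$2$2)"

lemma msize_nonneg: "0 \<le> msize M"
  by (simp add: msize_def)

lemma msize_mult: "msize (A ** B) \<le> msize A * msize B"
proof -
  have e: "cmod ((A ** B)$i$j) \<le> cmod (A$i$1) * cmod (B$1$j) + cmod (A$i$2) * cmod (B$2$j)" for i j
    using norm_triangle_ineq[of "A$i$1 * B$1$j" "A$i$2 * B$2$j"] by (simp add: mat2_mult_entry norm_mult)
  have "msize (A ** B) \<le> (cmod (A$1$1) + cmod (A$2$1)) * (cmod (B$1$1) + cmod (B$1$2))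
     + (cmod (A$1$2) + cmod (A$2$2)) * (cmod (B$2$1) + cmod (B$2$2))"
    unfolding msize_def using e[of 1 1] e[of 1 2] e[of 2 1] e[of 2 2] by (simp add: algebra_simps)
  also have "\<dots> \<le> msize A * msize B"
    unfolding msize_def by (simp add: algebra_simps add_nonneg_nonneg)
  finally show ?thesis .
qed

text \<open>The Lyapunov information carried by the Oseledets limit is extracted through trace and
  determinant only: det P_n is the n-th root of |det M_n|, and det (P_n - I) tends to 0.\<close>

lemma oseledets_limit_consequences:
  fixes M :: "nat \<Rightarrow> complex^2^2"
  assumes lim: "(\<lambda>n. psd_root (2*n) (adj (M n) ** M n)) \<longlonglongrightarrow> \<Lambda>"
    and ev: "v \<noteq> 0" "\<Lambda> *v v = v"
    and le: "\<And>c v. v \<noteq> 0 \<and> \<Lambda> *v v = c *s v \<Longrightarrow> Re c \<le> 1"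
    and ne: "{v. \<Lambda> *v v = v} \<noteq> UNIV"
  shows "(\<lambda>n. det (M n)) \<longlonglongrightarrow> 0"
    and "\<And>C \<theta>. 0 < \<theta> \<Longrightarrow> \<theta> < 1 \<Longrightarrow> eventually (\<lambda>n. C * \<theta> ^ n < msize (M n)) sequentially"
proof -
  define P where "P n = psd_root (2*n) (adj (M n) ** M n)" for n
  \<comment> \<open>At n = 0 the root has order 0 and nothing is known about it, so all facts about
    \<open>P n\<close> start at n = 1.\<close>
  have P: "psd (P n)" "cmatpow (P n) (2*n) = adj (M n) ** M n" if "1 \<le> n" for n
    using psd_root_works[OF psd_adj_mult, of "2*n" "M n"] that unfolding P_def by auto
  have "\<forall>n. \<exists>c d. 1 \<le> n \<longrightarrow> 0 \<le> d \<and> d \<le> c \<and> trace (P n) = complex_of_real (c + d) \<and> det (P n) = complex_of_real (c * d)"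
    using P(1) psd_eigenvalues by metis
  then obtain c d where cd: "\<And>n. 1 \<le> n \<Longrightarrow> 0 \<le> d n" "\<And>n. 1 \<le> n \<Longrightarrow> d n \<le> c n"
    "\<And>n. 1 \<le> n \<Longrightarrow> trace (P n) = complex_of_real (c n + d n)"
    "\<And>n. 1 \<le> n \<Longrightarrow> det (P n) = complex_of_real (c n * d n)" by metis
  have Plim: "P \<longlonglongrightarrow> \<Lambda>" using lim unfolding P_def .
  have ent: "(\<lambda>n. P n $ i $ j) \<longlonglongrightarrow> \<Lambda> $ i $ j" for i j
    by (intro tendsto_vec_nth Plim)
  have trl: "(\<lambda>n. trace (P n)) \<longlonglongrightarrow> trace \<Lambda>"
    unfolding trace_2 by (intro tendsto_intros ent)
  have detl: "(\<lambda>n. det (P n)) \<longlonglongrightarrow> det \<Lambda>"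
    unfolding det_2 by (intro tendsto_intros ent)
  have adjl: "adj \<Lambda> = \<Lambda>"
  proof -
    have "(\<lambda>n. P n $ i $ j) \<longlonglongrightarrow> cnj (\<Lambda> $ j $ i)" for i j
    proof (rule Lim_transform_eventually)
      show "(\<lambda>n. cnj (P n $ j $ i)) \<longlonglongrightarrow> cnj (\<Lambda> $ j $ i)" by (intro tendsto_intros ent)
      show "eventually (\<lambda>n. cnj (P n $ j $ i) = P n $ i $ j) sequentially"
        using eventually_ge_at_top[of 1]
      proof eventually_elim
        case (elim n)
        have "adj (P n) = P n" using P(1)[OF elim] psd_def by blast
        then show ?case using adj_entry[of "P n" i j] by simp
      qed
    qed
    then have "cnj (\<Lambda> $ j $ i) = \<Lambda> $ i $ j" for i j
      using ent LIMSEQ_unique by blast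
    then show ?thesis by (simp add: adj_def mat2_eq_iff)
  qed
  have evq: "\<exists>s\<ge>0. trace \<Lambda> = complex_of_real s" "\<exists>p\<ge>0. det \<Lambda> = complex_of_real p"
  proof -
    have cl: "closed (complex_of_real ` {0..})"
      by (intro closed_injective_linear_image) (auto intro: linearI simp: inj_on_def scaleR_conv_of_real)
    have "trace \<Lambda> \<in> complex_of_real ` {0..}"
    proof (rule closed_sequentially[OF cl _ LIMSEQ_ignore_initial_segment[OF trl, of 1]])
      fix n show "trace (P (n + 1)) \<in> complex_of_real ` {0..}"
        using cd(1,2,3)[of "n+1"] by (intro image_eqI[of _ _ "c (n+1) + d (n+1)"]) auto
    qed
    then show "\<exists>s\<ge>0. trace \<Lambda> = complex_of_real s" by auto
    have "det \<Lambda> \<in> complex_of_real ` {0..}"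
    proof (rule closed_sequentially[OF cl _ LIMSEQ_ignore_initial_segment[OF detl, of 1]])
      fix n show "det (P (n + 1)) \<in> complex_of_real ` {0..}"
        using cd(1,2,4)[of "n+1"] by (intro image_eqI[of _ _ "c (n+1) * d (n+1)"]) auto
    qed
    then show "\<exists>p\<ge>0. det \<Lambda> = complex_of_real p" by auto
  qed
  then have "psd \<Lambda>" using psd_of_trace_det adjl by metis
  then obtain a b where ab: "0 \<le> b" "b \<le> a" "trace \<Lambda> = complex_of_real (a + b)" "det \<Lambda> = complex_of_real (a * b)"
    using psd_eigenvalues by blast
  have eig: "(\<exists>v. v \<noteq> 0 \<and> \<Lambda> *v v = z *s v) \<longleftrightarrow> (z - a) * (z - b) = 0" for z
    unfolding eigenvalue_2 ab by (simp add: algebra_simps)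
  obtain u where "u \<noteq> 0" "\<Lambda> *v u = complex_of_real a *s u" using eig[of a] by auto
  then have "a \<le> 1" using le[of u "complex_of_real a"] by simp
  \<comment> \<open>1 is an eigenvalue of \<open>\<Lambda>\<close> and a, the larger eigenvalue, is
    at most 1; hence a = 1.\<close>
  have "(1 - complex_of_real a) * (1 - complex_of_real b) = 0"
    using eig[of 1] ev by auto
  then have "a = 1 \<or> b = 1" by auto
  then have a1: "a = 1" using \<open>a \<le> 1\<close> ab(2) by auto
  \<comment> \<open>If b = 1 as well, \<open>\<Lambda>\<close> - I is Hermitian with zero trace and
    determinant, hence zero, so \<open>\<Lambda>\<close> would fix every vector.\<close>
  have "b \<noteq> 1"
  proof
    assume b1: "b = 1"
    define N where "N = (\<chi> i j. \<Lambda>$i$j - mat 1 $ i $ j)"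
    have ent: "\<Lambda>$i$j = N$i$j + mat 1$i$j" for i j by (simp add: N_def)
    have tr: "trace N = complex_of_real 0" using ab(3) unfolding a1 b1 by (simp add: trace_2 N_def)
    have "det N = det \<Lambda> - trace \<Lambda> + 1" by (simp add: det_2 trace_2 N_def algebra_simps)
    then have "det N = complex_of_real 0" unfolding ab a1 b1 by simp
    moreover have "adj N = N" using adjl by (simp add: mat2_eq_iff adj_def N_def)
    ultimately have "psd N" using psd_of_trace_det tr by blast
    then have "N = 0" using psd_trace_zero tr by simp
    then have "\<Lambda> = mat 1" using ent by (simp add: mat2_eq_iff)
    then show False using ne by simp
  qed
  then have b1: "b < 1" using ab a1 by simp
  have cdl: "(\<lambda>n. c n * d n) \<longlonglongrightarrow> b"
  proof -
    have "(\<lambda>n. Re (det (P n))) \<longlonglongrightarrow> Re (det \<Lambda>)" by (intro tendsto_intros detl)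
    then have "(\<lambda>n. Re (det (P n))) \<longlonglongrightarrow> b" using ab a1 by simp
    then show ?thesis
      by (rule Lim_transform_eventually)
         (use cd(4) in \<open>auto intro!: eventually_sequentiallyI[of 1]\<close>)
  qed
  \<comment> \<open>The product is det (I - \<open>P n\<close>), which converges to det (I -
    \<open>\<Lambda>\<close>) = 0: some eigenvalue of \<open>P n\<close> approaches 1.\<close>
  have dl: "(\<lambda>n. (1 - c n) * (1 - d n)) \<longlonglongrightarrow> 0"
  proof -
    have "(\<lambda>n. Re (1 - trace (P n) + det (P n))) \<longlonglongrightarrow> Re (1 - trace \<Lambda> + det \<Lambda>)"
      by (intro tendsto_intros detl trl)
    then have "(\<lambda>n. Re (1 - trace (P n) + det (P n))) \<longlonglongrightarrow> 0" using ab a1 by simp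
    then show ?thesis
      by (rule Lim_transform_eventually)
         (use cd(3,4) in \<open>auto intro!: eventually_sequentiallyI[of 1] simp: algebra_simps\<close>)
  qed
  have detM: "cmod (det (M n)) = (c n * d n) ^ n" if "1 \<le> n" for n
  proof -
    have "complex_of_real ((cmod (det (M n)))\<^sup>2) = det (adj (M n) ** M n)"
      by (simp add: det_mul cmod_square_eq, simp add: det_2 adj_def algebra_simps)
    also have "\<dots> = complex_of_real ((c n * d n) ^ (2 * n))"
      using P(2)[OF that] det_cmatpow[of "P n" "2 * n"] cd(4)[OF that] by simp
    finally have "(cmod (det (M n)))\<^sup>2 = ((c n * d n) ^ n)\<^sup>2"
      by (simp only: of_real_eq_iff power_mult[symmetric] mult.commute)
    then show ?thesis using cd(1,2)[OF that] by (auto simp: power2_eq_iff_nonneg)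
  qed
  have trM: "c n ^ (2 * n) \<le> (msize (M n))\<^sup>2" if "1 \<le> n" for n
  proof -
    let ?s = "(cmod (M n$1$1))\<^sup>2 + (cmod (M n$2$1))\<^sup>2 + (cmod (M n$1$2))\<^sup>2 + (cmod (M n$2$2))\<^sup>2"
    have "complex_of_real ?s = trace (adj (M n) ** M n)"
      by (simp add: trace_2 mat2_mult_entry adj_def cmod_square_eq mult_ac)
    also have "\<dots> = complex_of_real (c n ^ (2 * n) + d n ^ (2 * n))"
      using P(2)[OF that] trace_cmatpow[OF cd(3)[OF that] cd(4)[OF that], of "2 * n"] by simp
    finally have "?s = c n ^ (2 * n) + d n ^ (2 * n)" by (simp only: of_real_eq_iff)
    moreover have "?s \<le> (msize (M n))\<^sup>2"
      by (simp add: msize_def power2_eq_square algebra_simps add_nonneg_nonneg)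
    moreover have "0 \<le> d n ^ (2 * n)" using cd(1)[OF that] by simp
    ultimately show ?thesis by linarith
  qed
  show "(\<lambda>n. det (M n)) \<longlonglongrightarrow> 0"
  proof (rule Lim_null_comparison)
    define r where "r = (b + 1) / 2"
    have r: "b < r" "0 \<le> r" "r < 1" using b1 ab(1) by (auto simp: r_def)
    have "eventually (\<lambda>n. c n * d n < r) sequentially" using order_tendstoD(2)[OF cdl r(1)] .
    then show "eventually (\<lambda>n. norm (det (M n)) \<le> r ^ n) sequentially"
      using eventually_ge_at_top[of 1]
    proof eventually_elim
      case (elim n)
      have "0 \<le> c n * d n" using cd(1,2)[OF elim(2)] by simp
      then show ?case unfolding detM[OF elim(2)] using elim(1) by (intro power_mono) auto
    qed
    show "(\<lambda>n. r ^ n) \<longlonglongrightarrow> 0" using r by (intro LIMSEQ_realpow_zero) auto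
  qed
  show "eventually (\<lambda>n. C * \<theta> ^ n < msize (M n)) sequentially" if \<theta>: "0 < \<theta>" "\<theta> < 1" for C \<theta>
  proof -
    \<comment> \<open>Any t strictly between \<open>\<theta>\<close> and 1 would do. For large n the
      bound C \<open>\<theta>\<close>^n is below t^n, so both eigenvalues of \<open>P n\<close>
      would be at most t and (1 - c n) (1 - d n) at least (1 - t)^2, against
      \<open>dl\<close>.\<close>
    define t where "t = (1 + \<theta>) / 2"
    have t: "\<theta> < t" "t < 1" "0 < t" using \<theta> by (auto simp: t_def)
    have "(\<lambda>n. C * (\<theta> / t) ^ n) \<longlonglongrightarrow> C * 0"
      using t \<theta> by (intro tendsto_intros LIMSEQ_realpow_zero) auto
    then have e1: "eventually (\<lambda>n. C * (\<theta> / t) ^ n < 1) sequentially"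
      by (intro order_tendstoD(2)) auto
    have "(1 - t)\<^sup>2 > 0" using t by simp
    then have e2: "eventually (\<lambda>n. (1 - c n) * (1 - d n) < (1 - t)\<^sup>2) sequentially"
      using order_tendstoD(2)[OF dl] by blast
    show ?thesis using e1 e2 eventually_ge_at_top[of 1]
    proof eventually_elim
      case (elim n)
      show ?case
      proof (rule ccontr)
        assume "\<not> ?case"
        then have "msize (M n) \<le> C * \<theta> ^ n" by simp
        also have "\<dots> \<le> t ^ n" using elim(1) t by (simp add: power_divide field_simps)
        finally have "(msize (M n))\<^sup>2 \<le> (t ^ n)\<^sup>2" by (intro power_mono msize_nonneg)
        then have "c n ^ (2 * n) \<le> t ^ (2 * n)" using trM[OF elim(3)]
          by (simp add: power_mult[symmetric] mult.commute)
        then have "c n \<le> t" using t elim(3) by (subst (asm) power_mono_iff) (use cd(1,2)[OF elim(3)] in auto)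
        then have "(1 - t) * (1 - t) \<le> (1 - c n) * (1 - d n)"
          using t cd(2)[OF elim(3)] by (intro mult_mono) auto
        then show False using elim(2) by (simp add: power2_eq_square)
      qed
    qed
  qed
qed

subsection \<open>Holomorphic maps on C2\<close>

definition dmat :: "(c2 \<Rightarrow> c2) \<Rightarrow> c2 \<Rightarrow> complex^2^2" where
  "dmat f z = matrix (frechet_derivative f (at z))"

text \<open>Replaces the existential derivative of \<open>holo_on\<close> by a canonical complex
  matrix, so that the chain rule becomes matrix multiplication.\<close>

lemma has_derivative_clinear_matrix:
  assumes "(f has_derivative L) (at z)" "\<And>(c::complex) v. L (c *s v) = c *s L v"
  shows "L = (\<lambda>v. dmat f z *v v)"
proof -
  have L: "L = frechet_derivative f (at z)" using frechet_derivative_at assms(1) by blast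
  have "linear L" using assms(1) has_derivative_linear by blast
  then have "Vector_Spaces.linear (*s) (*s) L"
    using assms(2) by unfold_locales (auto simp: linear_add)
  from matrix_works[OF this] show ?thesis unfolding dmat_def L[symmetric] by (simp add: fun_eq_iff)
qed

lemma holo_on_has_derivative:
  assumes "holo_on S f" "z \<in> S"
  shows "(f has_derivative (\<lambda>v. dmat f z *v v)) (at z)"
proof -
  obtain L where L: "(f has_derivative L) (at z)" "\<And>(c::complex) v. L (c *s v) = c *s L v"
    using assms holo_on_def by metis
  show ?thesis using has_derivative_clinear_matrix[OF L] L(1) by simp
qed

lemma mv_scale: "(A::complex^2^2) *v (c *s v) = c *s (A *v v)"
  by (simp add: vec_eq_iff forall_2 mat2_vec_entry algebra_simps)

lemma dmat_unique:
  assumes "(f has_derivative (\<lambda>v. A *v v)) (at z)"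
  shows "dmat f z = A"
proof -
  have "(\<lambda>v. A *v v) = (\<lambda>v. dmat f z *v v)"
    by (rule has_derivative_clinear_matrix[OF assms mv_scale])
  then show ?thesis by (simp add: matrix_eq fun_eq_iff)
qed

lemma holo_onI:
  assumes "\<And>z. z \<in> S \<Longrightarrow> (f has_derivative (\<lambda>v. A z *v v)) (at z)"
  shows "holo_on S f"
  unfolding holo_on_def
proof
  fix z assume "z \<in> S"
  then show "\<exists>L. (f has_derivative L) (at z) \<and> (\<forall>(c::complex) v. L (c *s v) = c *s L v)"
    using assms mv_scale by (intro exI[of _ "\<lambda>v. A z *v v"]) auto
qed

lemma holo_on_subset: "holo_on T f \<Longrightarrow> S \<subseteq> T \<Longrightarrow> holo_on S f"
  unfolding holo_on_def by blast

lemma holo_on_id: "holo_on S id"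
  by (rule holo_onI[where A = "\<lambda>_. mat 1"]) (simp add: id_def)

lemma holo_on_continuous: "holo_on S f \<Longrightarrow> continuous_on S f"
  using holo_on_has_derivative has_derivative_continuous continuous_at_imp_continuous_on by metis

lemma holo_on_cong_open:
  assumes "holo_on S f" "open S" "\<And>z. z \<in> S \<Longrightarrow> g z = f z"
  shows "holo_on S g"
proof (rule holo_onI)
  fix z assume z: "z \<in> S"
  show "(g has_derivative (\<lambda>v. dmat f z *v v)) (at z)"
    using has_derivative_transform_within_open[OF holo_on_has_derivative[OF assms(1) z] assms(2) z] assms(3) by simp
qed

lemma dmat_cong_open:
  assumes "holo_on S f" "open S" "z \<in> S" "\<And>z. z \<in> S \<Longrightarrow> g z = f z"
  shows "dmat g z = dmat f z"
  using has_derivative_transform_within_open[OF holo_on_has_derivative[OF assms(1,3)] assms(2,3)] assms(4)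
  by (intro dmat_unique) simp

lemma has_derivative_compose_matrix:
  assumes "holo_on S f" "z \<in> S" "holo_on T g" "f z \<in> T"
  shows "((\<lambda>x. g (f x)) has_derivative (\<lambda>v. (dmat g (f z) ** dmat f z) *v v)) (at z)"
  using has_derivative_compose[OF holo_on_has_derivative[OF assms(1,2)] holo_on_has_derivative[OF assms(3,4)]]
  by (simp add: matrix_vector_mul_assoc)

lemma holo_on_compose:
  assumes "holo_on S f" "holo_on T g" "\<And>z. z \<in> S \<Longrightarrow> f z \<in> T"
  shows "holo_on S (\<lambda>x. g (f x))"
  by (rule holo_onI) (rule has_derivative_compose_matrix[OF assms(1) _ assms(2)], use assms(3) in auto)

lemma dmat_compose:
  assumes "holo_on S f" "z \<in> S" "holo_on T g" "f z \<in> T"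
  shows "dmat (\<lambda>x. g (f x)) z = dmat g (f z) ** dmat f z"
  by (rule dmat_unique[OF has_derivative_compose_matrix[OF assms]])

lemma holo_on_diff:
  assumes "holo_on S f" "holo_on S g"
  shows "holo_on S (\<lambda>x. f x - g x)"
    and "\<And>z. z \<in> S \<Longrightarrow> dmat (\<lambda>x. f x - g x) z = dmat f z - dmat g z"
proof -
  have d: "((\<lambda>x. f x - g x) has_derivative (\<lambda>v. (dmat f z - dmat g z) *v v)) (at z)" if "z \<in> S" for z
    using has_derivative_diff[OF holo_on_has_derivative[OF assms(1) that] holo_on_has_derivative[OF assms(2) that]]
    by (simp add: matrix_vector_mult_diff_rdistrib)
  show "holo_on S (\<lambda>x. f x - g x)" by (rule holo_onI) (rule d)
  show "\<And>z. z \<in> S \<Longrightarrow> dmat (\<lambda>x. f x - g x) z = dmat f z - dmat g z" by (rule dmat_unique[OF d])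
qed

section \<open>Complex lines, Cauchy estimates, the identity theorem and compactness\<close>

lemma norm_c2_le: "norm (v::c2) \<le> cmod (v$1) + cmod (v$2)"
  using L2_set_le_sum[of UNIV "\<lambda>i. norm (v$i)"] by (simp add: norm_vec_def sum_2)

lemma norm_scale_c2: "norm (t *s (v::c2)) = cmod t * norm v"
proof -
  have "norm (t *s v) = L2_set (\<lambda>i. cmod t * norm (v$i)) UNIV"
    unfolding norm_vec_def by (simp add: norm_mult)
  also have "\<dots> = cmod t * norm v" by (simp add: norm_vec_def L2_set_right_distrib)
  finally show ?thesis .
qed

lemma norm_nth_c2: "cmod ((v::c2)$i) \<le> norm v"
  by (rule Finite_Cartesian_Product.norm_nth_le)

lemma msize_bound: "norm (A *v (v::c2)) \<le> msize A * norm v"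
proof -
  have e: "cmod ((A *v v)$i) \<le> cmod (A$i$1) * norm v + cmod (A$i$2) * norm v" for i
  proof -
    have "cmod ((A *v v)$i) \<le> cmod (A$i$1) * cmod (v$1) + cmod (A$i$2) * cmod (v$2)"
      using norm_triangle_ineq[of "A$i$1 * v$1" "A$i$2 * v$2"] by (simp add: mat2_vec_entry norm_mult)
    also have "\<dots> \<le> cmod (A$i$1) * norm v + cmod (A$i$2) * norm v"
      by (intro add_mono mult_left_mono norm_nth_c2) auto
    finally show ?thesis .
  qed
  show ?thesis
    using norm_c2_le[of "A *v v"] e[of 1] e[of 2] by (simp add: msize_def algebra_simps)
qed

lemma bounded_linear_line: "bounded_linear (\<lambda>t::complex. t *s (v::c2))"
  by (rule bounded_linear_intro[of _ "norm v"])
     (simp_all add: vec_eq_iff algebra_simps norm_scale_c2)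

lemma line_field_derivative:
  assumes "holo_on S f" "a + t *s v \<in> S"
  shows "((\<lambda>t. f (a + t *s v) $ i) has_field_derivative (dmat f (a + t *s v) *v v) $ i) (at t)"
proof -
  have "((\<lambda>t. a + t *s v) has_derivative (\<lambda>t. t *s v)) (at t)"
    by (auto intro!: derivative_eq_intros bounded_linear_imp_has_derivative[OF bounded_linear_line])
  from has_derivative_compose[OF this holo_on_has_derivative[OF assms]]
  have "((\<lambda>t. f (a + t *s v)) has_derivative (\<lambda>x. dmat f (a + t *s v) *v (x *s v))) (at t)" .
  from bounded_linear.has_derivative[OF bounded_linear_vec_nth this]
  show ?thesis unfolding has_field_derivative_def mv_scale by (simp add: mult_commute_abs)
qed

lemma open_line_preimage: "open S \<Longrightarrow> open {t. a + t *s v \<in> (S::c2 set)}"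
  using open_vimage[of S "\<lambda>t. a + t *s v"]
  by (simp add: vimage_def continuous_intros linear_continuous_on[OF bounded_linear_line])

lemma line_holomorphic:
  assumes "holo_on S f" "\<And>t. t \<in> T \<Longrightarrow> a + t *s v \<in> S"
  shows "(\<lambda>t. f (a + t *s v) $ i) holomorphic_on T"
  unfolding holomorphic_on_def field_differentiable_def
proof
  fix t assume "t \<in> T"
  then show "\<exists>f'. ((\<lambda>t. f (a + t *s v) $ i) has_field_derivative f') (at t within T)"
    using line_field_derivative[OF assms(1) assms(2)] has_field_derivative_at_within by blast
qed

text \<open>The one-variable Cauchy inequality on the line through a in direction v. One factor 2
  comes from using half of the radius, the other from adding the two coordinates.\<close>

lemma Cauchy_estimate_dmat:
  assumes f: "holo_on (ball a r) f" and B: "\<And>z. z \<in> ball a r \<Longrightarrow> norm (f z) \<le> B" and r: "0 < r"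
  shows "norm (dmat f a *v v) \<le> 4 * B / r * norm v"
proof (cases "v = 0")
  case False
  define s where "s = r / (2 * norm v)"
  have s: "s > 0" using r False by (simp add: s_def)
  have in_ball: "a + t *s v \<in> ball a r" if "cmod t \<le> s" for t
  proof -
    have "cmod t * norm v \<le> s * norm v" using that by (intro mult_right_mono) auto
    also have "\<dots> < r" using False r by (simp add: s_def)
    finally show ?thesis by (simp add: dist_norm norm_scale_c2)
  qed
  have e: "cmod ((dmat f a *v v) $ i) \<le> 2 * B / r * norm v" for i
  proof -
    let ?g = "\<lambda>t. f (a + t *s v) $ i"
    have h: "?g holomorphic_on cball 0 s" by (rule line_holomorphic[OF f], rule in_ball) simp
    have "norm ((deriv ^^ 1) ?g 0) \<le> fact 1 * B / s ^ 1"
    proof (rule Cauchy_inequality[OF _ _ s])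
      show "?g holomorphic_on ball 0 s" using h holomorphic_on_subset ball_subset_cball by blast
      show "continuous_on (cball 0 s) ?g" using h holomorphic_on_imp_continuous_on by blast
      fix x :: complex assume "norm (0 - x) = s"
      then show "norm (?g x) \<le> B" using in_ball[of x] B norm_nth_c2 order_trans by fastforce
    qed
    moreover have "deriv ?g 0 = (dmat f a *v v) $ i"
      using line_field_derivative[OF f, of a 0 v i] r by (intro DERIV_imp_deriv) simp
    ultimately show ?thesis using False r by (simp add: s_def field_simps)
  qed
  have "4 * B / r * norm v = 2 * B / r * norm v + 2 * B / r * norm v" by simp
  then show ?thesis using norm_c2_le[of "dmat f a *v v"] e[of 1] e[of 2] by linarith
qed simp

text \<open>Around each point of the half ball there is room r/2, so the derivative bound becomes 4
  B / (r/2).\<close>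

lemma holo_on_Lipschitz:
  assumes f: "holo_on (ball a r) f" and B: "\<And>z. z \<in> ball a r \<Longrightarrow> norm (f z) \<le> B" and r: "0 < r"
    and z: "z \<in> ball a (r/2)" and w: "w \<in> ball a (r/2)"
  shows "norm (f z - f w) \<le> 8 * B / r * norm (z - w)"
proof (rule differentiable_bound[OF _ _ _ z w])
  show "convex (ball a (r/2))" by simp
  fix x assume x: "x \<in> ball a (r/2)"
  then have xr: "x \<in> ball a r" using r by simp
  show "(f has_derivative (\<lambda>v. dmat f x *v v)) (at x within ball a (r/2))"
    using holo_on_has_derivative[OF f xr] has_derivative_at_withinI by blast
  have sub: "ball x (r/2) \<subseteq> ball a r"
  proof
    fix y assume "y \<in> ball x (r/2)"
    then show "y \<in> ball a r" using x dist_triangle[of a y x] by simp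
  qed
  have "norm (dmat f x *v v) \<le> 4 * B / (r/2) * norm v" for v
    using r B sub by (intro Cauchy_estimate_dmat holo_on_subset[OF f]) auto
  then show "onorm (\<lambda>v. dmat f x *v v) \<le> 8 * B / r"
    using order_trans[OF norm_ge_zero B[OF xr]] r by (intro onorm_bound) auto
qed

text \<open>The complex line through p and x meets the ball in a convex, hence connected, set of
  parameters that contains 1 and a neighbourhood of 0; the one-variable identity theorem applies to
  each coordinate.\<close>

lemma holo_on_identity:
  assumes f: "holo_on (ball a r) f" and g: "holo_on (ball a r) g"
    and p: "p \<in> ball a r" and e: "0 < e" and eq: "\<And>z. z \<in> ball p e \<Longrightarrow> f z = g z"
    and x: "x \<in> ball a r"
  shows "f x = g x"
proof -
  let ?l = "\<lambda>t::complex. p + t *s (x - p)"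
  define T where "T = {t. ?l t \<in> ball a r}"
  define U where "U = {t. ?l t \<in> ball a r \<inter> ball p e}"
  have "f x $ i = g x $ i" for i
  proof -
    have "f (?l 1) $ i = g (?l 1) $ i"
    proof (rule analytic_continuation_open[where s = U and s' = T and z = 1
          and f = "\<lambda>t. f (?l t) $ i" and g = "\<lambda>t. g (?l t) $ i"])
      show "open U" "open T" unfolding U_def T_def by (intro open_line_preimage open_Int open_ball)+
      have "0 \<in> U" unfolding U_def using p e by simp
      then show "U \<noteq> {}" by blast
      have "convex T" unfolding convex_def
      proof (intro ballI allI impI)
        fix s t u v assume st: "s \<in> T" "t \<in> T" and uv: "(0::real) \<le> u" "0 \<le> v" "u + v = 1"
        have "u *\<^sub>R ?l s + v *\<^sub>R ?l t \<in> ball a r"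
          using st uv convex_ball[of a r] unfolding T_def by (intro convexD) auto
        moreover have "u *\<^sub>R ?l s + v *\<^sub>R ?l t = ?l (u *\<^sub>R s + v *\<^sub>R t)"
        proof -
          have "u *\<^sub>R ?l s + v *\<^sub>R ?l t = (u + v) *\<^sub>R p + (u *\<^sub>R s + v *\<^sub>R t) *s (x - p)"
            by (simp add: vec_eq_iff algebra_simps)
          then show ?thesis using uv by simp
        qed
        ultimately show "u *\<^sub>R s + v *\<^sub>R t \<in> T" unfolding T_def by simp
      qed
      then show "connected T" by (rule convex_connected)
      show "U \<subseteq> T" by (auto simp: U_def T_def)
      show "(\<lambda>t. f (?l t) $ i) holomorphic_on T" "(\<lambda>t. g (?l t) $ i) holomorphic_on T"
        by (rule line_holomorphic[OF f] line_holomorphic[OF g], simp add: T_def)+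
      show "f (?l t) $ i = g (?l t) $ i" if "t \<in> U" for t
        using eq that by (simp add: U_def)
      show "1 \<in> T" using x by (simp add: T_def)
    qed
    then show ?thesis by simp
  qed
  then show ?thesis by (simp add: vec_eq_iff)
qed

lemma dmat_entry: "dmat f z $ i $ j = (dmat f z *v axis j 1) $ i"
  using exhaust_2[of j] by (auto simp: mat2_vec_entry axis_def)

text \<open>Weierstrass: Cauchy estimates applied to differences make the derivatives uniformly
  Cauchy on a smaller ball, where termwise differentiation is allowed.\<close>

lemma holo_on_uniform_limit:
  assumes fs: "\<And>n. holo_on (ball a r) (fs n)" and lim: "uniform_limit (ball a r) fs g sequentially"
  shows "holo_on (ball a r) g"
    and "\<And>z. z \<in> ball a r \<Longrightarrow> (\<lambda>n. dmat (fs n) z) \<longlonglongrightarrow> dmat g z"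
proof -
  have main: "\<exists>A. (g has_derivative (\<lambda>v. A *v v)) (at z) \<and> (\<lambda>n. dmat (fs n) z) \<longlonglongrightarrow> A"
    if z: "z \<in> ball a r" for z
  proof -
    obtain d where d: "0 < d" "ball z d \<subseteq> ball a r" using z open_ball open_contains_ball by metis
    let ?S = "ball z (d/2)"
    have sub: "ball x (d/2) \<subseteq> ball a r" if "x \<in> ?S" for x
    proof
      fix y assume "y \<in> ball x (d/2)"
      then have "y \<in> ball z d" using that dist_triangle[of z y x] by simp
      then show "y \<in> ball a r" using d by blast
    qed
    have cau: "\<exists>N. \<forall>m\<ge>N. \<forall>n\<ge>N. \<forall>x\<in>?S. \<forall>v. norm (dmat (fs m) x *v v - dmat (fs n) x *v v) \<le> e * norm v"
      if e: "0 < e" for e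
    proof -
      \<comment> \<open>Two members within \<open>\<delta>\<close> of g differ by at most 2
        \<open>\<delta>\<close>, and the Cauchy estimate on radius d/2 turns this into 16
        \<open>\<delta>\<close> / d = e.\<close>
      define \<delta> where "\<delta> = e * d / 16"
      have "\<delta> > 0" using e d by (simp add: \<delta>_def)
      then obtain N where N: "\<And>n x. n \<ge> N \<Longrightarrow> x \<in> ball a r \<Longrightarrow> dist (fs n x) (g x) < \<delta>"
        using lim unfolding uniform_limit_sequentially_iff by blast
      have "norm (dmat (fs m) x *v v - dmat (fs n) x *v v) \<le> e * norm v"
        if "m \<ge> N" "n \<ge> N" "x \<in> ?S" for m n x v
      proof -
        let ?h = "\<lambda>x. fs m x - fs n x"
        have xb: "x \<in> ball a r" using sub[OF that(3)] d(1) by (auto simp: subset_iff)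
        have 1: "norm (dmat ?h x *v v) \<le> 4 * (2 * \<delta>) / (d/2) * norm v"
        proof (rule Cauchy_estimate_dmat)
          show "holo_on (ball x (d/2)) ?h"
            by (rule holo_on_subset[OF holo_on_diff(1)[OF fs fs] sub[OF that(3)]])
          fix y assume "y \<in> ball x (d/2)"
          then have y: "y \<in> ball a r" using sub[OF that(3)] by blast
          have "dist (fs m y) (fs n y) \<le> dist (fs m y) (g y) + dist (fs n y) (g y)"
            by (rule dist_triangle2)
          also have "\<dots> \<le> 2 * \<delta>" using N[OF that(1) y] N[OF that(2) y] by linarith
          finally show "norm (?h y) \<le> 2 * \<delta>" by (simp add: dist_norm)
        qed (use d in simp)
        have 2: "4 * (2 * \<delta>) / (d/2) = e" using d by (simp add: \<delta>_def)
        have "dmat ?h x = dmat (fs m) x - dmat (fs n) x"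
          by (rule holo_on_diff(2)[OF fs fs xb])
        then show ?thesis using 1 unfolding 2 by (simp add: matrix_vector_mult_diff_rdistrib)
      qed
      then show ?thesis by blast
    qed
    have ent: "convergent (\<lambda>n. dmat (fs n) x $ i $ j)" if x: "x \<in> ?S" for x i j
    proof -
      have "Cauchy (\<lambda>n. dmat (fs n) x $ i $ j)"
      proof (rule CauchyI)
        fix e :: real assume e: "0 < e"
        then obtain N where N: "\<forall>m\<ge>N. \<forall>n\<ge>N. \<forall>x\<in>?S. \<forall>v. norm (dmat (fs m) x *v v - dmat (fs n) x *v v) \<le> e/2 * norm v"
          using cau[of "e/2"] by auto
        have "norm (dmat (fs m) x $ i $ j - dmat (fs n) x $ i $ j) < e" if "m \<ge> N" "n \<ge> N" for m n
        proof -
          let ?v = "axis j (1::complex) :: c2"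
          have "norm (dmat (fs m) x *v ?v - dmat (fs n) x *v ?v) \<le> e/2 * norm ?v"
            using N that x by blast
          moreover have "norm ((dmat (fs m) x *v ?v - dmat (fs n) x *v ?v) $ i) \<le> norm (dmat (fs m) x *v ?v - dmat (fs n) x *v ?v)"
            by (rule norm_nth_c2)
          ultimately show ?thesis using e by (simp add: dmat_entry[of _ x i j] norm_axis_1)
        qed
        then show "\<exists>M. \<forall>m\<ge>M. \<forall>n\<ge>M. norm (dmat (fs m) x $ i $ j - dmat (fs n) x $ i $ j) < e" by blast
      qed
      then show ?thesis by (rule Cauchy_convergent)
    qed
    define A where "A x = (\<chi> i j. lim (\<lambda>n. dmat (fs n) x $ i $ j))" for x
    have Alim: "(\<lambda>n. dmat (fs n) x) \<longlonglongrightarrow> A x" if "x \<in> ?S" for x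
    proof (intro vec_tendstoI)
      fix i j show "(\<lambda>n. dmat (fs n) x $ i $ j) \<longlonglongrightarrow> A x $ i $ j"
        using ent[OF that] by (simp add: A_def convergent_LIMSEQ_iff)
    qed
    have Avlim: "(\<lambda>n. dmat (fs n) x *v v) \<longlonglongrightarrow> A x *v v" if "x \<in> ?S" for x v
      unfolding matrix_vector_mult_def
      by (intro vec_tendstoI, simp, intro tendsto_intros Alim that)
    have zS: "z \<in> ?S" using d by simp
    have "\<exists>g. \<forall>x\<in>?S. (\<lambda>n. fs n x) \<longlonglongrightarrow> g x \<and> (g has_derivative (\<lambda>v. A x *v v)) (at x within ?S)"
    proof (rule has_derivative_sequence[where f' = "\<lambda>n x v. dmat (fs n) x *v v" and ?x0.0 = z and l = "g z"])
      show "(fs n has_derivative (\<lambda>v. dmat (fs n) x *v v)) (at x within ?S)" if "x \<in> ?S" for n x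
      proof -
        have "x \<in> ball a r" using sub[OF that] d(1) by (auto simp: subset_iff)
        then show ?thesis by (rule has_derivative_at_withinI[OF holo_on_has_derivative[OF fs]])
      qed
      show "\<forall>\<^sub>F n in sequentially. \<forall>x\<in>?S. \<forall>v. norm (dmat (fs n) x *v v - A x *v v) \<le> e * norm v" if e: "0 < e" for e
      proof -
        obtain N where N: "\<forall>m\<ge>N. \<forall>n\<ge>N. \<forall>x\<in>?S. \<forall>v. norm (dmat (fs m) x *v v - dmat (fs n) x *v v) \<le> e * norm v"
          using cau[OF e] by blast
        have "norm (dmat (fs m) x *v v - A x *v v) \<le> e * norm v" if "m \<ge> N" "x \<in> ?S" for m x v
        proof (rule tendsto_upperbound)
          show "(\<lambda>n. norm (dmat (fs m) x *v v - dmat (fs n) x *v v)) \<longlonglongrightarrow> norm (dmat (fs m) x *v v - A x *v v)"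
            by (intro tendsto_intros Avlim that)
          show "eventually (\<lambda>n. norm (dmat (fs m) x *v v - dmat (fs n) x *v v) \<le> e * norm v) sequentially"
            using eventually_ge_at_top[of N] by eventually_elim (use N that in blast)
        qed simp
        then show ?thesis unfolding eventually_sequentially by blast
      qed
      show "(\<lambda>n. fs n z) \<longlonglongrightarrow> g z" using lim z by (rule tendsto_uniform_limitI)
      show "convex ?S" by (rule convex_ball)
      show "z \<in> ?S" by (rule zS)
    qed
    then obtain g' where g': "\<And>x. x \<in> ?S \<Longrightarrow> (\<lambda>n. fs n x) \<longlonglongrightarrow> g' x"
      "\<And>x. x \<in> ?S \<Longrightarrow> (g' has_derivative (\<lambda>v. A x *v v)) (at x within ?S)" by blast
    have "g' x = g x" if "x \<in> ?S" for x
    proof (rule LIMSEQ_unique[OF g'(1)[OF that]])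
      have "x \<in> ball a r" using sub[OF that] d(1) by (auto simp: subset_iff)
      then show "(\<lambda>n. fs n x) \<longlonglongrightarrow> g x" using lim tendsto_uniform_limitI by metis
    qed
    moreover have "(g' has_derivative (\<lambda>v. A z *v v)) (at z)"
      using g'(2)[OF zS] zS at_within_open[OF zS open_ball] by simp
    ultimately have "(g has_derivative (\<lambda>v. A z *v v)) (at z)"
      using has_derivative_transform_within_open[OF _ open_ball zS] by blast
    then show ?thesis using Alim[OF zS] by blast
  qed
  show "holo_on (ball a r) g"
    using main mv_scale unfolding holo_on_def by metis
  show "\<And>z. z \<in> ball a r \<Longrightarrow> (\<lambda>n. dmat (fs n) z) \<longlonglongrightarrow> dmat g z"
    using main dmat_unique by metis
qed

text \<open>A uniform bound gives a uniform Lipschitz constant on the half ball, so Arzela-Ascoli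
  applies on the compact quarter ball inside it.\<close>

lemma holo_on_Montel:
  assumes F: "\<And>n. holo_on (ball a r) (F n)" and B: "\<And>n z. z \<in> ball a r \<Longrightarrow> norm (F n z) \<le> B" and r: "0 < r"
  obtains g k where "strict_mono (k::nat\<Rightarrow>nat)" "continuous_on (cball a (r/4)) g"
    "uniform_limit (cball a (r/4)) (\<lambda>n. F (k n)) g sequentially"
proof -
  let ?S = "cball a (r/4)"
  have sub: "?S \<subseteq> ball a (r/2)" "?S \<subseteq> ball a r" using r by auto
  have B0: "0 \<le> B" using order_trans[OF norm_ge_zero B[of a 0]] r by simp
  have lip: "norm (F n x - F n y) \<le> 8 * B / r * norm (x - y)" if "x \<in> ?S" "y \<in> ?S" for n x y
    using that sub by (intro holo_on_Lipschitz[OF F B r]) auto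
  obtain g k where gk: "continuous_on ?S g" "strict_mono (k :: nat \<Rightarrow> nat)"
    "\<And>e. 0 < e \<Longrightarrow> \<exists>N. \<forall>n x. n \<ge> N \<and> x \<in> ?S \<longrightarrow> norm (F (k n) x - g x) < e"
  proof (rule Arzela_Ascoli[of ?S F B])
    show "norm (F n x) \<le> B" if "x \<in> ?S" for n x using B that sub by blast
    show "\<exists>d>0. \<forall>n y. y \<in> ?S \<and> norm (x - y) < d \<longrightarrow> norm (F n x - F n y) < e"
      if x: "x \<in> ?S" and e: "0 < e" for x e
    proof (intro exI[of _ "e / (8 * B / r + 1)"] conjI allI impI)
      have p: "8 * B / r + 1 > 0" using B0 r by (simp add: add_nonneg_pos)
      then show "0 < e / (8 * B / r + 1)" using e by simp
      fix n y assume y: "y \<in> ?S \<and> norm (x - y) < e / (8 * B / r + 1)"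
      then have "norm (x - y) * (8 * B / r + 1) < e" using p by (simp add: pos_less_divide_eq)
      moreover have "norm (F n x - F n y) \<le> 8 * B / r * norm (x - y)" using lip x y by blast
      moreover have "8 * B / r * norm (x - y) \<le> norm (x - y) * (8 * B / r + 1)" by (simp add: algebra_simps)
      ultimately show "norm (F n x - F n y) < e" by linarith
    qed
  qed (use that in auto)
  have "uniform_limit ?S (\<lambda>n. F (k n)) g sequentially"
    unfolding uniform_limit_sequentially_iff dist_norm using gk(3) by blast
  then show ?thesis using that gk by blast
qed

lemma uniform_limit_compose_tendsto:
  fixes h :: "'a::metric_space \<Rightarrow> 'b::metric_space"
  assumes "uniform_limit S hs h sequentially" "continuous_on S h" "xs \<longlonglongrightarrow> x" "x \<in> S" "\<And>n. xs n \<in> S"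
  shows "(\<lambda>n. hs n (xs n)) \<longlonglongrightarrow> h x"
proof (rule tendstoI)
  fix e :: real assume e: "0 < e"
  have 1: "eventually (\<lambda>n. \<forall>y\<in>S. dist (hs n y) (h y) < e/2) sequentially"
    using assms(1) e uniform_limitD half_gt_zero by blast
  have "(\<lambda>n. h (xs n)) \<longlonglongrightarrow> h x"
    using continuous_on_tendsto_compose[OF assms(2,3,4)] assms(5) by simp
  then have 2: "eventually (\<lambda>n. dist (h (xs n)) (h x) < e/2) sequentially"
    using e by (intro tendstoD) auto
  show "eventually (\<lambda>n. dist (hs n (xs n)) (h x) < e) sequentially"
    using 1 2
  proof eventually_elim
    case (elim n)
    have "dist (hs n (xs n)) (h (xs n)) < e/2" using elim(1) assms(5) by blast
    then show ?case using elim(2) dist_triangle[of "hs n (xs n)" "h x" "h (xs n)"] by linarith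
  qed
qed

subsection \<open>Level sets of rank one maps\<close>

text \<open>The derivative at a nearby point is the derivative at z of a translate of g, and the
  translates converge uniformly near z; the derivatives at z then converge as well.\<close>

lemma continuous_on_dmat:
  assumes g: "holo_on S g" and S: "open S"
  shows "continuous_on S (dmat g)"
proof (rule continuous_at_imp_continuous_on, intro ballI)
  fix z assume z: "z \<in> S"
  obtain d where d: "0 < d" "cball z d \<subseteq> S" using S z open_contains_cball by blast
  have "compact (g ` cball z d)"
    by (intro compact_continuous_image continuous_on_subset[OF holo_on_continuous[OF g] d(2)] compact_cball)
  then obtain B where B: "\<And>w. w \<in> cball z d \<Longrightarrow> norm (g w) \<le> B"
    using compact_imp_bounded bounded_iff by (metis imageI)
  have gz: "holo_on (ball z d) g" using holo_on_subset[OF g] d(2) ball_subset_cball by blast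
  have "(\<lambda>n. dmat g (x n)) \<longlonglongrightarrow> dmat g z" if xz: "x \<longlonglongrightarrow> z" for x
  proof -
    have "eventually (\<lambda>n. dist (x n) z < d/4) sequentially" using tendstoD[OF xz, of "d/4"] d(1) by simp
    then obtain N where N: "\<And>n. n \<ge> N \<Longrightarrow> dist (x n) z < d/4" unfolding eventually_sequentially by blast
    define y where "y n = x (n + N) - z" for n
    have y: "norm (y n) < d/4" for n using N[of "n + N"] by (simp add: y_def dist_norm)
    have y0: "y \<longlonglongrightarrow> 0" unfolding y_def using LIMSEQ_ignore_initial_segment[OF xz, of N]
      by (simp add: LIM_zero)
    have sh: "holo_on (ball z (d/4)) (\<lambda>w. g (w + y n))" "dmat (\<lambda>w. g (w + y n)) z = dmat g (z + y n)" for n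
    proof -
      have t: "((\<lambda>w. w + y n) has_derivative (\<lambda>v. mat 1 *v v)) (at w)" for w
        by (auto intro!: derivative_eq_intros)
      have ht: "holo_on UNIV (\<lambda>w. w + y n)" by (rule holo_onI) (rule t)
      have dt: "dmat (\<lambda>w. w + y n) z = mat 1" by (rule dmat_unique) (rule t)
      have im: "w + y n \<in> ball z d" if "w \<in> ball z (d/4)" for w
      proof -
        have "dist z (w + y n) \<le> dist z w + norm (y n)"
          using dist_triangle[of z "w + y n" w] by (simp add: dist_norm)
        then show ?thesis using that y[of n] d(1) by simp
      qed
      show "holo_on (ball z (d/4)) (\<lambda>w. g (w + y n))"
        by (rule holo_on_compose[OF holo_on_subset[OF ht] gz]) (use im in auto)
      have "z + y n \<in> ball z d" using im[of z] d(1) by simp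
      from dmat_compose[OF ht _ gz this] dt show "dmat (\<lambda>w. g (w + y n)) z = dmat g (z + y n)" by simp
    qed
    have "uniform_limit (ball z (d/4)) (\<lambda>n w. g (w + y n)) g sequentially"
    proof (rule uniform_limitI)
      fix e :: real assume e: "0 < e"
      have B0: "0 \<le> B" using order_trans[OF norm_ge_zero B[of z]] d(1) by simp
      have p: "8 * B / d + 1 > 0" using B0 d(1) by (simp add: add_nonneg_pos)
      have "eventually (\<lambda>n. norm (y n) < e / (8 * B / d + 1)) sequentially"
        using tendstoD[OF y0, of "e / (8 * B / d + 1)"] e p by simp
      then show "\<forall>\<^sub>F n in sequentially. \<forall>w\<in>ball z (d/4). dist (g (w + y n)) (g w) < e"
      proof eventually_elim
        case (elim n)
        show ?case
        proof
          fix w assume w: "w \<in> ball z (d/4)"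
          have "dist z (w + y n) \<le> dist z w + norm (y n)"
            using dist_triangle[of z "w + y n" w] by (simp add: dist_norm)
          then have "w + y n \<in> ball z (d/2)" using w y[of n] by simp
          moreover have "w \<in> ball z (d/2)" using w d(1) by simp
          ultimately have "norm (g (w + y n) - g w) \<le> 8 * B / d * norm (w + y n - w)"
            using B d(1) by (intro holo_on_Lipschitz[OF gz]) auto
          also have "\<dots> \<le> (8 * B / d + 1) * norm (y n)" by (simp add: algebra_simps)
          also have "\<dots> < e" using elim p by (simp add: pos_less_divide_eq mult.commute)
          finally show "dist (g (w + y n)) (g w) < e" by (simp add: dist_norm)
        qed
      qed
    qed
    from holo_on_uniform_limit(2)[OF sh(1) this, of z] have "(\<lambda>n. dmat g (z + y n)) \<longlonglongrightarrow> dmat g z"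
      using d(1) unfolding sh(2) by simp
    then have "(\<lambda>n. dmat g (x (n + N))) \<longlonglongrightarrow> dmat g z" by (simp add: y_def)
    then show ?thesis by (rule LIMSEQ_offset)
  qed
  then show "isCont (dmat g) z" using continuous_at_sequentially[of z "dmat g"] by (simp add: o_def)
qed

text \<open>The real inverse function theorem supplies h. Its derivative is a right inverse of an
  injective complex linear map, hence itself complex linear, which makes h holomorphic.\<close>

lemma holo_inverse_function:
  assumes g: "holo_on S g" and S: "open S" and z: "z \<in> S" and nz: "det (dmat g z) \<noteq> 0"
  obtains U V h where "open U" "U \<subseteq> S" "z \<in> U" "open V" "g z \<in> V" "homeomorphism U V g h" "holo_on V h"
    "\<And>y. y \<in> V \<Longrightarrow> dmat g (h y) ** dmat h y = mat 1"
proof -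
  define f' where "f' x = Blinfun ((*v) (dmat g x))" for x
  have f': "blinfun_apply (f' x) = (*v) (dmat g x)" for x
    unfolding f'_def by (rule bounded_linear_Blinfun_apply) (rule matrix_vector_mul_bounded_linear)
  have cont: "continuous_on S f'"
  proof (rule continuous_at_imp_continuous_on, intro ballI)
    fix x assume x: "x \<in> S"
    have c: "isCont (dmat g) x"
      using continuous_on_dmat[OF g S] S x continuous_on_eq_continuous_at by blast
    have bd: "norm (f' y - f' x) \<le> msize (dmat g y - dmat g x)" for y
    proof (rule norm_blinfun_bound[OF msize_nonneg])
      fix v show "norm (blinfun_apply (f' y - f' x) v) \<le> msize (dmat g y - dmat g x) * norm v"
        using msize_bound[of "dmat g y - dmat g x" v]
        by (simp add: blinfun.diff_left f' matrix_vector_mult_diff_rdistrib)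
    qed
    have "((\<lambda>y. msize (dmat g y - dmat g x)) \<longlongrightarrow> msize (dmat g x - dmat g x)) (at x)"
      using c unfolding msize_def isCont_def by (intro tendsto_intros)
    then have "((\<lambda>y. msize (dmat g y - dmat g x)) \<longlongrightarrow> 0) (at x)" by (simp add: msize_def)
    then have "((\<lambda>y. f' y - f' x) \<longlongrightarrow> 0) (at x)"
      by (rule Lim_null_comparison[rotated]) (simp add: bd)
    then show "isCont f' x" unfolding isCont_def by (simp add: LIM_zero_iff)
  qed
  obtain A where A: "A ** dmat g z = mat 1" using nz invertible_det_nz invertible_def by metis
  define invf where "invf = Blinfun ((*v) A)"
  have invf: "blinfun_apply invf = (*v) A"
    unfolding invf_def by (rule bounded_linear_Blinfun_apply) (rule matrix_vector_mul_bounded_linear)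
  have inv_id: "invf o\<^sub>L f' z = id_blinfun"
    by (rule blinfun_eqI) (simp add: invf f' matrix_vector_mul_assoc A)
  have derf: "(g has_derivative blinfun_apply (f' x)) (at x)" if "x \<in> S" for x
    unfolding f' by (rule holo_on_has_derivative[OF g that])
  obtain U V h h' where h: "open U" "U \<subseteq> S" "z \<in> U" "open V" "g z \<in> V" "homeomorphism U V g h"
    "\<And>y. y \<in> V \<Longrightarrow> (h has_derivative (h' y)) (at y)"
    "\<And>y. y \<in> V \<Longrightarrow> h' y = inv (blinfun_apply (f' (h y)))"
    "\<And>y. y \<in> V \<Longrightarrow> bij (blinfun_apply (f' (h y)))"
    by (rule inverse_function_theorem[OF S derf cont z inv_id], assumption, rule that)
  have inv: "dmat g (h y) *v (h' y v) = v" if "y \<in> V" for y v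
    using h(8,9)[OF that] unfolding f' by (simp add: bij_is_surj surj_f_inv_f)
  have lin: "h' y (c *s v) = c *s h' y v" if "y \<in> V" for y c v
  proof -
    have "inj ((*v) (dmat g (h y)))" using h(9)[OF that] unfolding f' by (rule bij_is_inj)
    moreover have "dmat g (h y) *v h' y (c *s v) = dmat g (h y) *v (c *s h' y v)"
      using inv[OF that] by (simp add: mv_scale)
    ultimately show ?thesis by (simp add: inj_eq)
  qed
  have holo: "holo_on V h" unfolding holo_on_def using h(7) lin by blast
  have "dmat g (h y) ** dmat h y = mat 1" if "y \<in> V" for y
  proof -
    have "h' y = (\<lambda>v. dmat h y *v v)"
      using has_derivative_clinear_matrix[OF h(7)[OF that] lin[OF that]] .
    then show ?thesis using inv[OF that] by (simp add: matrix_eq flip: matrix_vector_mul_assoc)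
  qed
  then show ?thesis using that h(1-6) holo by blast
qed

text \<open>The rows of a singular 2 by 2 matrix are proportional, so the kernel of a nonzero row is
  the kernel of the matrix.\<close>

lemma rank_one_kernel:
  fixes D :: "complex^2^2"
  assumes "det D = 0" "(D *v v) $ i = 0" "D $ i $ j \<noteq> 0"
  shows "D *v v = 0"
proof -
  define a b c d x y where abcd: "a = D$1$1" "b = D$1$2" "c = D$2$1" "d = D$2$2" "x = v$1" "y = v$2"
  have dt: "a * d = b * c" using assms(1) by (simp add: det_2 abcd)
  have 1: "a * x + b * y = 0 \<and> (a \<noteq> 0 \<or> b \<noteq> 0) \<or> c * x + d * y = 0 \<and> (c \<noteq> 0 \<or> d \<noteq> 0)"
    using assms(2,3) exhaust_2[of i] exhaust_2[of j] by (auto simp: mat2_vec_entry abcd)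
  have "a * (c * x + d * y) = c * (a * x + b * y)" "b * (c * x + d * y) = d * (a * x + b * y)"
    using dt by (simp_all add: algebra_simps)
  then have "a * x + b * y = 0 \<and> c * x + d * y = 0" using 1 by auto
  then show ?thesis by (simp add: vec_eq_iff forall_2 mat2_vec_entry abcd)
qed

lemma convex_line_mem:
  fixes y y' :: c2
  assumes "convex S" "y \<in> S" "y' \<in> S" "t \<in> closed_segment 0 (1::complex)"
  shows "y + t *s (y' - y) \<in> S"
proof -
  obtain u where u: "0 \<le> u" "u \<le> 1" "t = of_real u"
    using assms(4) by (auto simp: closed_segment_def scaleR_conv_of_real)
  have "y + t *s (y' - y) = (1 - u) *\<^sub>R y + u *\<^sub>R y'"
    unfolding u by (simp add: vec_eq_iff) (simp add: scaleR_conv_of_real algebra_simps)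
  then show ?thesis using assms(1-3) u unfolding convex_alt by simp
qed

lemma holo_on_const_on_line:
  assumes G: "holo_on S G" and S: "convex S" and y: "y \<in> S" "y' \<in> S"
    and z: "\<And>x. x \<in> S \<Longrightarrow> dmat G x *v (y' - y) = 0"
  shows "G y = G y'"
proof -
  have "G y $ i = G y' $ i" for i
  proof -
    have "\<exists>c. \<forall>t\<in>closed_segment 0 (1::complex). G (y + t *s (y' - y)) $ i = c"
    proof (rule has_field_derivative_zero_constant)
      fix t :: complex assume "t \<in> closed_segment 0 1"
      then have m: "y + t *s (y' - y) \<in> S" using convex_line_mem S y by blast
      have "((\<lambda>t. G (y + t *s (y' - y)) $ i) has_field_derivative 0) (at t)"
        using line_field_derivative[OF G m, of i] z[OF m] by simp
      then show "((\<lambda>t. G (y + t *s (y' - y)) $ i) has_field_derivative 0) (at t within closed_segment 0 1)"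
        by (rule has_field_derivative_at_within)
    qed (rule convex_closed_segment)
    then obtain c where c: "\<And>t. t \<in> closed_segment 0 (1::complex) \<Longrightarrow> G (y + t *s (y' - y)) $ i = c" by blast
    show ?thesis using c[of 0] c[of 1] by simp
  qed
  then show ?thesis by (simp add: vec_eq_iff)
qed

lemma holo_chart_of_component:
  assumes g: "holo_on S g" 
  shows "holo_on S (\<lambda>z. vector [g z $ i, z $ k] :: c2)"
    and "\<And>z. z \<in> S \<Longrightarrow> dmat (\<lambda>z. vector [g z $ i, z $ k] :: c2) z = vector [dmat g z $ i, axis k 1]"
proof -
  have d: "((\<lambda>z. vector [g z $ i, z $ k] :: c2) has_derivative (\<lambda>v. (vector [dmat g z $ i, axis k 1] :: complex^2^2) *v v)) (at z)"
    if "z \<in> S" for z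
  proof -
    have e: "(vector [a, b] :: c2) = a *s axis 1 1 + b *s axis 2 1" for a b
      by (simp add: vec_eq_iff forall_2 axis_def)
    have m: "(vector [dmat g z $ i, axis k 1] :: complex^2^2) *v v = (dmat g z *v v) $ i *s axis 1 1 + v $ k *s axis 2 1" for v
      using exhaust_2[of k] by (auto simp: vec_eq_iff forall_2 mat2_vec_entry axis_def)
    have 1: "((\<lambda>z. g z $ i) has_derivative (\<lambda>v. (dmat g z *v v) $ i)) (at z)"
      by (rule bounded_linear.has_derivative[OF bounded_linear_vec_nth holo_on_has_derivative[OF g that]])
    have 2: "((\<lambda>z::c2. z $ k) has_derivative (\<lambda>v. v $ k)) (at z)"
      by (rule bounded_linear.has_derivative[OF bounded_linear_vec_nth has_derivative_ident])
    show ?thesis unfolding e m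
      by (rule has_derivative_add[OF bounded_linear.has_derivative[OF bounded_linear_line 1]
          bounded_linear.has_derivative[OF bounded_linear_line 2]])
  qed
  show "holo_on S (\<lambda>z. vector [g z $ i, z $ k] :: c2)" by (rule holo_onI) (rule d)
  show "\<And>z. z \<in> S \<Longrightarrow> dmat (\<lambda>z. vector [g z $ i, z $ k] :: c2) z = vector [dmat g z $ i, axis k 1]"
    by (rule dmat_unique[OF d])
qed

lemma det_chart:
  assumes "k \<noteq> j"
  shows "det (vector [(D::complex^2^2) $ i, axis k 1] :: complex^2^2) = 0 \<longleftrightarrow> D $ i $ j = 0"
  using assms exhaust_2[of k] exhaust_2[of j] by (auto simp: det_2 axis_def)

text \<open>The constant rank theorem in dimension two. If the derivative of g_i in direction j is
  nonzero at 0, then (g_i, z_k), with k the other index, is a chart. Moving with g_i fixed is a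
  direction in the kernel of one nonzero row, so by rank one all of g stays fixed.\<close>

lemma rank_one_level_chart:
  assumes g: "holo_on (ball 0 r) g" and r: "0 < r"
    and det0: "\<And>z. z \<in> ball 0 r \<Longrightarrow> det (dmat g z) = 0" and nz: "dmat g 0 \<noteq> 0"
  obtains N \<Phi> where "0 \<in> N" "N \<subseteq> ball 0 r" "biholo N \<Phi>"
    "\<And>z w. z \<in> N \<Longrightarrow> w \<in> N \<Longrightarrow> g z = g w \<longleftrightarrow> \<Phi> z $ 1 = \<Phi> w $ 1"
proof -
  obtain i j where ij: "dmat g 0 $ i $ j \<noteq> 0" using nz by (auto simp: vec_eq_iff)
  define k :: 2 where "k = (if j = 1 then 2 else 1)"
  have k: "k \<noteq> j" by (auto simp: k_def)
  define \<Phi> where "\<Phi> = (\<lambda>z. vector [g z $ i, z $ k] :: c2)"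
  have \<Phi>: "holo_on (ball 0 r) \<Phi>" "\<And>z. z \<in> ball 0 r \<Longrightarrow> dmat \<Phi> z = vector [dmat g z $ i, axis k 1]"
    unfolding \<Phi>_def using holo_chart_of_component[OF g] by auto
  have "det (dmat \<Phi> 0) \<noteq> 0" using det_chart[OF k] ij \<Phi>(2)[of 0] r by simp
  then obtain U V h where h: "open U" "U \<subseteq> ball 0 r" "0 \<in> U" "open V" "\<Phi> 0 \<in> V" "homeomorphism U V \<Phi> h" "holo_on V h"
    "\<And>y. y \<in> V \<Longrightarrow> dmat \<Phi> (h y) ** dmat h y = mat 1"
    using holo_inverse_function[OF \<Phi>(1) open_ball, of 0] r by (metis centre_in_ball)
  \<comment> \<open>Shrinking the image of the chart to a ball makes it convex: two points with
    equal first coordinate are joined by a segment inside it.\<close>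
  obtain s where s: "0 < s" "ball (\<Phi> 0) s \<subseteq> V" using h(4,5) open_contains_ball by metis
  let ?W = "ball (\<Phi> 0) s"
  define N where "N = U \<inter> \<Phi> -` ?W"
  have hU: "h y \<in> U" "\<Phi> (h y) = y" if "y \<in> V" for y
    using h(6) that unfolding homeomorphism_def by auto
  have h\<Phi>: "h (\<Phi> x) = x" "\<Phi> x \<in> V" if "x \<in> U" for x
    using h(6) that unfolding homeomorphism_def by auto
  have Nsub: "N \<subseteq> ball 0 r" using h(2) N_def by blast
  have Wh: "h y \<in> N" if "y \<in> ?W" for y using hU that s(2) unfolding N_def by auto
  have im: "\<Phi> ` N = ?W"
  proof
    show "?W \<subseteq> \<Phi> ` N"
    proof
      fix y assume y: "y \<in> ?W"
      then have "y = \<Phi> (h y)" using hU(2) s(2) by auto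
      then show "y \<in> \<Phi> ` N" using Wh[OF y] by (rule image_eqI)
    qed
  qed (auto simp: N_def)
  have openN: "open N" unfolding N_def
    using continuous_open_preimage[OF continuous_on_subset[OF holo_on_continuous[OF \<Phi>(1)] h(2)] h(1) open_ball] by simp
  have inj: "inj_on \<Phi> N" by (rule inj_on_inverseI[of _ h]) (use h\<Phi>(1) N_def in auto)
  have bih: "biholo N \<Phi>"
    unfolding biholo_def im
  proof (intro conjI openN inj open_ball holo_on_subset[OF \<Phi>(1) Nsub])
    show "holo_on ?W (inv_into N \<Phi>)"
    proof (rule holo_on_cong_open[OF holo_on_subset[OF h(7) s(2)] open_ball])
      fix y assume y: "y \<in> ?W"
      show "inv_into N \<Phi> y = h y"
        using inv_into_f_eq[OF inj Wh[OF y]] hU(2) y s(2) by blast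
    qed
  qed
  have hW: "holo_on ?W h" by (rule holo_on_subset[OF h(7) s(2)])
  have hr: "h y \<in> ball 0 r" if "y \<in> ?W" for y using Wh[OF that] Nsub by blast
  have G: "holo_on ?W (\<lambda>y. g (h y))" by (rule holo_on_compose[OF hW g hr])
  have fibre: "g (h y) = g (h y')" if y: "y \<in> ?W" "y' \<in> ?W" and eq: "y $ 1 = y' $ 1" for y y'
  proof (rule holo_on_const_on_line[OF G convex_ball y])
    fix x assume x: "x \<in> ?W"
    define v where "v = dmat h x *v (y' - y)"
    have xV: "x \<in> V" using x s(2) by blast
    have "dmat \<Phi> (h x) *v v = y' - y"
      unfolding v_def by (simp add: matrix_vector_mul_assoc h(8)[OF xV])
    then have "(dmat \<Phi> (h x) *v v) $ 1 = 0" using eq by simp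
    then have 1: "(dmat g (h x) *v v) $ i = 0"
      using \<Phi>(2)[OF hr[OF x]] by (simp add: mat2_vec_entry)
    have "det (dmat \<Phi> (h x)) * det (dmat h x) = 1"
      using h(8)[OF xV] by (metis det_mul det_I)
    then have "det (vector [dmat g (h x) $ i, axis k 1] :: complex^2^2) \<noteq> 0"
      unfolding \<Phi>(2)[OF hr[OF x]] by (metis mult_zero_left zero_neq_one)
    then have "dmat g (h x) $ i $ j \<noteq> 0" by (simp only: det_chart[OF k] not_False_eq_True)
    then have "dmat g (h x) *v v = 0"
      using rank_one_kernel[OF det0[OF hr[OF x]] 1] by blast
    then show "dmat (\<lambda>y. g (h y)) x *v (y' - y) = 0"
      unfolding dmat_compose[OF hW x g hr[OF x]] v_def by (simp add: matrix_vector_mul_assoc)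
  qed
  have "g z = g w \<longleftrightarrow> \<Phi> z $ 1 = \<Phi> w $ 1" if z: "z \<in> N" and w: "w \<in> N" for z w
  proof
    show "\<Phi> z $ 1 = \<Phi> w $ 1" if "g z = g w" using that by (simp add: \<Phi>_def)
    assume "\<Phi> z $ 1 = \<Phi> w $ 1"
    then have "g (h (\<Phi> z)) = g (h (\<Phi> w))" using z w by (intro fibre) (auto simp: N_def)
    then show "g z = g w" using h\<Phi>(1) z w by (simp add: N_def)
  qed
  moreover have "0 \<in> N" using h(3) s(1) by (simp add: N_def)
  ultimately show ?thesis using that Nsub bih by blast
qed

text \<open>Where g has rank two its image contains an open set, fixed pointwise by h. That set may
  be away from 0, so the identity theorem on the whole ball carries h = id to the origin.\<close>

lemma holo_fixing_open_image:
  assumes g: "holo_on (ball 0 \<rho>) g" and h: "holo_on (ball 0 r) h" and z: "z \<in> ball 0 \<rho>"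
    and im: "\<And>z. z \<in> ball 0 \<rho> \<Longrightarrow> g z \<in> ball 0 r" and r: "0 < r"
    and hg: "\<And>z. z \<in> ball 0 \<rho> \<Longrightarrow> h (g z) = g z" and nz: "det (dmat g z) \<noteq> 0"
  shows "dmat h 0 = mat 1"
proof -
  obtain U V k where "open V" "g z \<in> V" "homeomorphism U V g k" "U \<subseteq> ball 0 \<rho>"
    using holo_inverse_function[OF g open_ball z nz] by metis
  then have V: "open V" "g z \<in> V" "V \<subseteq> g ` ball 0 \<rho>" unfolding homeomorphism_def by auto
  obtain e where e: "0 < e" "ball (g z) e \<subseteq> V" using V open_contains_ball by metis
  have "h x = id x" if "x \<in> ball 0 r" for x
  proof (rule holo_on_identity[OF h holo_on_id im[OF z] e(1) _ that])
    fix y assume "y \<in> ball (g z) e"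
    then obtain w where "w \<in> ball 0 \<rho>" "y = g w" using e(2) V(3) by blast
    then show "h y = id y" using hg by simp
  qed
  then have "dmat h 0 = dmat id 0" using r by (intro dmat_cong_open[OF holo_on_id, of "ball 0 r"]) auto
  also have "\<dots> = mat 1" by (rule dmat_unique) (simp add: id_def)
  finally show ?thesis .
qed

lemma crank_rank_one:
  fixes A :: "complex^2^2"
  assumes "det A = 0" "A \<noteq> 0"
  shows "crank (\<lambda>v. A *v v) = 1"
proof -
  let ?C = "{card B | B. finite B \<and> B \<subseteq> range (\<lambda>v. A *v v) \<and> c_indep B}"
  have le: "card B \<le> 1" if B: "finite B" "B \<subseteq> range (\<lambda>v. A *v v)" "c_indep B" for B
  proof (rule ccontr)
    assume "\<not> card B \<le> 1"
    then obtain u w where uw: "u \<in> B" "w \<in> B" "u \<noteq> w"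
      using B(1) card_le_Suc0_iff_eq[OF B(1)] by auto
    then obtain a b where ab: "u = A *v a" "w = A *v b" using B(2) by blast
    \<comment> \<open>With a and b as the columns of E, a kernel vector of A E is a linear relation
      between u and w.\<close>
    define E :: "complex^2^2" where "E = (\<chi> i j. if j = 1 then a $ i else b $ i)"
    have "det (A ** E) = 0" using assms(1) by (simp add: det_mul)
    then obtain v where v: "v \<noteq> 0" "(A ** E) *v v = 0" using kernel_2 by blast
    have "(A ** E) *v v = v$1 *s u + v$2 *s w"
      by (simp add: vec_eq_iff forall_2 mat2_vec_entry mat2_mult_entry ab E_def algebra_simps)
    then have rel: "v$1 *s u + v$2 *s w = 0" using v(2) by simp
    define c where "c x = (if x = u then v$1 else if x = w then v$2 else 0)" for x
    have "(\<Sum>x\<in>B. c x *s x) = (\<Sum>x\<in>{u, w}. c x *s x)"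
      using uw B(1) by (intro sum.mono_neutral_right) (auto simp: c_def)
    also have "\<dots> = 0" using uw(3) rel by (simp add: c_def)
    finally have "\<forall>x\<in>B. c x = 0" using B(3) unfolding c_indep_def by blast
    then have "v$1 = 0" "v$2 = 0" using uw by (auto simp: c_def split: if_splits)
    then show False using v(1) by (simp add: vec_eq_iff forall_2)
  qed
  obtain x where x: "A *v x \<noteq> 0" using assms(2) by (auto simp: matrix_eq)
  have "c = 0" if "c *s (A *v x) = 0" for c
    using norm_scale_c2[of c "A *v x"] x that by simp
  then have "c_indep {A *v x}" unfolding c_indep_def by simp
  then have one: "1 \<in> ?C" by (intro CollectI exI[of _ "{A *v x}"]) auto
  have "?C \<subseteq> {..1}" using le by auto
  then have "finite ?C" using finite_subset by blast
  then show ?thesis unfolding crank_def using one le by (intro Max_eqI) auto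
qed

subsection \<open>Nonautonomous iteration\<close>

lemma represents_near:
  assumes "represents h W g" "represents h' W' g"
  obtains s where "0 < s" "\<And>z. z \<in> ball 0 s \<Longrightarrow> h z = h' z"
proof -
  obtain e where "0 < e" "ball 0 e \<subseteq> W" using assms(1) unfolding represents_def open_contains_ball by blast
  then have "h \<in> germ_class h" using assms(1) holo_on_subset unfolding germ_class_def represents_def by blast
  then have "h \<in> germ_class h'" using assms unfolding represents_def by simp
  then show ?thesis using that unfolding germ_class_def by blast
qed

lemma represents_zero:
  assumes "represents h W g" shows "h 0 = 0"
proof -
  obtain r f where rf: "0 < r" "holo_on (ball 0 r) f" "f 0 = 0" "Rep_germ g = germ_class f"
    using Rep_germ[of g] by blast
  then have "represents f (ball 0 r) g" unfolding represents_def by simp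
  then obtain s where "0 < s" "\<And>z. z \<in> ball 0 s \<Longrightarrow> f z = h z" using represents_near assms by metis
  then show ?thesis using rf(3) by (metis centre_in_ball)
qed

text \<open>Representatives of a germ agree near 0, so the choice made in \<open>dgerm\<close> does
  not affect the derivative.\<close>

lemma dgerm_eq_dmat:
  assumes "represents h W g" shows "dgerm g = dmat h 0"
proof -
  have d: "(h has_derivative (\<lambda>v. dmat h 0 *v v)) (at 0)"
    using assms holo_on_has_derivative unfolding represents_def by blast
  define P where "P L \<longleftrightarrow> (\<exists>h W. represents h W g \<and> (h has_derivative L) (at 0))" for L
  have "P (\<lambda>v. dmat h 0 *v v)" unfolding P_def using assms d by blast
  then have "P (SOME L. P L)" by (rule someI[where P = P])
  then obtain h' W' where h': "represents h' W' g" "(h' has_derivative (SOME L. P L)) (at 0)" unfolding P_def by blast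
  obtain s where s: "0 < s" "\<And>z. z \<in> ball 0 s \<Longrightarrow> h' z = h z" using represents_near[OF h'(1) assms] by blast
  have "(h has_derivative (SOME L. P L)) (at 0)"
    by (rule has_derivative_transform_within_open[OF h'(2) open_ball[of 0 s]]) (use s in auto)
  then have "(SOME L. P L) = (\<lambda>v. dmat h 0 *v v)" using d has_derivative_unique by blast
  then have "dgerm g = (\<chi> i j. (dmat h 0 *v axis j 1) $ i)"
    unfolding dgerm_def P_def by (simp add: Let_def)
  then show ?thesis by (simp add: vec_eq_iff dmat_entry[of h])
qed

definition seq_shift :: "nat \<Rightarrow> (nat \<Rightarrow> 'a) \<Rightarrow> nat \<Rightarrow> 'a" where
  "seq_shift n \<omega> = (\<lambda>k. \<omega> (k + n))"

lemma seq_shift_0 [simp]: "seq_shift 0 \<omega> = \<omega>"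
  by (simp add: seq_shift_def)

lemma iterR_Suc_fun: "iterR R \<omega> (Suc n) = (\<lambda>z. repR R (\<omega> n) (iterR R \<omega> n z))"
  by (simp add: fun_eq_iff)

lemma iterR_add: "iterR R \<omega> (m + n) z = iterR R (seq_shift n \<omega>) m (iterR R \<omega> n z)"
  by (induction m) (simp_all add: seq_shift_def)

lemma prodM_add: "prodM \<omega> (m + n) = prodM (seq_shift n \<omega>) m ** prodM \<omega> n"
  by (induction m) (simp_all add: seq_shift_def matrix_mul_assoc)

text \<open>The margin between R / 2 and R keeps orbits where the next map is holomorphic. Being a
  closed condition, the bound can be tested on a countable dense set, which makes the event
  measurable.\<close>

definition stays_bounded :: "real \<Rightarrow> real \<Rightarrow> (nat \<Rightarrow> germ) \<Rightarrow> bool" where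
  "stays_bounded R a \<omega> \<longleftrightarrow> (\<forall>n. \<forall>z\<in>ball 0 a. norm (iterR R \<omega> n z) \<le> R / 2)"

context
  fixes R :: real and \<omega> :: "nat \<Rightarrow> germ"
  assumes R: "0 < R" and rep: "\<And>k. bdd_rep (repR R (\<omega> k)) R (\<omega> k)"
begin

lemma rep_holo: "holo_on (ball 0 R) (repR R (\<omega> k))" "repR R (\<omega> k) 0 = 0" "dmat (repR R (\<omega> k)) 0 = dgerm (\<omega> k)"
  using rep[of k] represents_zero dgerm_eq_dmat unfolding bdd_rep_def represents_def by (blast, metis rep bdd_rep_def, metis rep bdd_rep_def)

lemma iterR_zero: "iterR R \<omega> n 0 = 0"
  by (induction n) (simp_all add: rep_holo)

lemma iterR_holo:
  assumes "stays_bounded R a \<omega>"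
  shows "holo_on (ball 0 a) (iterR R \<omega> n)"
proof (induction n)
  case 0
  then show ?case using holo_on_id by (simp add: id_def)
next
  case (Suc n)
  have "norm (iterR R \<omega> n z) < R" if "z \<in> ball 0 a" for z
    using assms that R unfolding stays_bounded_def by (smt (verit) field_sum_of_halves)
  then show ?case using holo_on_compose[OF Suc rep_holo(1)] by simp
qed

lemma dmat_iterR:
  assumes "stays_bounded R a \<omega>" "0 < a"
  shows "dmat (iterR R \<omega> n) 0 = prodM \<omega> n"
proof (induction n)
  case 0
  have "dmat (\<lambda>z. z) 0 = mat 1" by (rule dmat_unique) simp
  then show ?case by simp
next
  case (Suc n)
  have "dmat (iterR R \<omega> (Suc n)) 0 = dmat (repR R (\<omega> n)) (iterR R \<omega> n 0) ** dmat (iterR R \<omega> n) 0"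
    unfolding iterR_Suc_fun
    using dmat_compose[OF iterR_holo[OF assms(1)] _ rep_holo(1), of 0 n n] assms(2) R by (simp add: iterR_zero)
  then show ?case by (simp only: Suc iterR_zero rep_holo(3) prodM.simps)
qed

text \<open>The constant does not depend on n: this is the equicontinuity used along the good
  times.\<close>

lemma iterR_Lipschitz:
  assumes "stays_bounded R a \<omega>" "0 < a" "z \<in> ball 0 (a/2)" "w \<in> ball 0 (a/2)"
  shows "norm (iterR R \<omega> n z - iterR R \<omega> n w) \<le> 4 * R / a * norm (z - w)"
proof -
  have "norm (iterR R \<omega> n z - iterR R \<omega> n w) \<le> 8 * (R/2) / a * norm (z - w)"
    using assms(1) by (intro holo_on_Lipschitz[OF iterR_holo[OF assms(1)] _ assms(2-4)]) (auto simp: stays_bounded_def)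
  then show ?thesis by simp
qed

lemma ball_subset_Uom:
  assumes "stays_bounded R a \<omega>" "0 < a" "a \<le> R"
  shows "ball 0 a \<subseteq> Uom R \<omega>"
proof -
  have "norm (iterR R \<omega> n z) < R" if "z \<in> ball 0 a" for n z
    using assms(1) that R unfolding stays_bounded_def by (smt (verit) field_sum_of_halves)
  then have "ball 0 a \<subseteq> Dom R \<omega>" using assms(3) unfolding Dom_def by auto
  then have "ball 0 a \<subseteq> interior (Dom R \<omega>)" by (simp add: interior_maximal)
  then show ?thesis unfolding Uom_def using assms(2)
    by (intro connected_component_maximal) (auto intro: convex_connected)
qed

lemma msize_tendsto:
  assumes "M \<longlonglongrightarrow> A" shows "(\<lambda>n. msize (M n)) \<longlonglongrightarrow> msize A" "(\<lambda>n. det (M n)) \<longlonglongrightarrow> det A"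
  unfolding msize_def det_2 by (intro tendsto_intros assms)+

text \<open>Convergence of derivatives at 0 carries both the vanishing of the determinants and the
  lower bound c to the limit. Only convergence on a small ball is assumed, so this serves both for
  limits on \<open>Uom\<close> and for the limits chosen along good times.\<close>

lemma subsequential_limit_rank_one:
  assumes a: "stays_bounded R a \<omega>" "0 < a"
    and c: "0 < c" "\<And>n. c \<le> msize (prodM \<omega> n)" and det0: "(\<lambda>m. det (prodM \<omega> m)) \<longlonglongrightarrow> 0"
    and r: "strict_mono r" and e: "0 < e" "e \<le> a" and lim: "uniform_limit (ball 0 e) (\<lambda>k. iterR R \<omega> (r k)) g sequentially"
  shows "holo_on (ball 0 e) g" "det (dmat g 0) = 0" "dmat g 0 \<noteq> 0"
proof -
  have hol: "holo_on (ball 0 e) (iterR R \<omega> (r k))" for k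
    using holo_on_subset[OF iterR_holo[OF a(1)]] e by (simp add: subset_ball)
  show "holo_on (ball 0 e) g" by (rule holo_on_uniform_limit(1)[OF hol lim])
  have l: "(\<lambda>k. prodM \<omega> (r k)) \<longlonglongrightarrow> dmat g 0"
    using holo_on_uniform_limit(2)[OF hol lim, of 0] e unfolding dmat_iterR[OF a] by simp
  have "(\<lambda>k. det (prodM \<omega> (r k))) \<longlonglongrightarrow> 0" using LIMSEQ_subseq_LIMSEQ[OF det0 r] by (simp add: o_def)
  then show "det (dmat g 0) = 0" using msize_tendsto(2)[OF l] LIMSEQ_unique by blast
  have "c \<le> msize (dmat g 0)"
    by (rule tendsto_lowerbound[OF msize_tendsto(1)[OF l]]) (use c in auto)
  then show "dmat g 0 \<noteq> 0" using c(1) by (auto simp: msize_def)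
qed

lemma subsequential_limit_crank:
  assumes a: "stays_bounded R a \<omega>" "0 < a" "a \<le> R"
    and c: "0 < c" "\<And>n. c \<le> msize (prodM \<omega> n)" and det0: "(\<lambda>m. det (prodM \<omega> m)) \<longlonglongrightarrow> 0"
    and r: "strict_mono r"
    and lim: "\<And>K. compact K \<Longrightarrow> K \<subseteq> Uom R \<omega> \<Longrightarrow> uniform_limit K (\<lambda>k. iterR R \<omega> (r k)) g sequentially"
  shows "\<exists>L. (g has_derivative L) (at 0) \<and> crank L = 1"
proof -
  have "cball 0 (a/2) \<subseteq> Uom R \<omega>" using ball_subset_Uom[OF a] a(2) by (auto simp: subset_iff)
  then have "uniform_limit (cball 0 (a/2)) (\<lambda>k. iterR R \<omega> (r k)) g sequentially" by (intro lim) auto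
  then have "uniform_limit (ball 0 (a/2)) (\<lambda>k. iterR R \<omega> (r k)) g sequentially"
    by (rule uniform_limit_on_subset) auto
  from subsequential_limit_rank_one[OF a(1,2) c det0 r _ _ this] a(2)
  have "holo_on (ball 0 (a/2)) g" "det (dmat g 0) = 0" "dmat g 0 \<noteq> 0" by auto
  then show ?thesis using holo_on_has_derivative[of "ball 0 (a/2)" g 0] crank_rank_one a(2) by auto
qed

end

section \<open>Stable sets as level sets of one limit map\<close>

lemma biholo_translate:
  assumes "biholo N \<Phi>" shows "biholo N (\<lambda>w. \<Phi> w - c)"
proof -
  have b: "open N" "holo_on N \<Phi>" "inj_on \<Phi> N" "open (\<Phi> ` N)" "holo_on (\<Phi> ` N) (inv_into N \<Phi>)"
    using assms unfolding biholo_def by auto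
  let ?F = "\<lambda>w. \<Phi> w - c"
  have im: "?F ` N = (\<lambda>y. y - c) ` (\<Phi> ` N)" by (simp add: image_image)
  have o: "open (?F ` N)" unfolding im using open_translation_subtract[OF b(4)] .
  have inj: "inj_on ?F N" using b(3) by (auto simp: inj_on_def)
  have tr: "((\<lambda>w. w + d) has_derivative (\<lambda>v. mat 1 *v v)) (at w)" for w d :: c2
    by (auto intro!: derivative_eq_intros)
  have tr': "holo_on S (\<lambda>w. w + d)" for S d by (rule holo_onI) (rule tr)
  have "holo_on N (\<lambda>w. \<Phi> w + (- c))" by (rule holo_on_compose[OF b(2) tr'[of UNIV]]) simp
  then have "holo_on N ?F" by simp
  moreover have "holo_on (?F ` N) (inv_into N ?F)"
  proof (rule holo_on_cong_open[OF _ o])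
    show "holo_on (?F ` N) (\<lambda>y. inv_into N \<Phi> (y + c))"
      by (rule holo_on_compose[OF tr' b(5)]) auto
    fix y assume "y \<in> ?F ` N"
    then obtain w where w: "w \<in> N" "y = \<Phi> w - c" by blast
    then show "inv_into N ?F y = inv_into N \<Phi> (y + c)"
      using inv_into_f_f[OF inj w(1)] inv_into_f_f[OF b(3) w(1)] by simp
  qed
  ultimately show ?thesis unfolding biholo_def using b(1) o inj by blast
qed

text \<open>Deterministic core, for one fixed \<open>\<omega>\<close>. The radius a controls the
  orbit from time 0 and produces g; the radius b, available at infinitely many times, controls
  everything that happens after such a time.\<close>

lemma stable_sets_submanifolds:
  assumes R: "0 < R" and rep: "\<And>k. bdd_rep (repR R (\<omega> k)) R (\<omega> k)"
    and a: "stays_bounded R a \<omega>" "0 < a" "a \<le> R"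
    and b: "infinite {n. stays_bounded R b (seq_shift n \<omega>)}" "0 < b" "b \<le> R"
    and c: "0 < c" "\<And>n. c \<le> msize (prodM \<omega> n)"
    and det0: "\<And>n. (\<lambda>m. det (prodM (seq_shift n \<omega>) m)) \<longlonglongrightarrow> 0"
  shows "\<exists>\<rho>>0. \<forall>z\<in>ball 0 \<rho>. one_dim_submfd_near (Ws R \<omega> z) z"
proof -
  let ?f = "iterR R \<omega>"
  let ?T = "{n. stays_bounded R b (seq_shift n \<omega>)}"
  have reps: "bdd_rep (repR R (seq_shift n \<omega> k)) R (seq_shift n \<omega> k)" for n k using rep by (simp add: seq_shift_def)
  define K where "K = 4 * R / a"
  have K: "K > 0" using R a by (simp add: K_def)
  \<comment> \<open>Within a/4 the Lipschitz bound and the limit g are available; the second entry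
    sends all iterates into radius b/16, well inside the ball b/4 on which the limits of the later
    maps live.\<close>
  define \<rho>1 where "\<rho>1 = min (a/4) (b / (16 * K))"
  have \<rho>1: "0 < \<rho>1" "\<rho>1 \<le> a/4" "K * \<rho>1 \<le> b/16"
  proof -
    show "0 < \<rho>1" "\<rho>1 \<le> a/4" using a b K by (auto simp: \<rho>1_def)
    have "K * \<rho>1 \<le> K * (b / (16 * K))" using K by (intro mult_left_mono) (auto simp: \<rho>1_def)
    then show "K * \<rho>1 \<le> b/16" using K by simp
  qed
  have small: "norm (?f n z) \<le> b/16" if "z \<in> ball 0 \<rho>1" for n z
  proof -
    have "norm (?f n z - ?f n 0) \<le> K * norm (z - 0)"
      unfolding K_def using that \<rho>1 a by (intro iterR_Lipschitz[OF R rep a(1,2)]) auto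
    also have "\<dots> \<le> K * \<rho>1" using that K by (intro mult_left_mono) auto
    finally show ?thesis using \<rho>1(3) iterR_zero[OF R rep] by simp
  qed
  obtain g q where q: "strict_mono (q::nat\<Rightarrow>nat)"
    "uniform_limit (cball 0 (a/4)) (\<lambda>k. ?f (enumerate ?T (q k))) g sequentially"
    by (rule holo_on_Montel[where F = "\<lambda>k. ?f (enumerate ?T k)" and a = 0 and r = a and B = "R/2"])
       (use a iterR_holo[OF R rep a(1)] in \<open>auto simp: stays_bounded_def\<close>)
  define N where "N k = enumerate ?T (q k)" for k
  have N: "strict_mono N" unfolding N_def
    using strict_mono_o[OF strict_mono_enumerate[OF b(1)] q(1)] by (simp add: o_def)
  have NT: "stays_bounded R b (seq_shift (N k) \<omega>)" for k
    using enumerate_in_set[OF b(1), of "q k"] by (simp add: N_def)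
  have lim: "uniform_limit (ball 0 \<rho>1) (\<lambda>k. ?f (N k)) g sequentially"
    using q(2) unfolding N_def[symmetric] by (rule uniform_limit_on_subset) (use \<rho>1 in auto)
  have "\<rho>1 \<le> a" using \<rho>1(2) a(2) by simp
  from subsequential_limit_rank_one[OF R rep a(1,2) c _ N \<rho>1(1) this lim] det0[of 0]
  have g: "holo_on (ball 0 \<rho>1) g" "dmat g 0 \<noteq> 0" by auto
  have ptw: "(\<lambda>k. ?f (N k) z) \<longlonglongrightarrow> g z" if "z \<in> ball 0 \<rho>1" for z
    using lim that by (rule tendsto_uniform_limitI)
  have gsmall: "norm (g z) \<le> b/16" if "z \<in> ball 0 \<rho>1" for z
    by (rule tendsto_upperbound[OF tendsto_norm[OF ptw[OF that]]]) (use small that in auto)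
  have rank: "det (dmat g z) = 0" if z: "z \<in> ball 0 \<rho>1" for z
  proof (rule ccontr)
    assume nz: "det (dmat g z) \<noteq> 0"
    \<comment> \<open>The determinant of the segment that starts at \<open>N k\<close> must become
      small, hence the assumption \<open>det0\<close> after every shift.\<close>
    have "\<exists>l>k. cmod (det (prodM (seq_shift (N k) \<omega>) (N l - N k))) < 1/2" for k
    proof -
      have "eventually (\<lambda>m. dist (det (prodM (seq_shift (N k) \<omega>) m)) 0 < 1/2) sequentially"
        by (rule tendstoD[OF det0]) simp
      then obtain M where M: "\<And>m. m \<ge> M \<Longrightarrow> cmod (det (prodM (seq_shift (N k) \<omega>) m)) < 1/2"
        unfolding eventually_sequentially by auto
      have "N (k + j) \<ge> N k + j" for j
      proof (induction j)
        case (Suc j)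
        then show ?case using strict_monoD[OF N, of "k + j" "k + Suc j"] by simp
      qed simp
      from this[of "M + 1"] show ?thesis by (intro exI[of _ "k + (M + 1)"] conjI M) auto
    qed
    then obtain l where l: "\<And>k. l k > k" "\<And>k. cmod (det (prodM (seq_shift (N k) \<omega>) (N (l k) - N k))) < 1/2" by metis
    define h where "h k = iterR R (seq_shift (N k) \<omega>) (N (l k) - N k)" for k
    have hh: "holo_on (ball 0 b) (h k)" for k unfolding h_def by (rule iterR_holo[OF R reps NT])
    have hbd: "norm (h k z) \<le> R / 2" if "z \<in> ball 0 b" for k z
      using NT[of k] that unfolding stays_bounded_def h_def by blast
    obtain hlim p where p: "strict_mono (p::nat\<Rightarrow>nat)" "continuous_on (cball 0 (b/4)) hlim"
      "uniform_limit (cball 0 (b/4)) (\<lambda>k. h (p k)) hlim sequentially"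
      by (rule holo_on_Montel[where F = h and a = 0 and r = b and B = "R/2"])
         (use b(2) hh hbd in auto)
    have limb: "uniform_limit (ball 0 (b/4)) (\<lambda>k. h (p k)) hlim sequentially"
      by (rule uniform_limit_on_subset[OF p(3)]) auto
    have hb: "holo_on (ball 0 (b/4)) (h (p k))" for k
      by (rule holo_on_subset[OF hh]) (use b(2) in auto)
    have hol: "holo_on (ball 0 (b/4)) hlim" by (rule holo_on_uniform_limit(1)[OF hb limb])
    \<comment> \<open>The segment map \<open>h (p k)\<close> sends the orbit at time
      \<open>N (p k)\<close> to the orbit at time \<open>N (l (p k))\<close>. Both orbit points
      converge to g x, and the segment maps converge uniformly to \<open>hlim\<close>.\<close>
    have fixes_: "hlim (g x) = g x" if x: "x \<in> ball 0 \<rho>1" for x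
    proof -
      have sub: "filterlim (\<lambda>k. l (p k)) at_top sequentially"
      proof (rule filterlim_at_top_mono[OF filterlim_subseq[OF p(1)]])
        show "\<forall>\<^sub>F k in sequentially. p k \<le> l (p k)" using l(1) by (simp add: less_imp_le)
      qed
      have "(\<lambda>k. ?f (N (p k)) x) \<longlonglongrightarrow> g x"
        using LIMSEQ_subseq_LIMSEQ[OF ptw[OF x] p(1)] by (simp add: o_def)
      moreover have "?f n x \<in> cball 0 (b/4)" for n using small[OF x, of n] b(2) by simp
      moreover have "g x \<in> cball 0 (b/4)" using gsmall[OF x] b(2) by simp
      ultimately have "(\<lambda>k. h (p k) (?f (N (p k)) x)) \<longlonglongrightarrow> hlim (g x)"
        using uniform_limit_compose_tendsto[OF p(3,2)] by blast
      moreover have "h (p k) (?f (N (p k)) x) = ?f (N (l (p k))) x" for k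
      proof -
        have "N (p k) \<le> N (l (p k))" using strict_mono_leD[OF N] l(1) less_imp_le by blast
        then show ?thesis unfolding h_def
          using iterR_add[of R \<omega> "N (l (p k)) - N (p k)" "N (p k)" x] by simp
      qed
      ultimately have "(\<lambda>k. ?f (N (l (p k))) x) \<longlonglongrightarrow> hlim (g x)" by simp
      moreover have "(\<lambda>k. ?f (N (l (p k))) x) \<longlonglongrightarrow> g x"
        by (rule filterlim_compose[OF ptw[OF x] sub])
      ultimately show ?thesis using LIMSEQ_unique by blast
    qed
    have "g x \<in> ball 0 (b/4)" if "x \<in> ball 0 \<rho>1" for x using gsmall[OF that] b(2) by simp
    then have "dmat hlim 0 = mat 1"
      using b(2) by (intro holo_fixing_open_image[OF g(1) hol z _ _ fixes_ nz]) auto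
    moreover have "(\<lambda>k. dmat (h (p k)) 0) \<longlonglongrightarrow> dmat hlim 0"
      using holo_on_uniform_limit(2)[OF hb limb, of 0] b(2) by simp
    ultimately have "(\<lambda>k. det (dmat (h (p k)) 0)) \<longlonglongrightarrow> det (mat 1 :: complex^2^2)"
      using msize_tendsto(2)[OF R rep] by metis
    then have "(\<lambda>k. cmod (det (dmat (h (p k)) 0))) \<longlonglongrightarrow> 1" by (auto dest: tendsto_norm)
    moreover have "cmod (det (dmat (h (p k)) 0)) \<le> 1/2" for k
      using l(2)[of "p k"] dmat_iterR[OF R reps NT b(2)] by (simp add: h_def)
    ultimately have "(1::real) \<le> 1/2" by (intro tendsto_upperbound[of _ 1 sequentially]) auto
    then show False by simp
  qed
  obtain V \<Phi> where V: "0 \<in> V" "V \<subseteq> ball 0 \<rho>1" "biholo V \<Phi>"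
    "\<And>z w. z \<in> V \<Longrightarrow> w \<in> V \<Longrightarrow> g z = g w \<longleftrightarrow> \<Phi> z $ 1 = \<Phi> w $ 1"
    using rank_one_level_chart[OF g(1) \<rho>1(1) rank g(2)] by blast
  have VU: "V \<subseteq> Uom R \<omega>"
    using V(2) ball_subset_Uom[OF R rep a] \<rho>1(2) a(2) subset_ball[of \<rho>1 a] by fastforce
  have Ws: "w \<in> Ws R \<omega> z \<longleftrightarrow> g z = g w" if z: "z \<in> V" and w: "w \<in> V" for z w
  proof
    assume "w \<in> Ws R \<omega> z"
    then have "(\<lambda>n. norm (?f n z - ?f n w)) \<longlonglongrightarrow> 0" by (simp add: Ws_def)
    then have "(\<lambda>k. norm (?f (N k) z - ?f (N k) w)) \<longlonglongrightarrow> 0"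
      using LIMSEQ_subseq_LIMSEQ[OF _ N] by (fastforce simp: o_def)
    moreover have "(\<lambda>k. norm (?f (N k) z - ?f (N k) w)) \<longlonglongrightarrow> norm (g z - g w)"
      using ptw V(2) z w by (intro tendsto_intros) auto
    ultimately have "norm (g z - g w) = 0" using LIMSEQ_unique by blast
    then show "g z = g w" by simp
  next
    assume eq: "g z = g w"
    \<comment> \<open>Closeness is known only at the times \<open>N k\<close>; the Lipschitz
      constant 4 R / b of the maps starting at one such time transports it to all later n.\<close>
    have "(\<lambda>n. norm (?f n z - ?f n w)) \<longlonglongrightarrow> 0"
    proof (rule LIMSEQ_I)
      fix e :: real assume e: "0 < e"
      have Kb: "4 * R / b > 0" using R b by simp
      have "(\<lambda>k. norm (?f (N k) z - ?f (N k) w)) \<longlonglongrightarrow> norm (g z - g w)"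
        using ptw V(2) z w by (intro tendsto_intros) auto
      then have "eventually (\<lambda>k. norm (?f (N k) z - ?f (N k) w) < e / (4 * R / b)) sequentially"
        using eq e R b(2) by (intro order_tendstoD(2)[of _ 0]) auto
      then obtain k where k: "norm (?f (N k) z - ?f (N k) w) < e / (4 * R / b)"
        using eventually_happens'[OF sequentially_bot] by blast
      have "norm (?f n z - ?f n w) < e" if n: "n \<ge> N k" for n
      proof -
        have i: "?f n x = iterR R (seq_shift (N k) \<omega>) (n - N k) (?f (N k) x)" for x
          using iterR_add[of R \<omega> "n - N k" "N k" x] n by simp
        have "norm (?f n z - ?f n w) \<le> 4 * R / b * norm (?f (N k) z - ?f (N k) w)"
          unfolding i using small[of z "N k"] small[of w "N k"] V(2) z w b(2)
          by (intro iterR_Lipschitz[OF R reps NT b(2)]) auto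
        also have "\<dots> < 4 * R / b * (e / (4 * R / b))" using k Kb by (intro mult_strict_left_mono) auto
        also have "\<dots> = e" using R b(2) by simp
        finally show ?thesis .
      qed
      then show "\<exists>no. \<forall>n\<ge>no. norm (norm (?f n z - ?f n w) - 0) < e" by auto
    qed
    then show "w \<in> Ws R \<omega> z" using VU w by (auto simp: Ws_def)
  qed
  have "open V" using V(3) by (simp add: biholo_def)
  then obtain \<rho> where \<rho>: "0 < \<rho>" "ball 0 \<rho> \<subseteq> V" using V(1) open_contains_ball by metis
  have "one_dim_submfd_near (Ws R \<omega> z) z" if "z \<in> ball 0 \<rho>" for z
  proof -
    have z: "z \<in> V" using that \<rho>(2) by blast
    \<comment> \<open>Subtracting \<open>\<Phi> z\<close> moves the level through z to first
      coordinate zero.\<close>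
    let ?F = "\<lambda>w. \<Phi> w - \<Phi> z"
    have "?F ` (Ws R \<omega> z \<inter> V) = ?F ` V \<inter> {w. w $ 1 = 0}"
      using Ws[OF z] V(4)[OF z] by auto
    then show ?thesis unfolding one_dim_submfd_near_def
      using biholo_translate[OF V(3), of "\<Phi> z"] z Ws[OF z z] by blast
  qed
  then show ?thesis using \<rho>(1) by blast
qed

subsection \<open>Cocycles over the Bernoulli shift\<close>

text \<open>A visit at time t halves the tail supremum N steps later. Visits less than N apart
  overlap, so the product of N consecutive tail suprema is tracked: advancing the window by one
  replaces b k by b (k + N), gaining a factor 1/2 at each visit. As F (k + N) is below every factor,
  its N-th power decays exponentially.\<close>

lemma visits_exponential_decay:
  fixes F :: "nat \<Rightarrow> real" and G :: "nat \<Rightarrow> nat \<Rightarrow> real"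
  assumes F0: "\<And>n. 0 \<le> F n" and FC: "\<And>n. F n \<le> C" and sub: "\<And>m t. F (m + t) \<le> G m t * F t"
    and N: "1 \<le> N" and V: "\<And>t m. t \<in> V \<Longrightarrow> N \<le> m \<Longrightarrow> G m t \<le> 1/2"
    and c: "0 < c" and dens: "\<And>m. \<exists>k\<ge>m. c * real k \<le> real (card (V \<inter> {..<k}))"
    and slow: "\<And>C \<theta>. 0 < \<theta> \<Longrightarrow> \<theta> < 1 \<Longrightarrow> eventually (\<lambda>n. C * \<theta> ^ n < F n) sequentially"
  shows False
proof -
  define b where "b t = (SUP m\<in>{t..}. F m)" for t
  have bdd: "bdd_above (F ` {t..})" for t using FC by (intro bdd_aboveI[of _ C]) auto
  have Fb: "F m \<le> b t" if "t \<le> m" for m t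
    unfolding b_def using that by (intro cSUP_upper bdd) auto
  have ble: "b t \<le> x" if "\<And>m. t \<le> m \<Longrightarrow> F m \<le> x" for t x
    unfolding b_def using that by (intro cSUP_least) auto
  have bmono: "b t \<le> b s" if "s \<le> t" for s t
    by (rule ble) (use Fb that in auto)
  have bpos: "0 < b t" for t
  proof -
    have "eventually (\<lambda>n. 0 < F n) sequentially" using slow[of "1/2" 0] by simp
    then obtain n where "0 < F n" "t \<le> n"
      using eventually_ge_at_top[of t] eventually_happens'[OF sequentially_bot] eventually_conj by (metis (no_types, lifting))
    then show ?thesis using Fb[of t n] by simp
  qed
  have half: "b (t + N) \<le> (1/2) ^ (if t \<in> V then 1 else 0) * b t" for t
  proof (cases "t \<in> V")
    case True
    have "F m \<le> 1/2 * b t" if m: "t + N \<le> m" for m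
    proof -
      have "F m \<le> G (m - t) t * F t" using sub[of "m - t" t] m by simp
      also have "\<dots> \<le> 1/2 * F t" using V[OF True, of "m - t"] m F0 by (intro mult_right_mono) auto
      also have "\<dots> \<le> 1/2 * b t" using Fb[of t t] by simp
      finally show ?thesis .
    qed
    then have "b (t + N) \<le> 1/2 * b t" by (rule ble)
    then show ?thesis using True by simp
  qed (use bmono[of t "t + N"] in simp)
  have prod: "(\<Prod>t<N. b (k + t)) \<le> (1/2) ^ card (V \<inter> {..<k}) * (\<Prod>t<N. b t)" for k
  proof (induction k)
    case (Suc k)
    let ?e = "if k \<in> V then 1 else 0 :: nat"
    obtain N' where N': "N = Suc N'" using N by (cases N) auto
    have 1: "b k * (\<Prod>t<N. b (Suc k + t)) = b (k + N) * (\<Prod>t<N. b (k + t))"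
    proof -
      have "(\<Prod>t<Suc N. b (k + t)) = b k * (\<Prod>t<N. b (k + Suc t))"
        by (subst prod.lessThan_Suc_shift) simp
      moreover have "(\<Prod>t<Suc N. b (k + t)) = b (k + N) * (\<Prod>t<N. b (k + t))" by (simp add: mult.commute)
      ultimately show ?thesis by simp
    qed
    also have "\<dots> \<le> ((1/2) ^ ?e * b k) * ((1/2) ^ card (V \<inter> {..<k}) * (\<Prod>t<N. b t))"
      using bpos by (intro mult_mono half Suc) (auto intro!: prod_nonneg mult_nonneg_nonneg less_imp_le[OF bpos])
    finally have "b k * (\<Prod>t<N. b (Suc k + t)) \<le> b k * ((1/2) ^ (?e + card (V \<inter> {..<k})) * (\<Prod>t<N. b t))"
      by (simp only: power_add mult_ac)
    then have "(\<Prod>t<N. b (Suc k + t)) \<le> (1/2) ^ (?e + card (V \<inter> {..<k})) * (\<Prod>t<N. b t)"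
      using bpos[of k] by simp
    moreover have "card (V \<inter> {..<Suc k}) = ?e + card (V \<inter> {..<k})"
      by (auto simp: lessThan_Suc Int_insert_right)
    ultimately show ?case by simp
  qed simp
  define P where "P = (\<Prod>t<N. b t)"
  have P: "0 < P" unfolding P_def using bpos by (simp add: prod_pos)
  \<comment> \<open>A density c of halvings bounds the window product by \<open>\<theta>0\<close>^k
    P. The N-th root turns this into a rate for F itself; the division by \<open>\<theta>\<close>^N
    below accounts for the time k + N instead of k.\<close>
  define \<theta>0 where "\<theta>0 = (1/2) powr c"
  have \<theta>0: "0 < \<theta>0" "\<theta>0 < 1" using c powr_less_mono'[of "1/2" 0 c] by (simp_all add: \<theta>0_def)
  define \<theta> where "\<theta> = root N \<theta>0"
  have \<theta>: "0 < \<theta>" "\<theta> < 1" "\<theta> ^ N = \<theta>0" using \<theta>0 N by (auto simp: \<theta>_def)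
  obtain K where K: "\<And>n. n \<ge> K \<Longrightarrow> (root N P / \<theta> ^ N) * \<theta> ^ n < F n"
    using slow[OF \<theta>(1,2)] unfolding eventually_sequentially by blast
  obtain k where k: "K \<le> k" "c * real k \<le> real (card (V \<inter> {..<k}))" using dens by blast
  have 1: "root N P * \<theta> ^ k < F (k + N)" using K[of "k + N"] k(1) \<theta>(1) by (simp add: power_add)
  have "P * \<theta>0 ^ k = (root N P * \<theta> ^ k) ^ N"
    using P N \<theta>(3) by (simp add: power_mult_distrib power_mult[symmetric] mult.commute[of k] power_mult)
  also have "\<dots> < F (k + N) ^ N"
    using 1 N P \<theta>(1) by (intro power_strict_mono) auto
  also have "\<dots> = (\<Prod>t<N. F (k + N))" by simp
  also have "\<dots> \<le> (\<Prod>t<N. b (k + t))" using F0 Fb by (intro prod_mono) auto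
  also have "\<dots> \<le> (1/2) ^ card (V \<inter> {..<k}) * P" unfolding P_def by (rule prod)
  also have "\<dots> \<le> \<theta>0 ^ k * P"
  proof (rule mult_right_mono)
    have "(1/2::real) ^ card (V \<inter> {..<k}) = (1/2) powr real (card (V \<inter> {..<k}))" by (simp add: powr_realpow)
    also have "\<dots> \<le> (1/2) powr (c * real k)" using k(2) by (intro powr_mono') auto
    also have "\<dots> = \<theta>0 ^ k" by (simp add: \<theta>0_def powr_powr[symmetric] powr_realpow)
    finally show "(1/2::real) ^ card (V \<inter> {..<k}) \<le> \<theta>0 ^ k" .
  qed (use P in simp)
  finally show False by simp
qed

section \<open>Independence, stationarity and recurrence for the shift\<close>

context sequence_space
begin

lemma seq_shift_measurable [measurable]: "seq_shift n \<in> measurable S S"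
  unfolding seq_shift_def by (rule measurable_PiM_single') (auto simp: space_PiM)

lemma space_S: "\<omega> \<in> space S \<longleftrightarrow> (\<forall>k. \<omega> k \<in> space M)"
  by (auto simp: space_PiM PiE_iff)

lemma seq_shift_comb_seq: "seq_shift n (comb_seq n \<omega> \<omega>') = \<omega>'"
  by (simp add: seq_shift_def comb_seq_add)

text \<open>Splicing the first n entries of one sequence to an independent second sequence preserves
  the law. Under the splicing the event pulls back to the rectangle B x A, since B sees only the
  prefix and the shift returns the second sequence.\<close>

lemma emeasure_prefix_shift:
  assumes B: "B \<in> sets S" and A: "A \<in> sets S"
    and dep: "\<And>\<omega> \<omega>'. \<omega> \<in> space S \<Longrightarrow> \<omega>' \<in> space S \<Longrightarrow> comb_seq n \<omega> \<omega>' \<in> B \<longleftrightarrow> \<omega> \<in> B"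
  shows "emeasure S {\<omega> \<in> space S. \<omega> \<in> B \<and> seq_shift n \<omega> \<in> A} = emeasure S B * emeasure S A"
proof -
  let ?X = "{\<omega> \<in> space S. \<omega> \<in> B \<and> seq_shift n \<omega> \<in> A}"
  have X: "?X \<in> sets S" using A B by measurable
  have "emeasure S ?X = emeasure (distr (S \<Otimes>\<^sub>M S) S (\<lambda>(\<omega>, \<omega>'). comb_seq n \<omega> \<omega>')) ?X"
    by (simp only: PiM_comb_seq)
  also have "\<dots> = emeasure (S \<Otimes>\<^sub>M S) ((\<lambda>(\<omega>, \<omega>'). comb_seq n \<omega> \<omega>') -` ?X \<inter> space (S \<Otimes>\<^sub>M S))"
    by (rule emeasure_distr[OF measurable_comb_seq X])
  also have "(\<lambda>(\<omega>, \<omega>'). comb_seq n \<omega> \<omega>') -` ?X \<inter> space (S \<Otimes>\<^sub>M S) = B \<times> A"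
  proof -
    have sp: "B \<subseteq> space S" "A \<subseteq> space S" using A B sets.sets_into_space by auto
    have "comb_seq n \<omega> \<omega>' \<in> space S" if "\<omega> \<in> space S" "\<omega>' \<in> space S" for \<omega> \<omega>'
      using that unfolding space_S comb_seq_def by auto
    then show ?thesis using sp dep
      by (auto simp: space_pair_measure seq_shift_comb_seq intro!: dep[THEN iffD2])
  qed
  also have "emeasure (S \<Otimes>\<^sub>M S) (B \<times> A) = emeasure S B * emeasure S A" by (rule P.emeasure_pair_measure_Times[OF B A])
  finally show ?thesis .
qed

lemma prob_prefix_shift:
  assumes "B \<in> sets S" "A \<in> sets S"
    "\<And>\<omega> \<omega>'. \<omega> \<in> space S \<Longrightarrow> \<omega>' \<in> space S \<Longrightarrow> comb_seq n \<omega> \<omega>' \<in> B \<longleftrightarrow> \<omega> \<in> B"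
  shows "P.prob {\<omega> \<in> space S. \<omega> \<in> B \<and> seq_shift n \<omega> \<in> A} = P.prob B * P.prob A"
  using emeasure_prefix_shift[OF assms] by (simp add: measure_def enn2real_mult)

lemma prob_seq_shift:
  assumes "A \<in> sets S"
  shows "P.prob {\<omega> \<in> space S. seq_shift n \<omega> \<in> A} = P.prob A"
proof -
  have "comb_seq n \<omega> \<omega>' \<in> space S" if "\<omega> \<in> space S" "\<omega>' \<in> space S" for \<omega> \<omega>'
    using that unfolding space_S comb_seq_def by auto
  then have "P.prob {\<omega> \<in> space S. \<omega> \<in> space S \<and> seq_shift n \<omega> \<in> A} = P.prob (space S) * P.prob A"
    by (intro prob_prefix_shift assms) auto
  then show ?thesis by (simp add: P.prob_space)
qed

lemma AE_seq_shift:
  assumes "AE \<omega> in S. Q \<omega>"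
  shows "AE \<omega> in S. Q (seq_shift n \<omega>)"
proof -
  obtain Z where Z: "Z \<in> sets S" "{\<omega> \<in> space S. \<not> Q \<omega>} \<subseteq> Z" "P.prob Z = 0"
    using assms by (auto elim!: AE_E simp: measure_def)
  have "P.prob {\<omega> \<in> space S. seq_shift n \<omega> \<in> Z} = 0" using prob_seq_shift[OF Z(1)] Z(3) by simp
  then have "AE \<omega> in S. \<not> seq_shift n \<omega> \<in> Z"
    using Z(1) by (subst (asm) P.prob_eq_0) (auto elim: AE_mp)
  then show ?thesis
  proof (rule AE_mp, intro AE_I2 impI)
    fix \<omega> assume "\<omega> \<in> space S" "seq_shift n \<omega> \<notin> Z"
    moreover have "seq_shift n \<omega> \<in> space S" using \<open>\<omega> \<in> space S\<close> by (simp add: space_S seq_shift_def)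
    ultimately show "Q (seq_shift n \<omega>)" using Z(2) by blast
  qed
qed

text \<open>The tail unions decrease to the limsup and each has probability at least p; continuity
  from above concludes.\<close>

lemma prob_infinitely_often:
  fixes E :: "nat \<Rightarrow> (nat \<Rightarrow> 'a) set"
  assumes E: "\<And>n. E n \<in> sets S" and p: "\<And>n. 1 \<le> n \<Longrightarrow> p \<le> P.prob (E n)"
  shows "{\<omega> \<in> space S. \<forall>m. \<exists>n\<ge>m. \<omega> \<in> E n} \<in> sets S"
    and "p \<le> P.prob {\<omega> \<in> space S. \<forall>m. \<exists>n\<ge>m. \<omega> \<in> E n}"
proof -
  let ?U = "\<lambda>m. \<Union>n\<in>{m..}. E n"
  have U: "?U m \<in> sets S" for m by (rule sets.countable_UN'') (auto intro: E countableI_type)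
  have eq: "{\<omega> \<in> space S. \<forall>m. \<exists>n\<ge>m. \<omega> \<in> E n} = (\<Inter>m. ?U m)"
    using sets.sets_into_space[OF E] by (auto simp: Bex_def) blast
  show "{\<omega> \<in> space S. \<forall>m. \<exists>n\<ge>m. \<omega> \<in> E n} \<in> sets S" unfolding eq using U by auto
  have "(\<lambda>m. P.prob (?U m)) \<longlonglongrightarrow> P.prob (\<Inter>m. ?U m)"
  proof (rule P.finite_Lim_measure_decseq)
    show "decseq ?U" unfolding decseq_def by (intro allI impI UN_mono) auto
  qed (use U in auto)
  moreover have "p \<le> P.prob (?U m)" for m
  proof -
    have "p \<le> P.prob (E (Suc m))" by (rule p) simp
    also have "\<dots> \<le> P.prob (?U m)" by (rule P.finite_measure_mono[OF UN_upper U]) simp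
    finally show ?thesis .
  qed
  ultimately show "p \<le> P.prob {\<omega> \<in> space S. \<forall>m. \<exists>n\<ge>m. \<omega> \<in> E n}"
    unfolding eq by (intro tendsto_lowerbound) auto
qed

text \<open>By stationarity the visit count has expectation n p. It is at most n on
  \<open>E n\<close> and at most n p / 2 off it, so \<open>E n\<close> must carry the remaining n p
  / 2 of the expectation.\<close>

lemma prob_visits_density:
  assumes A: "A \<in> sets S"
  defines "E \<equiv> \<lambda>n. {\<omega> \<in> space S. P.prob A / 2 * real n \<le> real (card ({t. seq_shift t \<omega> \<in> A} \<inter> {..<n}))}"
  shows "E n \<in> sets S" and "1 \<le> n \<Longrightarrow> P.prob A / 2 \<le> P.prob (E n)"
proof -
  let ?p = "P.prob A"
  let ?c = "\<lambda>n \<omega>. \<Sum>t<n. indicat_real {\<omega> \<in> space S. seq_shift t \<omega> \<in> A} \<omega>"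
  have card: "real (card ({t. seq_shift t \<omega> \<in> A} \<inter> {..<n})) = ?c n \<omega>" if "\<omega> \<in> space S" for \<omega> n
  proof -
    have "?c n \<omega> = (\<Sum>t<n. indicat_real {t. seq_shift t \<omega> \<in> A} t)"
      using that by (intro sum.cong) (auto simp: indicator_def)
    also have "\<dots> = real (card ({t. seq_shift t \<omega> \<in> A} \<inter> {..<n}))"
      by (simp add: indicator_def sum.If_cases Int_commute of_bool_def)
    finally show ?thesis by simp
  qed
  have At: "{\<omega> \<in> space S. seq_shift t \<omega> \<in> A} \<in> sets S" for t using A by measurable
  have E': "E n = {\<omega> \<in> space S. ?p / 2 * real n \<le> ?c n \<omega>}" for n
    unfolding E_def using card by auto
  have meas: "?c n \<in> borel_measurable S" for n using At by measurable
  show E: "E n \<in> sets S" for n unfolding E' using meas by measurable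
  assume n: "1 \<le> n"
  have "real n * ?p = P.expectation (?c n)"
    using At prob_seq_shift[OF A] by (simp add: P.emeasure_eq_measure)
  also have "\<dots> \<le> P.expectation (\<lambda>\<omega>. real n * indicator (E n) \<omega> + ?p / 2 * real n)"
  proof (rule integral_mono)
    show "integrable S (?c n)" using At by (auto simp: P.emeasure_eq_measure)
    show "integrable S (\<lambda>\<omega>. real n * indicator (E n) \<omega> + ?p / 2 * real n)"
      using E by (auto simp: P.emeasure_eq_measure)
    fix \<omega> assume \<omega>: "\<omega> \<in> space S"
    have "?c n \<omega> \<le> real n" using sum_bounded_above[of "{..<n}" "\<lambda>t. indicat_real {\<omega> \<in> space S. seq_shift t \<omega> \<in> A} \<omega>" 1]
      by (simp add: indicator_def)
    moreover have "0 \<le> ?p / 2 * real n" by simp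
    moreover have "?c n \<omega> \<le> ?p / 2 * real n" if "\<omega> \<notin> E n" using that \<omega> unfolding E' by simp
    moreover have "indicat_real (E n) \<omega> = (if \<omega> \<in> E n then 1 else 0)" by simp
    ultimately show "?c n \<omega> \<le> real n * indicator (E n) \<omega> + ?p / 2 * real n"
      by (cases "\<omega> \<in> E n") (simp_all only: if_True if_False, simp_all)
  qed
  also have "\<dots> = real n * P.prob (E n) + ?p / 2 * real n"
    using E by (simp add: P.emeasure_eq_measure P.prob_space)
  finally have "real n * (?p / 2) \<le> real n * P.prob (E n)" by (simp add: field_simps)
  then show "?p / 2 \<le> P.prob (E n)" using n by simp
qed

lemma exists_of_positive_prob_AE:
  assumes "D \<in> sets S" "0 < P.prob D" "AE \<omega> in S. Q \<omega>"
  shows "\<exists>\<omega>\<in>D. Q \<omega>"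
proof (rule ccontr)
  assume "\<not> ?thesis"
  then have "AE \<omega> in S. \<omega> \<notin> D" using assms(3) by (auto elim!: AE_mp)
  then have "P.prob D = 0" using assms(1) by (simp add: P.prob_eq_0)
  then show False using assms(2) by simp
qed

text \<open>By stationarity the shifts of \<open>A j\<close> occur infinitely often with probability
  at least that of \<open>A j\<close>, which tends to 1. The index j depends on
  \<open>\<omega>\<close>, but for each \<open>\<omega>\<close> one j serves infinitely many
  times.\<close>

lemma AE_infinitely_often_some:
  assumes A: "\<And>j::nat. A j \<in> sets S" and inc: "\<And>i j. i \<le> j \<Longrightarrow> A i \<subseteq> A j"
    and full: "AE \<omega> in S. \<exists>j. \<omega> \<in> A j"
  shows "AE \<omega> in S. \<exists>j. \<forall>m. \<exists>n\<ge>m. seq_shift n \<omega> \<in> A j"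
proof -
  let ?E = "\<lambda>j n. {\<omega> \<in> space S. seq_shift n \<omega> \<in> A j}"
  let ?I = "\<lambda>j. {\<omega> \<in> space S. \<forall>m. \<exists>n\<ge>m. \<omega> \<in> ?E j n}"
  have E: "?E j n \<in> sets S" for j n using A[of j] by measurable
  have I: "?I j \<in> sets S" "P.prob (A j) \<le> P.prob (?I j)" for j
    using prob_infinitely_often[of "?E j" "P.prob (A j)"] E prob_seq_shift[OF A] by auto
  have U: "(\<Union>j. ?I j) \<in> sets S" using I(1) by blast
  have "P.prob (\<Union>j. A j) = 1"
    using A full by (intro P.prob_eq_1[THEN iffD2]) auto
  moreover have "(\<lambda>j. P.prob (A j)) \<longlonglongrightarrow> P.prob (\<Union>j. A j)"
    using A inc by (intro P.finite_Lim_measure_incseq) (auto simp: incseq_def)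
  moreover have "P.prob (A j) \<le> P.prob (\<Union>j. ?I j)" for j
    using I(2)[of j] P.finite_measure_mono[OF _ U, of "?I j"] by force
  ultimately have "1 \<le> P.prob (\<Union>j. ?I j)" by (intro tendsto_upperbound) auto
  then have "P.prob (\<Union>j. ?I j) = 1" using P.prob_le_1 order_antisym by blast
  then have "AE \<omega> in S. \<omega> \<in> (\<Union>j. ?I j)" by (rule P.AE_prob_1)
  then show ?thesis by (rule AE_mp) (intro AE_I2, blast)
qed

text \<open>The lower bound found is deterministic: it depends only on a C0 that bounds the whole
  sequence with positive probability. Smallness at time n and the bound C0 after time n are
  independent, so both occur together with positive probability, and recurrence of that event forces
  exponential decay.\<close>

lemma cocycle_bounded_below:
  fixes F :: "nat \<Rightarrow> (nat \<Rightarrow> 'a) \<Rightarrow> real"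
  assumes meas [measurable]: "\<And>n. F n \<in> borel_measurable S"
    and F0: "\<And>n \<omega>. 0 \<le> F n \<omega>"
    and sub: "\<And>m n \<omega>. F (m + n) \<omega> \<le> F m (seq_shift n \<omega>) * F n \<omega>"
    and dep: "\<And>n \<omega> \<omega>'. F n (comb_seq n \<omega> \<omega>') = F n \<omega>"
    and bdd: "AE \<omega> in S. \<exists>C. \<forall>n. F n \<omega> \<le> C"
    and slow: "AE \<omega> in S. \<forall>C \<theta>. 0 < \<theta> \<longrightarrow> \<theta> < 1 \<longrightarrow> eventually (\<lambda>n. C * \<theta> ^ n < F n \<omega>) sequentially"
  shows "AE \<omega> in S. \<exists>c>0. \<forall>n. c \<le> F n \<omega>"
proof -
  define A where "A C = {\<omega> \<in> space S. \<forall>n. F n \<omega> \<le> real C}" for C :: nat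
  have A: "A C \<in> sets S" for C unfolding A_def by measurable
  have "\<exists>C. P.prob (A C) > 0"
  proof (rule ccontr)
    assume "\<not> ?thesis"
    then have "P.prob (A C) = 0" for C using measure_nonneg[of S "A C"] by (metis less_eq_real_def)
    then have "AE \<omega> in S. \<omega> \<notin> A C" for C using A by (simp add: P.prob_eq_0)
    then have "AE \<omega> in S. \<forall>C. \<omega> \<notin> A C" by (simp add: AE_all_countable)
    with bdd AE_space[of S] have "AE \<omega> in S. False"
    proof eventually_elim
      case (elim \<omega>)
      then obtain C where C: "\<And>n. F n \<omega> \<le> C" by blast
      have "F n \<omega> \<le> real (nat \<lceil>C\<rceil>)" for n using C[of n] real_nat_ceiling_ge[of C] by linarith
      then have "\<omega> \<in> A (nat \<lceil>C\<rceil>)" using elim by (simp add: A_def)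
      then show ?case using elim by blast
    qed
    then show False by simp
  qed
  then obtain C0 where C0: "P.prob (A C0) > 0" by blast
  \<comment> \<open>Smallness c against the later bound C0 yields the factor 1/2; the 1 added covers
    C0 = 0.\<close>
  define c where "c = 1 / (2 * (real C0 + 1))"
  have c: "0 < c" "c * real C0 \<le> 1/2" by (simp_all add: c_def field_simps)
  have "AE \<omega> in S. c \<le> F n \<omega>" for n
  proof -
    define B where "B = {\<omega> \<in> space S. F n \<omega> < c}"
    have B: "B \<in> sets S" unfolding B_def by measurable
    define A' where "A' = {\<omega> \<in> space S. \<omega> \<in> B \<and> seq_shift n \<omega> \<in> A C0}"
    have A': "A' \<in> sets S" unfolding A'_def using B A[of C0] by measurable
    have cs: "comb_seq n \<omega> \<omega>' \<in> space S" if "\<omega> \<in> space S" "\<omega>' \<in> space S" for \<omega> \<omega>'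
      using that unfolding space_S comb_seq_def by auto
    have pA': "P.prob A' = P.prob B * P.prob (A C0)"
      unfolding A'_def using cs by (intro prob_prefix_shift B A) (auto simp: B_def dep)
    \<comment> \<open>\<open>Suc n\<close> in place of n because the window length in the decay
      lemma must be positive.\<close>
    have contr: "F m \<omega> \<le> 1/2" if "\<omega> \<in> A'" "Suc n \<le> m" for m \<omega>
    proof -
      have "F m \<omega> \<le> F (m - n) (seq_shift n \<omega>) * F n \<omega>" using sub[of "m - n" n \<omega>] that(2) by simp
      also have "\<dots> \<le> real C0 * c"
        using that(1) F0 by (intro mult_mono) (auto simp: A'_def A_def B_def)
      finally show ?thesis using c(2) by (simp add: mult.commute)
    qed
    have "P.prob B = 0"
    proof (rule ccontr)
      assume "P.prob B \<noteq> 0"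
      then have "0 < P.prob B" using measure_nonneg[of S B] by linarith
      then have p: "0 < P.prob A'" unfolding pA' using C0 by (rule mult_pos_pos)
      let ?E = "\<lambda>n. {\<omega> \<in> space S. P.prob A' / 2 * real n \<le> real (card ({t. seq_shift t \<omega> \<in> A'} \<inter> {..<n}))}"
      let ?I = "{\<omega> \<in> space S. \<forall>m. \<exists>n\<ge>m. \<omega> \<in> ?E n}"
      have I: "?I \<in> sets S" "P.prob A' / 2 \<le> P.prob ?I"
        using prob_infinitely_often[of ?E "P.prob A' / 2", OF prob_visits_density[OF A']] by blast+
      have "AE \<omega> in S. (\<exists>C. \<forall>n. F n \<omega> \<le> C) \<and>
        (\<forall>C \<theta>. 0 < \<theta> \<longrightarrow> \<theta> < 1 \<longrightarrow> eventually (\<lambda>n. C * \<theta> ^ n < F n \<omega>) sequentially)"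
        using bdd slow by eventually_elim blast
      then obtain \<omega> where \<omega>: "\<omega> \<in> ?I" "\<exists>C. \<forall>n. F n \<omega> \<le> C"
        "\<And>C \<theta>. 0 < \<theta> \<Longrightarrow> \<theta> < 1 \<Longrightarrow> eventually (\<lambda>n. C * \<theta> ^ n < F n \<omega>) sequentially"
        using exists_of_positive_prob_AE[OF I(1), of "\<lambda>\<omega>. (\<exists>C. \<forall>n. F n \<omega> \<le> C) \<and>
          (\<forall>C \<theta>. 0 < \<theta> \<longrightarrow> \<theta> < 1 \<longrightarrow> eventually (\<lambda>n. C * \<theta> ^ n < F n \<omega>) sequentially)"] I(2) p
        by auto
      obtain C where C: "\<And>n. F n \<omega> \<le> C" using \<omega>(2) by blast
      show False
      proof (rule visits_exponential_decay[where F = "\<lambda>n. F n \<omega>" and G = "\<lambda>m t. F m (seq_shift t \<omega>)"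
            and V = "{t. seq_shift t \<omega> \<in> A'}" and N = "Suc n" and c = "P.prob A' / 2"])
        show "\<exists>k\<ge>m. P.prob A' / 2 * real k \<le> real (card ({t. seq_shift t \<omega> \<in> A'} \<inter> {..<k}))" for m
          using \<omega>(1) by blast
      qed (use F0 C sub contr p \<omega>(3) in auto)
    qed
    then have "AE \<omega> in S. \<omega> \<notin> B" using B by (simp add: P.prob_eq_0)
    then show ?thesis using AE_space[of S] by eventually_elim (auto simp: B_def)
  qed
  then have "AE \<omega> in S. \<forall>n. c \<le> F n \<omega>" by (simp add: AE_all_countable)
  then show ?thesis by eventually_elim (use c in blast)
qed

end

subsection \<open>Measurability on the space of germs\<close>

text \<open>The function below is the k-th Taylor coefficient, up to the factor k!, of a germ along the
  complex line through z. Unlike point evaluations, which are only defined on part of the space of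
  germs, these functionals are continuous for the inductive limit topology.\<close>

definition line_coeff :: "nat \<Rightarrow> 2 \<Rightarrow> c2 \<Rightarrow> germ \<Rightarrow> complex" where
  "line_coeff k i z g = (deriv ^^ k) (\<lambda>t. (SOME h. \<exists>W. represents h W g) (t *s z) $ i) 0"

lemma represents_exists: "\<exists>h W. represents h W g"
proof -
  obtain r f where rf: "0 < r" "holo_on (ball 0 r) f" "Rep_germ g = germ_class f"
    using Rep_germ[of g] by blast
  then have "represents f (ball 0 r) g" unfolding represents_def by simp
  then show ?thesis by blast
qed

lemma line_coeff_eq:
  assumes "represents h W g"
  shows "line_coeff k i z g = (deriv ^^ k) (\<lambda>t. h (t *s z) $ i) 0"
proof -
  let ?h = "SOME h. \<exists>W. represents h W g"
  have "\<exists>W. represents ?h W g" by (rule someI_ex[OF represents_exists])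
  then obtain W' where W': "represents ?h W' g" by blast
  obtain s where s: "0 < s" "\<And>z. z \<in> ball 0 s \<Longrightarrow> ?h z = h z"
    by (rule represents_near[OF W' assms], rule that)
  have "open {t. 0 + t *s z \<in> ball 0 s}" by (rule open_line_preimage) simp
  then have "eventually (\<lambda>t. t \<in> {t. 0 + t *s z \<in> ball 0 s}) (nhds 0)"
    using s(1) by (intro eventually_nhds_in_open) auto
  then have "eventually (\<lambda>t. ?h (t *s z) $ i = h (t *s z) $ i) (nhds 0)"
    by eventually_elim (use s(2) in simp)
  then show ?thesis unfolding line_coeff_def by (intro higher_deriv_cong_ev) auto
qed

lemma line_coeff_diff_bound:
  assumes h: "holo_on (ball 0 r) h" and h': "holo_on (ball 0 r) h'" and r: "0 < r"
    and B: "\<And>z. z \<in> ball 0 r \<Longrightarrow> dist (h z) (h' z) \<le> B"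
  shows "cmod ((deriv ^^ k) (\<lambda>t. h (t *s z) $ i) 0 - (deriv ^^ k) (\<lambda>t. h' (t *s z) $ i) 0)
    \<le> fact k * B / (r / (2 * (1 + norm z))) ^ k"
proof -
  \<comment> \<open>For |t| at most s the point t z has norm at most r/2; the 1 added to the norm
    covers z = 0.\<close>
  define s where "s = r / (2 * (1 + norm z))"
  have n: "0 < 1 + norm z" using norm_ge_zero[of z] by linarith
  have s: "0 < s" unfolding s_def using r n by simp
  have im: "0 + t *s z \<in> ball 0 r" if "cmod t \<le> s" for t
  proof -
    have "cmod t * norm z \<le> s * norm z" using that by (intro mult_right_mono) auto
    also have "\<dots> \<le> s * (1 + norm z)" using s by (intro mult_left_mono) auto
    also have "s * (1 + norm z) = r / 2"
    proof -
      define w where "w = 1 + norm z"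
      have "w > 0" using n by (simp add: w_def)
      then show ?thesis unfolding s_def w_def[symmetric] by simp
    qed
    finally show ?thesis using r by (simp add: norm_scale_c2)
  qed
  let ?T = "{t. 0 + t *s z \<in> ball 0 r}"
  have T: "open ?T" by (rule open_line_preimage) simp
  have hol: "(\<lambda>t. h (0 + t *s z) $ i) holomorphic_on ?T" "(\<lambda>t. h' (0 + t *s z) $ i) holomorphic_on ?T"
    by (rule line_holomorphic[OF h] line_holomorphic[OF h'], simp)+
  let ?d = "\<lambda>t. h (t *s z) $ i - h' (t *s z) $ i"
  have eq: "(deriv ^^ k) ?d 0 = (deriv ^^ k) (\<lambda>t. h (t *s z) $ i) 0 - (deriv ^^ k) (\<lambda>t. h' (t *s z) $ i) 0"
    using higher_deriv_diff[OF hol T, of 0 k] r by simp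
  have "?d holomorphic_on ?T" using holomorphic_on_diff[OF hol] by simp
  then have dc: "?d holomorphic_on cball 0 s" by (rule holomorphic_on_subset) (use im in auto)
  have "cmod ((deriv ^^ k) ?d 0) \<le> fact k * B / s ^ k"
  proof (rule Cauchy_inequality[OF _ _ s])
    show "?d holomorphic_on ball 0 s" using holomorphic_on_subset[OF dc] ball_subset_cball by blast
    show "continuous_on (cball 0 s) ?d" by (rule holomorphic_on_imp_continuous_on[OF dc])
    fix x :: complex assume "norm (0 - x) = s"
    then have x: "x *s z \<in> ball 0 r" using im[of x] by simp
    have "norm (?d x) \<le> norm (h (x *s z) - h' (x *s z))"
      using norm_nth_c2[of "h (x *s z) - h' (x *s z)" i] by simp
    then show "norm (?d x) \<le> B" using B[OF x] by (simp add: dist_norm)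
  qed
  then show ?thesis unfolding eq s_def .
qed

lemma Xn_repn: "g \<in> Xn n \<Longrightarrow> bdd_rep (repn n g) (eps n) g"
  unfolding Xn_def repn_def mem_Collect_eq by (rule someI_ex[where P = "\<lambda>h. bdd_rep h (eps n) g"])

lemma repn_dist:
  assumes "g \<in> Xn n" "g' \<in> Xn n" "z \<in> ball 0 (eps n)"
  shows "dist (repn n g z) (repn n g' z) \<le> dn n g g'"
proof -
  obtain B B' where B: "\<And>z. z \<in> ball 0 (eps n) \<Longrightarrow> norm (repn n g z) \<le> B"
    "\<And>z. z \<in> ball 0 (eps n) \<Longrightarrow> norm (repn n g' z) \<le> B'"
    using Xn_repn[OF assms(1)] Xn_repn[OF assms(2)] unfolding bdd_rep_def bounded_iff by blast
  have "bdd_above ((\<lambda>z. dist (repn n g z) (repn n g' z)) ` ball 0 (eps n))"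
  proof (rule bdd_aboveI2)
    fix z :: c2 assume z: "z \<in> ball 0 (eps n)"
    show "dist (repn n g z) (repn n g' z) \<le> B + B'"
      using B(1)[OF z] B(2)[OF z] norm_triangle_ineq4[of "repn n g z" "repn n g' z"] by (simp add: dist_norm)
  qed
  then show ?thesis unfolding dn_def using assms(3) by (intro cSUP_upper)
qed

text \<open>On each \<open>Xn n\<close> the Cauchy inequality makes the coefficient Lipschitz for
  \<open>dn n\<close>, which is what openness in the inductive limit asks for.\<close>

lemma line_coeff_preimage_open:
  assumes V: "open V" shows "germ_open (line_coeff k i z -` V)"
  unfolding germ_open_def
proof (intro allI ballI)
  fix n g assume "g \<in> line_coeff k i z -` V \<inter> Xn n"
  then have g: "line_coeff k i z g \<in> V" "g \<in> Xn n" by auto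
  obtain e where e: "0 < e" "ball (line_coeff k i z g) e \<subseteq> V" using V g(1) open_contains_ball by metis
  define s where "s = (eps n / (2 * (1 + norm z))) ^ k"
  have n: "0 < 1 + norm z" using norm_ge_zero[of z] by linarith
  have ep: "0 < eps n" by (simp add: eps_def)
  have s: "0 < s" unfolding s_def using n ep by simp
  show "\<exists>\<delta>>0. \<forall>g'\<in>Xn n. dn n g g' < \<delta> \<longrightarrow> g' \<in> line_coeff k i z -` V"
  proof (intro exI[of _ "e * s / fact k"] conjI ballI impI)
    show "0 < e * s / fact k" using e s by simp
    fix g' assume g': "g' \<in> Xn n" "dn n g g' < e * s / fact k"
    have rep: "represents (repn n g) (ball 0 (eps n)) g" "represents (repn n g') (ball 0 (eps n)) g'"
      using Xn_repn[OF g(2)] Xn_repn[OF g'(1)] by (simp_all add: bdd_rep_def)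
    have "cmod (line_coeff k i z g - line_coeff k i z g') \<le> fact k * dn n g g' / s"
      unfolding line_coeff_eq[OF rep(1)] line_coeff_eq[OF rep(2)] s_def
      using rep ep repn_dist[OF g(2) g'(1)]
      by (intro line_coeff_diff_bound) (auto simp: represents_def)
    also have "\<dots> < e" using g'(2) s by (simp add: field_simps)
    finally have "line_coeff k i z g' \<in> ball (line_coeff k i z g) e" by (simp add: dist_norm)
    then show "g' \<in> line_coeff k i z -` V" using e(2) by blast
  qed
qed

lemma dgerm_line_coeff: "dgerm g $ i $ j = line_coeff 1 i (axis j 1) g"
proof -
  obtain h W where h: "represents h W g" using represents_exists by blast
  then have hW: "holo_on W h" "0 \<in> W" by (auto simp: represents_def)
  have "deriv (\<lambda>t. h (t *s axis j 1) $ i) 0 = (dmat h 0 *v axis j 1) $ i"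
    using line_field_derivative[OF hW(1), of 0 0 "axis j 1" i] hW(2) by (intro DERIV_imp_deriv) simp
  then show ?thesis unfolding line_coeff_eq[OF h] dgerm_eq_dmat[OF h] dmat_entry[of h 0 i j] by simp
qed

text \<open>The Taylor series of t \<mapsto> h (t z) converges on a disc of radius R / |z| > 1, so
  it may be evaluated at t = 1. This exhibits evaluation at z as a limit of measurable functions of
  the germ.\<close>

lemma line_coeff_sums:
  assumes "bdd_rep h R g" "norm z < R"
  shows "(\<lambda>k. line_coeff k i z g / fact k) sums (h z $ i)"
proof -
  have h: "represents h (ball 0 R) g" "holo_on (ball 0 R) h" using assms(1) by (auto simp: bdd_rep_def represents_def)
  have R: "0 < R" using assms(2) norm_ge_zero[of z] by linarith
  define \<rho> where "\<rho> = (if z = 0 then 2 else R / norm z)"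
  have \<rho>: "1 < \<rho>" using assms(2) by (simp add: \<rho>_def)
  have im: "0 + t *s z \<in> ball 0 R" if "t \<in> ball 0 \<rho>" for t
    using that R by (cases "z = 0") (simp_all add: \<rho>_def norm_scale_c2 field_simps)
  have "(\<lambda>t. h (0 + t *s z) $ i) holomorphic_on ball 0 \<rho>" by (rule line_holomorphic[OF h(2) im])
  then have "(\<lambda>t. h (t *s z) $ i) holomorphic_on ball 0 \<rho>" by simp
  from holomorphic_power_series[OF this, of 1] \<rho> show ?thesis
    by (simp add: line_coeff_eq[OF h(1)])
qed

lemma borel_measurable_c2:
  assumes "\<And>i. (\<lambda>x. (f x :: c2) $ i) \<in> borel_measurable N"
  shows "f \<in> borel_measurable N"
proof -
  have m: "(\<lambda>x. f x $ i *s axis i (1::complex)) \<in> borel_measurable N" for i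
    by (rule borel_measurable_continuous_on[OF linear_continuous_on[OF bounded_linear_line] assms])
  have e: "f = (\<lambda>x. f x $ 1 *s axis 1 1 + f x $ 2 *s axis 2 1)"
    by (simp add: fun_eq_iff vec_eq_iff forall_2 axis_def)
  show ?thesis by (subst e) (intro borel_measurable_add m)
qed

section \<open>Measurable events on sequences of germs\<close>

context
  fixes \<nu> :: "germ measure"
  assumes sets_nu: "sets \<nu> = sets (sigma UNIV {U. openin germ_top U})"
begin

lemma space_nu: "space \<nu> = UNIV"
  using sets_eq_imp_space_eq[OF sets_nu] by simp

lemma openin_sets: "openin germ_top U \<Longrightarrow> U \<in> sets \<nu>"
  unfolding sets_nu by simp

lemma germ_open_sets: "germ_open U \<Longrightarrow> U \<in> sets \<nu>"
  by (rule openin_sets) (simp add: germ_top_def topology_generated_by_Basis)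

lemma line_coeff_measurable [measurable]: "line_coeff k i z \<in> borel_measurable \<nu>"
  by (rule borel_measurableI) (simp add: space_nu germ_open_sets line_coeff_preimage_open)

text \<open>The complement is the union of all null open sets, hence open and measurable, whatever
  its measure.\<close>

lemma supp_sets: "supp \<nu> \<in> sets \<nu>"
proof -
  have "- supp \<nu> = \<Union>{U. openin germ_top U \<and> emeasure \<nu> U = 0}"
    unfolding supp_def by (auto simp: zero_less_iff_neq_zero)
  then have "openin germ_top (- supp \<nu>)" by auto
  then have "UNIV - (- supp \<nu>) \<in> sets \<nu>" using openin_sets sets.compl_sets[of "- supp \<nu>" \<nu>] space_nu by metis
  then show ?thesis by (simp add: Compl_eq_Diff_UNIV[symmetric])
qed

text \<open>Outside its natural domain the evaluation is redirected to a point of norm R, so that an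
  orbit that leaves the ball of radius R is absorbed there.\<close>

definition eval_abs :: "real \<Rightarrow> germ \<Rightarrow> c2 \<Rightarrow> c2" where
  "eval_abs R g z = (if g \<in> supp \<nu> \<and> norm z < R then repR R g z else axis 1 (complex_of_real R))"

lemma repR_bdd_rep: "R_ok \<nu> R \<Longrightarrow> g \<in> supp \<nu> \<Longrightarrow> bdd_rep (repR R g) R g"
  unfolding R_ok_def repR_def by (rule someI_ex[where P = "\<lambda>h. bdd_rep h R g"]) blast

lemma eval_abs_measurable_germ:
  assumes "R_ok \<nu> R" shows "(\<lambda>g. eval_abs R g z) \<in> borel_measurable \<nu>"
proof (rule borel_measurable_c2)
  fix i
  let ?s = "\<lambda>K g. if g \<in> supp \<nu> \<and> norm z < R then (\<Sum>k<K. line_coeff k i z g / fact k)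
    else axis 1 (complex_of_real R) $ i"
  show "(\<lambda>g. eval_abs R g z $ i) \<in> borel_measurable \<nu>"
  proof (rule borel_measurable_LIMSEQ_metric)
    show "?s K \<in> borel_measurable \<nu>" for K using supp_sets by measurable
    fix g show "(\<lambda>K. ?s K g) \<longlonglongrightarrow> eval_abs R g z $ i"
      using line_coeff_sums[OF repR_bdd_rep[OF assms]] by (auto simp: eval_abs_def sums_def)
  qed
qed

text \<open>A function measurable in the germ and continuous in the point is jointly measurable:
  approximate the point by simple functions and treat each value separately.\<close>

lemma eval_abs_measurable:
  assumes R: "R_ok \<nu> R" and u: "u \<in> borel_measurable N" and G: "G \<in> measurable N \<nu>"
  shows "(\<lambda>x. eval_abs R (G x) (u x)) \<in> borel_measurable N"
proof -
  obtain F where F: "\<And>i. simple_function N (F i)" "\<And>x. x \<in> space N \<Longrightarrow> (\<lambda>i. F i x) \<longlonglongrightarrow> u x"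
    using borel_measurable_implies_sequence_metric[OF u, of 0] by blast
  let ?b = "axis 1 (complex_of_real R) :: c2"
  have "(\<lambda>x. eval_abs R (G x) (F i x)) \<in> borel_measurable N" for i
  proof (rule measurable_compose_countable'[where I = "F i ` space N" and g = "F i"
        and f = "\<lambda>q x. eval_abs R (G x) q"])
    show "(\<lambda>x. eval_abs R (G x) q) \<in> borel_measurable N" for q
      by (rule measurable_compose[OF G eval_abs_measurable_germ[OF R]])
    have "finite (F i ` space N)" using F(1) simple_function_def by blast
    then show "countable (F i ` space N)" by (rule countable_finite)
    show "F i \<in> measurable N (count_space (F i ` space N))"
      using F(1)[of i] by (subst measurable_count_space_eq_countable)
        (auto simp: simple_function_def intro: countable_finite)
  qed
  \<comment> \<open>Where the limit point is not in the open ball, approximating points may still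
    lie inside it; the guard on u x removes the resulting discontinuity of
    \<open>eval_abs\<close>.\<close>
  then have m: "(\<lambda>x. if norm (u x) < R then eval_abs R (G x) (F i x) else ?b) \<in> borel_measurable N" for i
    using u by measurable
  show ?thesis
  proof (rule borel_measurable_LIMSEQ_metric[OF m])
    fix x assume x: "x \<in> space N"
    show "(\<lambda>i. if norm (u x) < R then eval_abs R (G x) (F i x) else ?b) \<longlonglongrightarrow> eval_abs R (G x) (u x)"
    proof (cases "norm (u x) < R \<and> G x \<in> supp \<nu>")
      case True
      then have ux: "u x \<in> ball 0 R" by simp
      have c: "continuous_on (ball 0 R) (repR R (G x))"
        using repR_bdd_rep[OF R] True holo_on_continuous by (auto simp: bdd_rep_def represents_def)
      have ev: "eventually (\<lambda>i. F i x \<in> ball 0 R) sequentially"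
        using F(2)[OF x] open_ball ux by (rule topological_tendstoD)
      have "(\<lambda>i. repR R (G x) (F i x)) \<longlonglongrightarrow> repR R (G x) (u x)"
        by (rule continuous_on_tendsto_compose[OF c F(2)[OF x] ux ev])
      then have "(\<lambda>i. if norm (u x) < R then eval_abs R (G x) (F i x) else ?b) \<longlonglongrightarrow> repR R (G x) (u x)"
      proof (rule Lim_transform_eventually)
        show "eventually (\<lambda>i. repR R (G x) (F i x) = (if norm (u x) < R then eval_abs R (G x) (F i x) else ?b)) sequentially"
          using ev by eventually_elim (use True in \<open>simp add: eval_abs_def\<close>)
      qed
      then show ?thesis using True by (simp add: eval_abs_def)
    next
      case False
      then have "(\<lambda>i. if norm (u x) < R then eval_abs R (G x) (F i x) else ?b) = (\<lambda>_. ?b)"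
        by (auto simp: fun_eq_iff eval_abs_def)
      moreover have "eval_abs R (G x) (u x) = ?b" using False by (auto simp: eval_abs_def)
      ultimately show ?thesis by simp
    qed
  qed
qed

primrec iter_abs :: "real \<Rightarrow> nat \<Rightarrow> c2 \<Rightarrow> (nat \<Rightarrow> germ) \<Rightarrow> c2" where
  "iter_abs R 0 z \<omega> = z"
| "iter_abs R (Suc n) z \<omega> = eval_abs R (\<omega> n) (iter_abs R n z \<omega>)"

lemma iter_abs_measurable:
  assumes "R_ok \<nu> R" shows "iter_abs R n z \<in> borel_measurable (PiM UNIV (\<lambda>_::nat. \<nu>))"
proof (induction n)
  case (Suc n)
  have "(\<lambda>\<omega>. eval_abs R (\<omega> n) (iter_abs R n z \<omega>)) \<in> borel_measurable (PiM UNIV (\<lambda>_::nat. \<nu>))"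
    by (rule eval_abs_measurable[OF assms Suc]) measurable
  then show ?case by (simp add: fun_eq_iff)
qed simp

text \<open>The two iterations agree while the orbit stays below R, and either bound guarantees that
  inductively. Only the bounds are compared, since the orbits may differ after an exit.\<close>

lemma iter_abs_eq_iterR:
  assumes R: "0 < R" and supp: "\<And>n. \<omega> n \<in> supp \<nu>"
  shows "(\<forall>n. norm (iter_abs R n z \<omega>) \<le> R/2) \<longleftrightarrow> (\<forall>n. norm (iterR R \<omega> n z) \<le> R/2)"
proof
  assume b: "\<forall>n. norm (iter_abs R n z \<omega>) \<le> R/2"
  have "iter_abs R n z \<omega> = iterR R \<omega> n z" for n
  proof (induction n)
    case (Suc n)
    have "norm (iter_abs R n z \<omega>) < R" using b[rule_format, of n] R by simp
    then show ?case using supp Suc by (simp add: eval_abs_def)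
  qed simp
  then show "\<forall>n. norm (iterR R \<omega> n z) \<le> R/2" using b by simp
next
  assume b: "\<forall>n. norm (iterR R \<omega> n z) \<le> R/2"
  have "iter_abs R n z \<omega> = iterR R \<omega> n z" for n
  proof (induction n)
    case (Suc n)
    have "norm (iterR R \<omega> n z) < R" using b[rule_format, of n] R by simp
    then show ?case using supp Suc by (simp add: eval_abs_def)
  qed simp
  then show "\<forall>n. norm (iter_abs R n z \<omega>) \<le> R/2" using b by simp
qed

lemma prodM_entry_measurable: "(\<lambda>\<omega>. prodM \<omega> n $ i $ j) \<in> borel_measurable (PiM UNIV (\<lambda>_::nat. \<nu>))"
proof (induction n arbitrary: i j)
  case (Suc n)
  have d: "(\<lambda>\<omega>. dgerm (\<omega> n) $ i $ j) \<in> borel_measurable (PiM UNIV (\<lambda>_::nat. \<nu>))" for i j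
    unfolding dgerm_line_coeff by measurable
  show ?case unfolding prodM.simps mat2_mult_entry by (intro borel_measurable_add borel_measurable_times d Suc)
qed simp

lemma msize_prodM_measurable: "(\<lambda>\<omega>. msize (prodM \<omega> n)) \<in> borel_measurable (PiM UNIV (\<lambda>_::nat. \<nu>))"
  unfolding msize_def using prodM_entry_measurable by measurable

end

subsection \<open>The random Fatou set\<close>

text \<open>The Cauchy estimate with bound R / 2 gives 2 R / a for each of the four entries.\<close>

lemma prodM_bounded:
  assumes R: "0 < R" and rep: "\<And>k. bdd_rep (repR R (\<omega> k)) R (\<omega> k)"
    and a: "stays_bounded R a \<omega>" "0 < a"
  shows "msize (prodM \<omega> n) \<le> 8 * R / a"
proof -
  have e: "cmod (prodM \<omega> n $ i $ j) \<le> 2 * R / a" for i j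
  proof -
    have "norm (dmat (iterR R \<omega> n) 0 *v axis j 1) \<le> 4 * (R/2) / a * norm (axis j (1::complex) :: c2)"
      using a by (intro Cauchy_estimate_dmat iterR_holo[OF R rep a(1)]) (auto simp: stays_bounded_def)
    then have "norm (prodM \<omega> n *v axis j 1) \<le> 2 * R / a"
      by (simp add: dmat_iterR[OF R rep a] norm_axis_1)
    moreover have "(prodM \<omega> n *v axis j 1) $ i = prodM \<omega> n $ i $ j"
      using exhaust_2[of j] by (auto simp: mat2_vec_entry axis_def)
    ultimately show ?thesis using norm_nth_c2[of "prodM \<omega> n *v axis j 1" i] by simp
  qed
  have "msize (prodM \<omega> n) \<le> 2 * R / a + 2 * R / a + 2 * R / a + 2 * R / a"
    unfolding msize_def by (intro add_mono e)
  also have "\<dots> = 8 * R / a" by simp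
  finally show ?thesis .
qed

text \<open>The bound must be extended from D to the whole ball at each n before going on:
  continuity of the next iterate on the ball requires it. The condition on a settles n = 0.\<close>

lemma stays_bounded_of_dense:
  assumes R: "0 < R" and rep: "\<And>k. bdd_rep (repR R (\<omega> k)) R (\<omega> k)" and a: "a \<le> R/2"
    and D: "\<And>X. open X \<Longrightarrow> X \<noteq> {} \<Longrightarrow> \<exists>d\<in>D. d \<in> X"
    and b: "\<And>q n. q \<in> D \<Longrightarrow> norm q < a \<Longrightarrow> norm (iterR R \<omega> n q) \<le> R/2"
  shows "stays_bounded R a \<omega>"
proof -
  have "holo_on (ball 0 a) (iterR R \<omega> n) \<and> (\<forall>z\<in>ball 0 a. norm (iterR R \<omega> n z) \<le> R/2)" for n
  proof (induction n)
    case 0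
    then show ?case using holo_on_id[of "ball 0 a"] a by (simp add: id_def)
  next
    case (Suc n)
    have "iterR R \<omega> n z \<in> ball 0 R" if z: "z \<in> ball 0 a" for z
    proof -
      have "norm (iterR R \<omega> n z) \<le> R/2" using Suc z by blast
      then show ?thesis using R by simp
    qed
    moreover have "holo_on (ball 0 R) (repR R (\<omega> n))" by (rule rep_holo(1)[OF R]) (rule rep)
    ultimately have "holo_on (ball 0 a) (\<lambda>z. repR R (\<omega> n) (iterR R \<omega> n z))"
      using holo_on_compose[OF conjunct1[OF Suc]] by blast
    then have h: "holo_on (ball 0 a) (iterR R \<omega> (Suc n))" by (simp only: iterR_Suc_fun)
    have "norm (iterR R \<omega> (Suc n) z) \<le> R/2" if z: "z \<in> ball 0 a" for z
    proof (rule ccontr)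
      assume n: "\<not> ?thesis"
      let ?X = "ball 0 a \<inter> (\<lambda>z. norm (iterR R \<omega> (Suc n) z)) -` {R/2<..}"
      have "continuous_on (ball 0 a) (\<lambda>z. norm (iterR R \<omega> (Suc n) z))"
        by (rule continuous_on_norm[OF holo_on_continuous[OF h]])
      then have "open ?X" by (rule continuous_open_preimage) auto
      moreover have "z \<in> ?X" using z n by simp
      ultimately obtain d where "d \<in> D" "d \<in> ?X" using D by blast
      then show False using b[of d "Suc n"] by simp
    qed
    then show ?case using h by blast
  qed
  then show ?thesis unfolding stays_bounded_def by blast
qed

lemma compo_holo:
  assumes "\<And>n. represents (h n) (W n) (\<omega> n)" "\<And>z n. z \<in> ball 0 r \<Longrightarrow> compo h n z \<in> W n"
  shows "holo_on (ball 0 r) (compo h n)"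
proof (induction n)
  case (Suc n)
  have "holo_on (W n) (h n)" using assms(1) by (simp add: represents_def)
  from holo_on_compose[OF Suc this assms(2)] show ?case by (simp add: o_def)
qed (use holo_on_id in \<open>simp add: id_def\<close>)

lemma compo_zero:
  assumes "\<And>n. represents (h n) (W n) (\<omega> n)" shows "compo h n 0 = 0"
  by (induction n) (simp_all add: represents_zero[OF assms])

text \<open>Failure gives points tending to 0 whose images have norm above e. Along a subsequence
  the maps converge uniformly to a continuous g with g 0 = 0, so the images would tend to 0.\<close>

lemma normal_fam_equicontinuous_at_zero:
  assumes rep: "\<And>n. represents (h n) (W n) (\<omega> n)" and W: "\<And>z n. z \<in> ball 0 r \<Longrightarrow> compo h n z \<in> W n"
    and r: "0 < r" and normal: "normal_fam (ball 0 r) (range (compo h))" and e: "0 < e"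
  shows "\<exists>\<delta>>0. \<delta> \<le> r \<and> (\<forall>z\<in>ball 0 \<delta>. \<forall>n. norm (compo h n z) \<le> e)"
proof (rule ccontr)
  assume no: "\<not> ?thesis"
  \<comment> \<open>Dividing by m + 2 places all points in the compact ball of radius r/2, where
    convergence is uniform.\<close>
  have "\<exists>z n. norm z < r / real (m + 2) \<and> e < norm (compo h n z)" for m
  proof -
    have "0 < r / real (m + 2)" "r / real (m + 2) \<le> r" using r by (simp_all add: field_simps)
    then have "\<not> (\<forall>z\<in>ball 0 (r / real (m + 2)). \<forall>n. norm (compo h n z) \<le> e)" using no by blast
    then obtain z n where "z \<in> ball 0 (r / real (m + 2))" "\<not> norm (compo h n z) \<le> e" by blast
    then show ?thesis by (intro exI[of _ z] exI[of _ n]) simp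
  qed
  then obtain z n where zn: "\<And>m. norm (z m) < r / real (m + 2)" "\<And>m. e < norm (compo h (n m) (z m))" by metis
  obtain q g where q: "strict_mono q"
    "\<And>K. compact K \<Longrightarrow> K \<subseteq> ball 0 r \<Longrightarrow> uniform_limit K ((\<lambda>m. compo h (n m)) \<circ> q) g sequentially"
    using normal unfolding normal_fam_def by (metis (no_types, lifting) rangeI)
  let ?K = "cball (0::c2) (r/2)"
  have K: "?K \<subseteq> ball 0 r" using r by auto
  have ul: "uniform_limit ?K (\<lambda>m. compo h (n (q m))) g sequentially"
    using q(2)[OF _ K] by (simp add: o_def)
  have "continuous_on ?K g"
    by (rule uniform_limit_theorem[OF _ ul])
       (use continuous_on_subset[OF holo_on_continuous[OF compo_holo[OF rep W]] K] in auto)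
  moreover have z0: "(\<lambda>m. z (q m)) \<longlonglongrightarrow> 0"
  proof -
    have "(\<lambda>m. r * inverse (real (Suc (Suc m)))) \<longlonglongrightarrow> r * 0"
      by (intro tendsto_intros LIMSEQ_Suc[OF LIMSEQ_inverse_real_of_nat])
    then have "(\<lambda>m. r / real (m + 2)) \<longlonglongrightarrow> 0" by (simp add: divide_inverse)
    then have "z \<longlonglongrightarrow> 0" by (rule Lim_null_comparison[rotated]) (use zn(1) in \<open>simp add: less_imp_le\<close>)
    from LIMSEQ_subseq_LIMSEQ[OF this q(1)] show ?thesis by (simp add: o_def)
  qed
  moreover have "z m \<in> ?K" for m
  proof -
    have "r / real (m + 2) \<le> r / 2" using r by (intro divide_left_mono) auto
    then have "norm (z m) \<le> r/2" using zn(1)[of m] by linarith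
    then show ?thesis by simp
  qed
  ultimately have "(\<lambda>m. compo h (n (q m)) (z (q m))) \<longlonglongrightarrow> g 0"
    using r by (intro uniform_limit_compose_tendsto[OF ul]) auto
  moreover have "g 0 = 0"
  proof -
    have "(\<lambda>m. compo h (n (q m)) 0) \<longlonglongrightarrow> g 0" using ul r by (intro tendsto_uniform_limitI) auto
    then show ?thesis using LIMSEQ_unique[OF _ tendsto_const] by (simp add: compo_zero[OF rep])
  qed
  ultimately have "(\<lambda>m. norm (compo h (n (q m)) (z (q m)))) \<longlonglongrightarrow> 0" using tendsto_norm_zero by simp
  then have "e \<le> 0" by (rule tendsto_lowerbound) (use zn(2) in \<open>simp_all add: less_imp_le\<close>)
  then show False using e by simp
qed

text \<open>The representatives in the Fatou hypothesis need not be \<open>repR\<close>. They agree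
  with it near 0, and the identity theorem on the ball of radius \<open>\<delta>\<close> extends the
  agreement of the iterates.\<close>

lemma fatou_imp_stays_bounded:
  assumes R: "0 < R" and rep: "\<And>k. bdd_rep (repR R (\<omega> k)) R (\<omega> k)"
    and h: "\<And>n. represents (h n) (W n) (\<omega> n)" and W: "\<And>z n. z \<in> ball 0 r \<Longrightarrow> compo h n z \<in> W n"
    and r: "0 < r" and normal: "normal_fam (ball 0 r) (range (compo h))"
  shows "\<exists>\<delta>>0. stays_bounded R \<delta> \<omega>"
proof -
  obtain \<delta> where \<delta>: "0 < \<delta>" "\<delta> \<le> r" "\<And>z n. z \<in> ball 0 \<delta> \<Longrightarrow> norm (compo h n z) \<le> R/2"
    using normal_fam_equicontinuous_at_zero[OF h W r normal, of "R/2"] R by (metis half_gt_zero)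
  have hol: "holo_on (ball 0 \<delta>) (compo h n)" for n
    by (rule holo_on_subset[OF compo_holo[OF h W] subset_ball[OF \<delta>(2)]])
  have "\<forall>z\<in>ball 0 \<delta>. iterR R \<omega> n z = compo h n z" for n
  proof (induction n)
    case (Suc n)
    have inR: "compo h n z \<in> ball 0 R" if "z \<in> ball 0 \<delta>" for z using \<delta>(3)[OF that, of n] R by simp
    have "holo_on (ball 0 R) (repR R (\<omega> n))" by (rule rep_holo(1)[OF R]) (rule rep)
    then have h1: "holo_on (ball 0 \<delta>) (\<lambda>z. repR R (\<omega> n) (compo h n z))"
      by (rule holo_on_compose[OF hol _ inR])
    obtain s where s: "0 < s" "\<And>z. z \<in> ball 0 s \<Longrightarrow> repR R (\<omega> n) z = h n z"
      by (rule represents_near[OF _ h[of n]]) (use rep[of n] that in \<open>auto simp: bdd_rep_def\<close>)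
    have "open (ball 0 \<delta> \<inter> compo h n -` ball 0 s)"
      by (rule continuous_open_preimage[OF holo_on_continuous[OF hol]]) auto
    moreover have "0 \<in> ball 0 \<delta> \<inter> compo h n -` ball 0 s"
      using \<delta>(1) s(1) by (simp add: compo_zero[OF h])
    ultimately obtain e where e: "0 < e" "ball 0 e \<subseteq> ball 0 \<delta> \<inter> compo h n -` ball 0 s"
      using open_contains_ball by metis
    have "repR R (\<omega> n) (compo h n z) = compo h (Suc n) z" if z: "z \<in> ball 0 \<delta>" for z
    proof (rule holo_on_identity[OF h1 hol _ e(1) _ z])
      show "(0::c2) \<in> ball 0 \<delta>" using \<delta>(1) by simp
      fix y :: c2 assume "y \<in> ball 0 e"
      then show "repR R (\<omega> n) (compo h n y) = compo h (Suc n) y" using e(2) s(2) by auto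
    qed
    then show ?case using Suc by simp
  qed simp
  then have "stays_bounded R \<delta> \<omega>" using \<delta>(3) by (simp add: stays_bounded_def)
  then show ?thesis using \<delta>(1) by blast
qed

lemma stays_bounded_mono: "stays_bounded R a \<omega> \<Longrightarrow> b \<le> a \<Longrightarrow> stays_bounded R b \<omega>"
  unfolding stays_bounded_def by auto

theorem theorem1p2:
  fixes \<nu> :: "germ measure" and R :: real
  assumes "prob_space \<nu>"
    and "sets \<nu> = sets (sigma UNIV {U. openin germ_top U})"
    and "compactin germ_top (supp \<nu>)"
    and "semi_neutral \<nu>"
    and "random_fatou \<nu>"
    and "R_ok \<nu> R"
  shows "AE \<omega> in PiM UNIV (\<lambda>_::nat. \<nu>). (\<forall>n. \<omega> n \<in> supp \<nu>) \<longrightarrow>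
     ((\<forall>r g. strict_mono r \<and>
          (\<forall>K. compact K \<and> K \<subseteq> Uom R \<omega> \<longrightarrow>
               uniform_limit K (\<lambda>k. iterR R \<omega> (r k)) g sequentially)
        \<longrightarrow> (\<exists>L. (g has_derivative L) (at 0) \<and> crank L = 1))
      \<and> (\<exists>\<rho>>0. \<forall>z\<in>ball 0 \<rho>. one_dim_submfd_near (Ws R \<omega> z) z))"
proof -
  interpret \<nu>: prob_space \<nu> by fact
  interpret sequence_space \<nu> ..
  have R: "0 < R" using assms(6) by (simp add: R_ok_def)
  have supp: "supp \<nu> \<in> sets \<nu>" by (rule supp_sets[OF assms(2)])
  have rep: "bdd_rep (repR R (\<omega> k)) R (\<omega> k)" if "\<forall>n. \<omega> n \<in> supp \<nu>" for \<omega> k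
    using repR_bdd_rep[OF assms(2,6)] that by blast
  let ?\<Omega> = "{\<omega> \<in> space S. \<forall>n. \<omega> n \<in> supp \<nu>}"
  let ?B = "{\<omega> \<in> space S. \<omega> 0 \<in> supp \<nu>}"
  have \<Omega>: "?\<Omega> \<in> sets S" and B: "?B \<in> sets S" using supp by measurable
  \<comment> \<open>Splitting off the first coordinate gives P(\<open>\<Omega>\<close>) = P(B)
    P(\<open>\<Omega>\<close>): either \<open>\<Omega>\<close> is null and the implication holds
    vacuously almost everywhere, or the support has full measure.\<close>
  have "{\<omega> \<in> space S. \<omega> \<in> ?B \<and> seq_shift 1 \<omega> \<in> ?\<Omega>} = ?\<Omega>"
  proof -
    have "(\<forall>n. \<omega> n \<in> supp \<nu>) \<longleftrightarrow> \<omega> 0 \<in> supp \<nu> \<and> (\<forall>n. seq_shift 1 \<omega> n \<in> supp \<nu>)" for \<omega>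
      unfolding seq_shift_def using not0_implies_Suc by (metis Suc_eq_plus1)
    moreover have "seq_shift 1 \<omega> \<in> space S" if "\<omega> \<in> space S" for \<omega> using that by (simp add: space_S seq_shift_def)
    ultimately show ?thesis by blast
  qed
  moreover have "P.prob {\<omega> \<in> space S. \<omega> \<in> ?B \<and> seq_shift 1 \<omega> \<in> ?\<Omega>} = P.prob ?B * P.prob ?\<Omega>"
    by (rule prob_prefix_shift[OF B \<Omega>]) (auto simp: space_S comb_seq_def split: nat.split)
  ultimately have "P.prob ?\<Omega> = P.prob ?B * P.prob ?\<Omega>" by simp
  then consider "P.prob ?\<Omega> = 0" | "P.prob ?B = 1" by auto
  then show ?thesis
  proof cases
    case 1
    then have "AE \<omega> in S. \<omega> \<notin> ?\<Omega>" using \<Omega> by (simp add: P.prob_eq_0)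
    then show ?thesis using AE_space[of S] by eventually_elim blast
  next
    case 2
    then have "AE \<omega> in S. \<omega> \<in> ?B" by (rule P.AE_prob_1)
    then have "AE \<omega> in S. \<omega> 0 \<in> supp \<nu>" by eventually_elim blast
    then have "AE \<omega> in S. seq_shift n \<omega> 0 \<in> supp \<nu>" for n by (rule AE_seq_shift)
    then have full: "AE \<omega> in S. \<forall>n. \<omega> n \<in> supp \<nu>" by (simp add: AE_all_countable seq_shift_def)
    have lyap: "AE \<omega> in S. (\<lambda>n. det (prodM \<omega> n)) \<longlonglongrightarrow> 0 \<and>
      (\<forall>C \<theta>. 0 < \<theta> \<longrightarrow> \<theta> < 1 \<longrightarrow> eventually (\<lambda>n. C * \<theta> ^ n < msize (prodM \<omega> n)) sequentially)"
      using full assms(4)[unfolded semi_neutral_def]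
    proof eventually_elim
      case (elim \<omega>)
      then obtain \<Lambda> v where \<Lambda>: "(\<lambda>n. psd_root (2*n) (adj (prodM \<omega> n) ** prodM \<omega> n)) \<longlonglongrightarrow> \<Lambda>"
        "v \<noteq> 0" "\<Lambda> *v v = v" "\<And>c v. v \<noteq> 0 \<and> \<Lambda> *v v = c *s v \<Longrightarrow> Re c \<le> 1" "{v. \<Lambda> *v v = v} \<noteq> UNIV"
        by blast
      show ?case
        using oseledets_limit_consequences[OF \<Lambda>(1-3) _ \<Lambda>(5)] \<Lambda>(4) by (intro conjI allI impI) blast+
    qed
    then have "AE \<omega> in S. (\<lambda>n. det (prodM \<omega> n)) \<longlonglongrightarrow> 0" by eventually_elim blast
    then have "AE \<omega> in S. (\<lambda>m. det (prodM (seq_shift n \<omega>) m)) \<longlonglongrightarrow> 0" for n by (rule AE_seq_shift)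
    then have det0: "AE \<omega> in S. \<forall>n. (\<lambda>m. det (prodM (seq_shift n \<omega>) m)) \<longlonglongrightarrow> 0"
      by (simp add: AE_all_countable)

    obtain D :: "c2 set" where D: "countable D" "\<And>X. open X \<Longrightarrow> X \<noteq> {} \<Longrightarrow> \<exists>d\<in>D. d \<in> X"
      using countable_dense_setE by blast
    \<comment> \<open>The measurable form of \<open>stays_bounded\<close> at radius R / (j + 2). The
      2 keeps the radius at most R / 2, so that the identity, the iterate of index 0, satisfies the
      bound.\<close>
    define A where "A j = {\<omega> \<in> space S. (\<forall>n. \<omega> n \<in> supp \<nu>) \<and>
      (\<forall>q\<in>D. norm q < R / real (j + 2) \<longrightarrow> (\<forall>n. norm (iter_abs \<nu> R n q \<omega>) \<le> R/2))}" for j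
    have A: "A j \<in> sets S" for j
    proof -
      have "{\<omega> \<in> space S. \<forall>q\<in>D. norm q < R / real (j + 2) \<longrightarrow> (\<forall>n. norm (iter_abs \<nu> R n q \<omega>) \<le> R/2)} \<in> sets S"
      proof (rule sets.sets_Collect_countable_All'[OF _ D(1)])
        fix q
        note [measurable] = iter_abs_measurable[OF assms(2,6)]
        show "{\<omega> \<in> space S. norm q < R / real (j + 2) \<longrightarrow> (\<forall>n. norm (iter_abs \<nu> R n q \<omega>) \<le> R/2)} \<in> sets S"
          by measurable
      qed
      from sets.Int[OF \<Omega> this] show ?thesis unfolding A_def by (rule back_subst[of "\<lambda>X. X \<in> sets S"]) auto
    qed
    have rad: "R / real (j + 2) \<le> R / real (i + 2)" if "i \<le> j" for i j
      using R that by (intro divide_left_mono) auto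
    have incA: "A i \<subseteq> A j" if "i \<le> j" for i j
      using rad[OF that] unfolding A_def by (auto intro: less_le_trans)
    have A_iff: "\<omega> \<in> A j \<longleftrightarrow> stays_bounded R (R / real (j + 2)) \<omega>"
      if \<omega>: "\<omega> \<in> space S" "\<forall>n. \<omega> n \<in> supp \<nu>" for j \<omega>
    proof -
      have "\<omega> \<in> A j \<longleftrightarrow> (\<forall>q\<in>D. norm q < R / real (j + 2) \<longrightarrow> (\<forall>n. norm (iterR R \<omega> n q) \<le> R/2))"
        unfolding A_def using \<omega> iter_abs_eq_iterR[OF assms(2) R, of \<omega>] by auto
      also have "\<dots> \<longleftrightarrow> stays_bounded R (R / real (j + 2)) \<omega>"
      proof
        assume b: "\<forall>q\<in>D. norm q < R / real (j + 2) \<longrightarrow> (\<forall>n. norm (iterR R \<omega> n q) \<le> R/2)"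
        show "stays_bounded R (R / real (j + 2)) \<omega>"
          by (rule stays_bounded_of_dense[OF R rep[OF \<omega>(2)] _ D(2)]) (use b rad[of 0 j] in auto)
      qed (auto simp: stays_bounded_def)
      finally show ?thesis .
    qed
    have fatou: "AE \<omega> in S. \<exists>j. \<omega> \<in> A j"
      using full assms(5)[unfolded random_fatou_def] AE_space[of S]
    proof eventually_elim
      case (elim \<omega>)
      then obtain r h W where h: "0 < r" "\<And>n. represents (h n) (W n) (\<omega> n)"
        "\<And>z n. z \<in> ball 0 r \<Longrightarrow> compo h n z \<in> W n" "normal_fam (ball 0 r) (range (compo h))"
        by blast
      obtain \<delta> where \<delta>: "0 < \<delta>" "stays_bounded R \<delta> \<omega>"
        using fatou_imp_stays_bounded[OF R rep[OF elim(1)] h(2,3,1,4)] by blast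
      obtain j where "R / \<delta> < real j" using reals_Archimedean2 by blast
      then have "R / real (j + 2) \<le> \<delta>" using \<delta>(1) R by (simp add: field_simps)
      then have "\<omega> \<in> A j" using A_iff[OF elim(3,1)] stays_bounded_mono[OF \<delta>(2)] by blast
      then show ?case by blast
    qed
    have "AE \<omega> in S. \<exists>C. \<forall>n. msize (prodM \<omega> n) \<le> C"
      using full fatou AE_space[of S]
    proof eventually_elim
      case (elim \<omega>)
      then obtain j where "stays_bounded R (R / real (j + 2)) \<omega>" using A_iff by blast
      from prodM_bounded[OF R rep[OF elim(1)] this] R show ?case by auto
    qed
    then have below: "AE \<omega> in S. \<exists>c>0. \<forall>n. c \<le> msize (prodM \<omega> n)"
    proof (rule cocycle_bounded_below[rotated 4])
      show "AE \<omega> in S. \<forall>C \<theta>. 0 < \<theta> \<longrightarrow> \<theta> < 1 \<longrightarrow> eventually (\<lambda>n. C * \<theta> ^ n < msize (prodM \<omega> n)) sequentially"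
        using lyap by eventually_elim blast
      show "(\<lambda>\<omega>. msize (prodM \<omega> n)) \<in> borel_measurable S" for n by (rule msize_prodM_measurable[OF assms(2)])
      show "msize (prodM \<omega> (m + n)) \<le> msize (prodM (seq_shift n \<omega>) m) * msize (prodM \<omega> n)" for m n \<omega>
        unfolding prodM_add by (rule msize_mult)
      have "prodM (comb_seq n \<omega> \<omega>') m = prodM \<omega> m" if "m \<le> n" for m n \<omega> \<omega>'
        using that by (induction m) (simp_all add: comb_seq_less)
      then show "msize (prodM (comb_seq n \<omega> \<omega>') n) = msize (prodM \<omega> n)" for n \<omega> \<omega>' by simp
    qed (rule msize_nonneg)
    have "AE \<omega> in S. \<exists>j. \<forall>m. \<exists>n\<ge>m. seq_shift n \<omega> \<in> A j"
      by (rule AE_infinitely_often_some[OF A incA fatou])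
    with full fatou below det0 AE_space[of S] show ?thesis
    proof eventually_elim
      case (elim \<omega>)
      note reps = rep[OF elim(1)]
      obtain i where i: "stays_bounded R (R / real (i + 2)) \<omega>" using elim A_iff by blast
      have a: "0 < R / real (i + 2)" "R / real (i + 2) \<le> R" using R by (auto simp: field_simps)
      obtain c where c: "0 < c" "\<And>n. c \<le> msize (prodM \<omega> n)" using elim by blast
      obtain j where j: "\<forall>m. \<exists>n\<ge>m. seq_shift n \<omega> \<in> A j" using elim by blast
      have b: "0 < R / real (j + 2)" "R / real (j + 2) \<le> R" using R by (auto simp: field_simps)
      have "stays_bounded R (R / real (j + 2)) (seq_shift n \<omega>)" if "seq_shift n \<omega> \<in> A j" for n
        using that A_iff[of "seq_shift n \<omega>" j] unfolding A_def by blast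
      then have inf: "infinite {n. stays_bounded R (R / real (j + 2)) (seq_shift n \<omega>)}"
        using j unfolding infinite_nat_iff_unbounded_le by blast
      have d: "(\<lambda>m. det (prodM (seq_shift n \<omega>) m)) \<longlonglongrightarrow> 0" for n using elim by blast
      then have d0: "(\<lambda>m. det (prodM \<omega> m)) \<longlonglongrightarrow> 0" using d[of 0] by simp
      have "\<exists>L. (g has_derivative L) (at 0) \<and> crank L = 1"
        if "strict_mono r" "\<forall>K. compact K \<and> K \<subseteq> Uom R \<omega> \<longrightarrow>
               uniform_limit K (\<lambda>k. iterR R \<omega> (r k)) g sequentially" for r g
        by (rule subsequential_limit_crank[OF R reps i a c d0 that(1)]) (use that(2) in blast)
      moreover have "\<exists>\<rho>>0. \<forall>z\<in>ball 0 \<rho>. one_dim_submfd_near (Ws R \<omega> z) z"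
        by (rule stable_sets_submanifolds[OF R reps i a inf b c d])
      ultimately show ?case by blast
    qed
  qed
qed

end
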